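(* Let $(\mathcal{A},\varphi,\psi)$ be a conditionally non-commutative probability space and consider two pairs of distributions, $(\mu_1,\nu_1)$ and $(\mu_2,\nu_2)$, with their respective extensions, $(\Phi_1,\Psi_1)$ and $(\Phi_2,\Psi_2)$, to two pairs of characters on $T(T_+(\mathcal{A}))$. Then the conditionally monotone additive convolution of pairs of characters $$(\Phi_1,\Psi_1)*(\Phi_2,\Psi_2):=\Big(\mathcal{E}_\succ\big(\beta_2+\Psi_2^{*-1}\succ\beta_1\prec\Psi_2\big),\ \Psi_1*\Psi_2\Big),\qquad \Phi_i=\mathcal{E}_\succ(\beta_i),\ i=1,2,$$ is the pair of characters extending the conditionally monotone additive convolution $(\mu_1,\nu_1)\blacktriangleright(\mu_2,\nu_2)$.
   Context: **Probability spaces and distributions.** A non-commutative probability space $(\mathcal{A},\varphi)$ is an associative unital complex algebra $\mathcal{A}$ with a linear functional $\varphi:\mathcal{A}\to\mathbb{C}$, $\varphi(1_{\mathcal{A}})=1$. A conditionally non-commutative probability space $(\mathcal{A},\varphi,\psi)$ has in addition a second linear functional $\psi$ with $\psi(1_{\mathcal{A}})=1$. The distribution of a random variable $a\in\mathcal{A}$ in $(\mathcal{A},\varphi,\psi)$ is the pair $(\mu,\nu)$ of linear functionals on $\mathbb{C}[X]$ with $\mu(X^n)=\varphi(a^n)$, $\nu(X^n)=\psi(a^n)$, $n\ge0$. $\delta_0$ is the distribution of $0$: $\delta_0(1)=1$, $\delta_0(X^n)=0$ for $n\ge1$. **Convolutions.** Let $\mathrm{NC}(n)$ be the set of non-crossing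 partitions of $[n]=\{1,\dots,n\}$. A block $V$ of $\pi$ is inner if some other block contains $a,b$ with $a<c<b$ for all $c\in V$; otherwise $V$ is outer. The free cumulants $k_n(\nu)$ of a distribution $\nu$ are defined by $\nu(X^n)=\sum_{\pi\in\mathrm{NC}(n)}\prod_{V\in\pi}k_{|V|}(\nu)$; the free convolution $\nu_1\boxplus\nu_2$ is the distribution with $k_n(\nu_1\boxplus\nu_2)=k_n(\nu_1)+k_n(\nu_2)$ for all $n$. The c-free cumulants $k_n^{(c)}(\mu,\nu)$ are defined by $$\mu(X^n)=\sum_{\pi\in\mathrm{NC}(n)}\prod_{V\text{ outer}}k^{(c)}_{|V|}(\mu,\nu)\prod_{V\text{ inner}}k_{|V|}(\nu).$$ The distribution $\mu_1\,{}_{\nu_1}\!\boxplus_{\nu_2}\mu_2$ is the distribution $\mu$ with $k_n^{(c)}(\mu,\nu_1\boxplus\nu_2)=k_n^{(c)}(\mu_1,\nu_1)+k_n^{(c)}(\mu_2,\nu_2)$ for all $n\ge1$. Subalgebras $\mathcal{A}_1,\mathcal{A}_2$ (not necessarily unital) of $(\mathcal{A},\varphi)$ are monotone independent if $\varphi(x_1\cdots x_n)=\varphi(x_\ell)\varphi(x_1\cdots x_{\ell-1}x_{\ell+1}\cdots x_n)$ whenever $x_j\in\mathcal{A}_{i_j}$, $i_j\neq i_{j+1}$, and $i_{\ell-1}<i_\ell>i_{\ell+1}$ (the condition involving a non-existent neighbour being omitted when $\ell=1$ or $\ell=n$). The monotone convolution $\nu_1\blacktriangleright\nu_2$ is the distribution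 of $x+y$ for $x,y$ with distributions $\nu_1,\nu_2$ in some non-commutative probability space such that the (non-unital) subalgebras generated by $x$ and by $y$, in this order, are monotone independent; it depends only on $\nu_1,\nu_2$. The c-monotone additive convolution of pairs of distributions is $$(\mu_1,\nu_1)\blacktriangleright(\mu_2,\nu_2):=\big(\mu_1\,{}_{\delta_0}\!\boxplus_{\nu_2}\mu_2,\ \nu_1\blacktriangleright\nu_2\big).$$ **Double tensor Hopf algebra.** $T_+(\mathcal{A})=\bigoplus_{n\ge1}\mathcal{A}^{\otimes n}$ and $T(T_+(\mathcal{A}))=\bigoplus_{n\ge0}T_+(\mathcal{A})^{\otimes n}$. A word $a_1\cdots a_n$ in $T_+(\mathcal{A})$ denotes $a_1\otimes\cdots\otimes a_n$; pure tensors in $T(T_+(\mathcal{A}))$ are written $w_1|\cdots|w_m$. The product is concatenation with $|$, with unit the empty word $\mathbf{1}$. For $w=a_1\cdots a_n$ and $S=\{s_1<\dots<s_l\}\subseteq[n]$ let $w_S=a_{s_1}\cdots a_{s_l}$ ($w_\emptyset=\mathbf{1}$), and let $J_1,\dots,J_r$ be the connected components (maximal intervals of consecutive integers) of $[n]\setminus S$, ordered by minimal elements. The coproduct is $\Delta(w)=\sum_{S\subseteq[n]}w_S\otimes w_{J_1}|\cdots|w_{J_r}$, extended multiplicatively; the counit $\epsilon$ is the unital algebra morphism vanishing on $T_+(\mathcal{A})$. Split $\Delta=\Delta_\prec+\Delta_\succ$ on the augmentation ideal, where $\Delta_\prec(w)=\sum_{1\in S\subseteq[n]}w_S\otimes w_{J_1}|\cdots|w_{J_r}$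 on words and $\Delta_\prec(w_1|w_2|\cdots|w_m)=\Delta_\prec(w_1)\Delta(w_2|\cdots|w_m)$, and likewise for $\Delta_\succ$. **Products on the dual.** For linear forms $f,g$: $f*g=m_{\mathbb{C}}(f\otimes g)\Delta$ (associative, unit $\epsilon$), $f\prec g=m_{\mathbb{C}}(f\otimes g)\Delta_\prec$, $f\succ g=m_{\mathbb{C}}(f\otimes g)\Delta_\succ$, where $m_{\mathbb{C}}$ is the product of $\mathbb{C}$, with $f\prec\epsilon=f=\epsilon\succ f$ and $\epsilon\prec f=0=f\succ\epsilon$ for $f\ne\epsilon$; half-shuffle products are only used when at least one factor vanishes on $\mathbf{1}$, and then they vanish on $\mathbf{1}$. They satisfy $(f\prec g)\prec h=f\prec(g*h)$, $(f\succ g)\prec h=f\succ(g\prec h)$, $f\succ(g\succ h)=(f*g)\succ h$. **Characters.** $G$ is the group (for $*$, with inverse $\Psi^{*-1}$) of characters, i.e. unital algebra morphisms $T(T_+(\mathcal{A}))\to\mathbb{C}$. $\mathfrak{g}$ is the space of infinitesimal characters: linear forms $\alpha$ with $\alpha(\mathbf{1})=0$ and $\alpha(w_1|\cdots|w_k)=0$ for all $k\ge2$, $w_i\in T_+(\mathcal{A})$. The map $\mathcal{E}_\succ(\alpha)=\sum_{n\ge0}\alpha^{\succ n}$ ($\alpha^{\succ0}=\epsilon$, $\alpha^{\succ n}=\alpha^{\succ(n-1)}\succ\alpha$) is a bijection $\mathfrak{g}\to G$. **Extension of distributions to characters.** If $(\mu_i,\nu_i)$ is the distribution of the random variable $a_i\in\mathcal{A}$,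 its extension is the pair of characters $(\Phi_i,\Psi_i)$ on $T(T_+(\mathcal{A}))$ given by $\Phi_i(w)=\mu_i(X^n)$ and $\Psi_i(w)=\nu_i(X^n)$ if $w=a_i^{\otimes n}$, and $\Phi_i(w)=0=\Psi_i(w)$ if $w$ is a word containing a letter different from $a_i$. A pair of characters built from $(\Phi_1,\Psi_1)$ and $(\Phi_2,\Psi_2)$ is said to extend an additive convolution $(\mu,\nu)$ of $(\mu_1,\nu_1)$ and $(\mu_2,\nu_2)$ in the following sense: its restriction to the sub-Hopf algebra $T(T_+(\mathcal{A}_{a_1+a_2}))$, with $\mathcal{A}_{a_1+a_2}$ the unital algebra generated by $a_1+a_2$, extends $(\mu,\nu)$, i.e. the two characters take the values $\mu(X^n)$ and $\nu(X^n)$ on $(a_1+a_2)^{\otimes n}$.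
   Formalization: The random variables a_1 and a_2 are assumed distinct (the claim fails for a_1 = a_2), and the letters in the definition of the extensions range over a fixed set spanning the algebra and containing a_1 and a_2, such as a basis. *)

theory Defs
  imports
    Complex_Main
    "HOL-Library.Disjoint_Sets"
    "HOL-Library.Multiset"
    "HOL-Library.Poly_Mapping"
    "HOL-Computational_Algebra.Polynomial"
begin

section \<open>Non-commutative probability spaces and distributions\<close>

locale complex_algebra = vector_space scale
  for scale :: "complex \<Rightarrow> 'a::ring_1 \<Rightarrow> 'a" +
  assumes scale_mult_left: "scale c x * y = scale c (x * y)"
    and scale_mult_right: "x * scale c y = scale c (x * y)"

definition unital_functional ::
  "(complex \<Rightarrow> 'a::ring_1 \<Rightarrow> 'a) \<Rightarrow> ('a \<Rightarrow> complex) \<Rightarrow> bool" where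
  "unital_functional scale \<phi> \<longleftrightarrow> Vector_Spaces.linear scale (*) \<phi> \<and> \<phi> 1 = 1"

definition nc_prob_space ::
  "(complex \<Rightarrow> 'a::ring_1 \<Rightarrow> 'a) \<Rightarrow> ('a \<Rightarrow> complex) \<Rightarrow> bool" where
  "nc_prob_space scale \<phi> \<longleftrightarrow> complex_algebra scale \<and> unital_functional scale \<phi>"

definition cond_nc_prob_space ::
  "(complex \<Rightarrow> 'a::ring_1 \<Rightarrow> 'a) \<Rightarrow> ('a \<Rightarrow> complex) \<Rightarrow> ('a \<Rightarrow> complex) \<Rightarrow> bool" where
  "cond_nc_prob_space scale \<phi> \<psi> \<longleftrightarrow> nc_prob_space scale \<phi> \<and> unital_functional scale \<psi>"

type_synonym distribution = "complex poly \<Rightarrow> complex"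

abbreviation is_distribution :: "distribution \<Rightarrow> bool" where
  "is_distribution \<mu> \<equiv> unital_functional smult \<mu>"

abbreviation moment :: "distribution \<Rightarrow> nat \<Rightarrow> complex" where
  "moment \<mu> n \<equiv> \<mu> (monom 1 n)"

definition has_distribution ::
  "('a::ring_1 \<Rightarrow> complex) \<Rightarrow> 'a \<Rightarrow> distribution \<Rightarrow> bool" where
  "has_distribution \<phi> a \<mu> \<longleftrightarrow> is_distribution \<mu> \<and> (\<forall>n. moment \<mu> n = \<phi> (a ^ n))"

definition delta0 :: distribution where
  "delta0 p = coeff p 0"

section \<open>Free and conditionally free additive convolution\<close>

definition noncrossing :: "nat set set \<Rightarrow> bool" where
  "noncrossing \<pi> \<longleftrightarrow>
     \<not> (\<exists>V\<in>\<pi>. \<exists>W\<in>\<pi>. V \<noteq> W \<and>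
          (\<exists>a\<in>V. \<exists>b\<in>W. \<exists>c\<in>V. \<exists>d\<in>W. a < b \<and> b < c \<and> c < d))"

definition NC :: "nat \<Rightarrow> nat set set set" where
  "NC n = {\<pi>. partition_on {1..n} \<pi> \<and> noncrossing \<pi>}"

definition inner_block :: "nat set set \<Rightarrow> nat set \<Rightarrow> bool" where
  "inner_block \<pi> V \<longleftrightarrow> (\<exists>W\<in>\<pi>. W \<noteq> V \<and> (\<exists>a\<in>W. \<exists>b\<in>W. \<forall>c\<in>V. a < c \<and> c < b))"

text \<open>Cumulants only carry information in positive degree; the value in degree \<open>0\<close> is fixed to
  \<open>0\<close> so that the cumulant sequence is a uniquely determined function.\<close>

definition free_cumulant :: "distribution \<Rightarrow> nat \<Rightarrow> complex" where
  "free_cumulant \<nu> = (THE k. k 0 = 0 \<and>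
     (\<forall>n\<ge>1. moment \<nu> n = (\<Sum>\<pi>\<in>NC n. \<Prod>V\<in>\<pi>. k (card V))))"

definition free_conv :: "distribution \<Rightarrow> distribution \<Rightarrow> distribution" where
  "free_conv \<nu>1 \<nu>2 = (THE \<nu>. is_distribution \<nu> \<and>
     (\<forall>n\<ge>1. free_cumulant \<nu> n = free_cumulant \<nu>1 n + free_cumulant \<nu>2 n))"

definition cfree_cumulant :: "distribution \<Rightarrow> distribution \<Rightarrow> nat \<Rightarrow> complex" where
  "cfree_cumulant \<mu> \<nu> = (THE k. k 0 = 0 \<and>
     (\<forall>n\<ge>1. moment \<mu> n =
        (\<Sum>\<pi>\<in>NC n. (\<Prod>V\<in>{V\<in>\<pi>. \<not> inner_block \<pi> V}. k (card V)) *
                   (\<Prod>V\<in>{V\<in>\<pi>. inner_block \<pi> V}. free_cumulant \<nu> (card V)))))"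

text \<open>\<open>cfree_conv \<mu>1 \<nu>1 \<nu>2 \<mu>2\<close> is \<open>\<mu>1\<close> convolved with \<open>\<mu>2\<close>, with subscripts \<open>\<nu>1\<close> and \<open>\<nu>2\<close>.\<close>

definition cfree_conv ::
  "distribution \<Rightarrow> distribution \<Rightarrow> distribution \<Rightarrow> distribution \<Rightarrow> distribution" where
  "cfree_conv \<mu>1 \<nu>1 \<nu>2 \<mu>2 = (THE \<mu>. is_distribution \<mu> \<and>
     (\<forall>n\<ge>1. cfree_cumulant \<mu> (free_conv \<nu>1 \<nu>2) n =
            cfree_cumulant \<mu>1 \<nu>1 n + cfree_cumulant \<mu>2 \<nu>2 n))"

section \<open>Monotone and conditionally monotone additive convolution\<close>

text \<open>Subalgebras need not contain the unit.\<close>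

definition subalgebra :: "(complex \<Rightarrow> 'a::ring_1 \<Rightarrow> 'a) \<Rightarrow> 'a set \<Rightarrow> bool" where
  "subalgebra scale A \<longleftrightarrow> module.subspace scale A \<and> (\<forall>x\<in>A. \<forall>y\<in>A. x * y \<in> A)"

text \<open>Monotone independence of an ordered family of subalgebras: in a product
  \<open>x\<^sub>1 \<cdots> x\<^sub>n\<close> with \<open>x\<^sub>j \<in> A (i\<^sub>j)\<close> and distinct neighbouring indices, every factor whose index is
  a strict local maximum can be taken out.  Positions are counted from \<open>0\<close>.\<close>

definition monotone_independent ::
  "('a::ring_1 \<Rightarrow> complex) \<Rightarrow> ('i::linorder \<Rightarrow> 'a set) \<Rightarrow> 'i set \<Rightarrow> bool" where
  "monotone_independent \<phi> A I \<longleftrightarrow>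
     (\<forall>xs is l. length is = length xs \<and> set is \<subseteq> I \<and>
        (\<forall>j<length xs. xs ! j \<in> A (is ! j)) \<and>
        (\<forall>j. Suc j < length xs \<longrightarrow> is ! j \<noteq> is ! Suc j) \<and>
        l < length xs \<and>
        (0 < l \<longrightarrow> is ! (l - 1) < is ! l) \<and>
        (Suc l < length xs \<longrightarrow> is ! Suc l < is ! l)
        \<longrightarrow> \<phi> (prod_list xs) = \<phi> (xs ! l) * \<phi> (prod_list (take l xs @ drop (Suc l) xs)))"

definition monotone_sum ::
  "(complex \<Rightarrow> 'a::ring_1 \<Rightarrow> 'a) \<Rightarrow> distribution \<Rightarrow> distribution \<Rightarrow> distribution \<Rightarrow> bool" where
  "monotone_sum scale \<nu>1 \<nu>2 \<nu> \<longleftrightarrow>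
     (\<exists>\<phi> x y. nc_prob_space scale \<phi> \<and> has_distribution \<phi> x \<nu>1 \<and> has_distribution \<phi> y \<nu>2 \<and>
        monotone_independent \<phi> (\<lambda>i::nat. if i = 1 then subalgebra scale hull {x}
                                         else subalgebra scale hull {y}) {1, 2} \<and>
        has_distribution \<phi> (x + y) \<nu>)"

text \<open>HOL cannot quantify over the algebra underlying ``some probability space''.  It suffices to
  consider the free unital algebra \<open>\<complex>\<langle>X, Y\<rangle>\<close>: if \<open>x, y\<close> are elements of any
  probability space, pulling the functional back along \<open>X \<mapsto> x, Y \<mapsto> y\<close> preserves the distributions
  of \<open>x\<close>, \<open>y\<close>, \<open>x + y\<close> and monotone independence.  The free algebra is the monoid algebra of the
  monoid of words in two letters.\<close>

datatype 'i free_monoid = Free_Monoid (letters: "'i list")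

instantiation free_monoid :: (type) monoid_add
begin

definition zero_free_monoid :: "'a free_monoid" where
  "0 = Free_Monoid []"

definition plus_free_monoid :: "'a free_monoid \<Rightarrow> 'a free_monoid \<Rightarrow> 'a free_monoid" where
  "u + v = Free_Monoid (letters u @ letters v)"

instance
  by standard (simp_all add: zero_free_monoid_def plus_free_monoid_def)

end

type_synonym free_algebra_2 = "bool free_monoid \<Rightarrow>\<^sub>0 complex"

definition scale_free_algebra_2 :: "complex \<Rightarrow> free_algebra_2 \<Rightarrow> free_algebra_2" where
  "scale_free_algebra_2 c p = Poly_Mapping.single 0 c * p"

definition monotone_conv :: "distribution \<Rightarrow> distribution \<Rightarrow> distribution" where
  "monotone_conv \<nu>1 \<nu>2 = (THE \<nu>. monotone_sum scale_free_algebra_2 \<nu>1 \<nu>2 \<nu>)"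

fun cmonotone_conv ::
  "distribution \<times> distribution \<Rightarrow> distribution \<times> distribution \<Rightarrow> distribution \<times> distribution" where
  "cmonotone_conv (\<mu>1, \<nu>1) (\<mu>2, \<nu>2) = (cfree_conv \<mu>1 delta0 \<nu>2 \<mu>2, monotone_conv \<nu>1 \<nu>2)"

section \<open>The double tensor Hopf algebra and its dual\<close>

text \<open>A list of nonempty words \<open>[w\<^sub>1, \<dots>, w\<^sub>m]\<close> over the algebra stands for the pure tensor
  \<open>w\<^sub>1 | \<cdots> | w\<^sub>m\<close>, the empty list for the unit, and list append is the product.  By the universal
  property of tensor products, a linear form on the double tensor algebra is the same as a
  function of these lists that is linear in each letter.  Lists in which an empty word occurs do
  not denote pure tensors; all forms take the value \<open>0\<close> there.\<close>

type_synonym 'a form = "'a list list \<Rightarrow> complex"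

definition linear_form :: "(complex \<Rightarrow> 'a::ring_1 \<Rightarrow> 'a) \<Rightarrow> 'a form \<Rightarrow> bool" where
  "linear_form scale f \<longleftrightarrow>
     (\<forall>us u v vs. Vector_Spaces.linear scale (*) (\<lambda>a. f (us @ (u @ a # v) # vs))) \<and>
     (\<forall>ws. [] \<in> set ws \<longrightarrow> f ws = 0)"

definition counit :: "'a form" where
  "counit ws = (if ws = [] then 1 else 0)"

text \<open>Letters of a word are at positions \<open>0, \<dots>, length w - 1\<close>, so the distinguished position
  is \<open>0\<close>.\<close>

definition subword :: "'a list \<Rightarrow> nat set \<Rightarrow> 'a list list" where
  "subword w S = (if nths w S = [] then [] else [nths w S])"

text \<open>The connected component of the complement of \<open>S\<close> in \<open>{..<n}\<close> with minimal element \<open>m\<close>.\<close>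

definition component :: "nat \<Rightarrow> nat set \<Rightarrow> nat \<Rightarrow> nat set" where
  "component n S m = {k. m \<le> k \<and> k < n \<and> {m..k} \<inter> S = {}}"

definition gap_words :: "'a list \<Rightarrow> nat set \<Rightarrow> 'a list list" where
  "gap_words w S =
     [nths w (component (length w) S m).
        m \<leftarrow> [0..<length w], m \<notin> S \<and> (m = 0 \<or> m - 1 \<in> S)]"

text \<open>The coproduct of a pure tensor is a sum of pure tensors \<open>u \<otimes> v\<close> with
  coefficients \<open>1\<close>; it is recorded as the multiset of the pairs \<open>(u, v)\<close>.\<close>

type_synonym 'a tensor_sum = "('a list list \<times> 'a list list) multiset"

definition tensor_mult :: "'a tensor_sum \<Rightarrow> 'a tensor_sum \<Rightarrow> 'a tensor_sum" where
  "tensor_mult A B = (\<Sum>(u, v)\<in>#A. image_mset (\<lambda>(u', v'). (u @ u', v @ v')) B)"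

definition split_word :: "'a list \<Rightarrow> nat set set \<Rightarrow> 'a tensor_sum" where
  "split_word w \<S> = image_mset (\<lambda>S. (subword w S, gap_words w S)) (mset_set \<S>)"

definition word_subsets :: "'a list \<Rightarrow> nat set set" where
  "word_subsets w = (if w = [] then {} else Pow {..<length w})"

fun coprod :: "'a list list \<Rightarrow> 'a tensor_sum" where
  "coprod [] = {#([], [])#}"
| "coprod (w # ws) = tensor_mult (split_word w (word_subsets w)) (coprod ws)"

fun coprod_left :: "'a list list \<Rightarrow> 'a tensor_sum" where
  "coprod_left [] = {#}"
| "coprod_left (w # ws) =
     tensor_mult (split_word w {S \<in> word_subsets w. 0 \<in> S}) (coprod ws)"

fun coprod_right :: "'a list list \<Rightarrow> 'a tensor_sum" where
  "coprod_right [] = {#}"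
| "coprod_right (w # ws) =
     tensor_mult (split_word w {S \<in> word_subsets w. 0 \<notin> S}) (coprod ws)"

definition tensor_eval :: "'a form \<Rightarrow> 'a form \<Rightarrow> 'a tensor_sum \<Rightarrow> complex" where
  "tensor_eval f g A = (\<Sum>(u, v)\<in>#A. f u * g v)"

definition conv :: "'a form \<Rightarrow> 'a form \<Rightarrow> 'a form" (infixl \<open>\<star>\<close> 70) where
  "f \<star> g = (\<lambda>ws. tensor_eval f g (coprod ws))"

text \<open>The half-coproducts live on the augmentation ideal; on the unit the half-shuffle products
  are \<open>0\<close>.  For a form \<open>f\<close> vanishing on the unit this yields the usual conventions: with the
  counit \<open>\<epsilon>\<close>, \<open>f \<lhd> \<epsilon> = f = \<epsilon> \<rhd> f\<close> and \<open>\<epsilon> \<lhd> f = 0 = f \<rhd> \<epsilon>\<close>.\<close>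

definition half_left :: "'a form \<Rightarrow> 'a form \<Rightarrow> 'a form" (infixl \<open>\<lhd>\<close> 70) where
  "f \<lhd> g = (\<lambda>ws. tensor_eval f g (coprod_left ws))"

definition half_right :: "'a form \<Rightarrow> 'a form \<Rightarrow> 'a form" (infixl \<open>\<rhd>\<close> 70) where
  "f \<rhd> g = (\<lambda>ws. tensor_eval f g (coprod_right ws))"

definition characters :: "(complex \<Rightarrow> 'a::ring_1 \<Rightarrow> 'a) \<Rightarrow> 'a form set" where
  "characters scale =
     {\<Phi>. linear_form scale \<Phi> \<and> \<Phi> [] = 1 \<and> (\<forall>us vs. \<Phi> (us @ vs) = \<Phi> us * \<Phi> vs)}"

definition infinitesimal_characters :: "(complex \<Rightarrow> 'a::ring_1 \<Rightarrow> 'a) \<Rightarrow> 'a form set" where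
  "infinitesimal_characters scale =
     {\<alpha>. linear_form scale \<alpha> \<and> \<alpha> [] = 0 \<and> (\<forall>ws. length ws \<ge> 2 \<longrightarrow> \<alpha> ws = 0)}"

definition char_inverse :: "(complex \<Rightarrow> 'a::ring_1 \<Rightarrow> 'a) \<Rightarrow> 'a form \<Rightarrow> 'a form" where
  "char_inverse scale \<Psi> =
     (THE \<Theta>. \<Theta> \<in> characters scale \<and> \<Theta> \<star> \<Psi> = counit \<and> \<Psi> \<star> \<Theta> = counit)"

fun half_right_power :: "'a form \<Rightarrow> nat \<Rightarrow> 'a form" where
  "half_right_power \<alpha> 0 = counit"
| "half_right_power \<alpha> (Suc n) = half_right_power \<alpha> n \<rhd> \<alpha>"

text \<open>The series is pointwise: for an infinitesimal character all but finitely many terms vanish on a given pure tensor.\<close>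

definition E_right :: "'a form \<Rightarrow> 'a form" where
  "E_right \<alpha> = (\<lambda>ws. suminf (\<lambda>n. half_right_power \<alpha> n ws))"

definition L_right :: "(complex \<Rightarrow> 'a::ring_1 \<Rightarrow> 'a) \<Rightarrow> 'a form \<Rightarrow> 'a form" where
  "L_right scale = inv_into (infinitesimal_characters scale) E_right"

fun cmonotone_char_conv ::
  "(complex \<Rightarrow> 'a::ring_1 \<Rightarrow> 'a) \<Rightarrow> 'a form \<times> 'a form \<Rightarrow> 'a form \<times> 'a form \<Rightarrow> 'a form \<times> 'a form" where
  "cmonotone_char_conv scale (\<Phi>1, \<Psi>1) (\<Phi>2, \<Psi>2) =
     (let \<beta>1 = L_right scale \<Phi>1; \<beta>2 = L_right scale \<Phi>2;
          \<gamma> = (char_inverse scale \<Psi>2 \<rhd> \<beta>1) \<lhd> \<Psi>2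
      in (E_right (\<lambda>ws. \<beta>2 ws + \<gamma> ws), \<Psi>1 \<star> \<Psi>2))"

section \<open>Extension of distributions to characters\<close>

text \<open>This is the sense in which a character extends the distribution of an additive convolution:
  only the tensor powers of \<open>a\<close> (there, the sum of the two random variables) are prescribed.\<close>

definition takes_moments ::
  "(complex \<Rightarrow> 'a::ring_1 \<Rightarrow> 'a) \<Rightarrow> 'a \<Rightarrow> distribution \<Rightarrow> 'a form \<Rightarrow> bool" where
  "takes_moments scale a \<mu> \<Phi> \<longleftrightarrow>
     \<Phi> \<in> characters scale \<and> (\<forall>n\<ge>1. \<Phi> [replicate n a] = moment \<mu> n)"

text \<open>Words are multilinear in their letters, so \<open>2 a\<close> must not count as a letter different from
  \<open>a\<close>: letters are taken from a fixed alphabet \<open>L\<close>.  If \<open>L\<close> is a linear basis containing \<open>a\<close>, then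
  the extension exists and is unique; if \<open>L\<close> merely spans, it is still unique.\<close>

definition is_extension ::
  "(complex \<Rightarrow> 'a::ring_1 \<Rightarrow> 'a) \<Rightarrow> 'a set \<Rightarrow> 'a \<Rightarrow> distribution \<Rightarrow> 'a form \<Rightarrow> bool" where
  "is_extension scale L a \<mu> \<Phi> \<longleftrightarrow>
     takes_moments scale a \<mu> \<Phi> \<and>
     (\<forall>w. set w \<subseteq> L \<and> (\<exists>x\<in>set w. x \<noteq> a) \<longrightarrow> \<Phi> [w] = 0)"

end

theory Submission
  imports Defs
begin

text \<open>Every object in the theorem is determined by what it does on single words, so the argument
concerns functions \<open>p\<close> on words with \<open>p [] = 1\<close>, which \<open>character_of\<close> extends
multiplicatively to characters.

On words, the convolution of characters is the sum over all sets \<open>S\<close> of positions of \<open>f\<close> of the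
selected letters times the values of \<open>p\<close> on the gaps between them.  Read letter by letter, this
is the structural recursion \<open>word_conv\<close>; it makes associativity a direct induction
(\<open>word_conv_assoc\<close>), and recursion on the length of words yields inverses.  In the series
\<open>E_right \<beta>\<close> only one gap can carry \<open>\<beta>\<close>, and it must be a prefix of the word.  Hence
\<open>\<Phi> = E_right \<beta>\<close> says that \<open>\<Phi> w\<close> is the sum of \<open>\<beta> u * \<Phi> v\<close> over the splittings \<open>w = u @ v\<close> with
\<open>u\<close> nonempty (\<open>E_right_eq_character_of\<close>): \<open>\<beta>\<close> is the family of Boolean cumulants of \<open>\<Phi>\<close>.

In \<open>(\<Psi>2\<inverse> \<rhd> \<beta>1) \<lhd> \<Psi>2\<close> the first letter of a word is selected, \<open>\<beta>1\<close> is applied to a prefix of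
the selected letters, \<open>\<Psi>2\<inverse>\<close> to the other selected letters and \<open>\<Psi>2\<close> to the gaps.  Fix the last
position that goes to \<open>\<beta>1\<close>.  The sum over the rest of the word is then the value of
\<open>\<Psi>2\<inverse> \<star> \<Psi>2\<close>, the counit, so that the rest is empty (\<open>word_conv_prefix_conv\<close>).  What remains is
the sum of \<open>\<beta>1\<close> of the selected letters times \<open>\<Psi>2\<close> of the gaps over those \<open>S\<close> that contain both
the first and the last position (\<open>bridge_conv\<close>).

On the side of distributions, a noncrossing partition is cut along the block of \<open>1\<close>.  The gaps
of this block are filled by arbitrary noncrossing partitions of inner blocks, which sum up to
moments of \<open>\<nu>\<close>.  So the Boolean cumulants of \<open>\<mu>\<close> are the sums of \<open>\<kappa> (card S)\<close> times the
moments of \<open>\<nu>\<close> at the gap lengths over the sets \<open>S\<close> that contain the first and the last position,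
where \<open>\<kappa>\<close> are the c-free cumulants of \<open>(\<mu>, \<nu>)\<close> (\<open>NC_sum_boolean\<close>).  This expression is linear
in \<open>\<kappa>\<close>; and if \<open>\<nu>\<close> is \<open>delta0\<close>, all gaps are empty and Boolean and c-free cumulants agree.  As
the free convolution of \<open>delta0\<close> and \<open>\<nu>2\<close> is \<open>\<nu>2\<close>, the Boolean cumulants of the c-free convolution
are those of \<open>\<mu>2\<close> plus the sum for \<open>\<kappa> =\<close> the Boolean cumulants of \<open>\<mu>1\<close> with moments of \<open>\<nu>2\<close> in the
gaps.  By multilinearity, the extension of a distribution of \<open>a1\<close> or of \<open>a2\<close> has its
moments as values on the powers of \<open>a1 + a2\<close> (\<open>extension_on_sum\<close>), so these are precisely the
values of \<open>\<beta>2 + (\<Psi>2\<inverse> \<rhd> \<beta>1) \<lhd> \<Psi>2\<close> there (\<open>cfree_conv_words\<close>).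

For the second component, expand \<open>(x + y) ^ n\<close> over the sets \<open>S\<close> of the factors equal to \<open>x\<close>.
Monotone independence extracts every maximal run of factors \<open>y\<close>, so the moment is the sum of
the moments of \<open>\<nu>1\<close> at \<open>card S\<close> times the moments of \<open>\<nu>2\<close> at the gap lengths: again the word
convolution (\<open>monotone_moments\<close>).  Cumulants and convolutions of distributions are given by
definite descriptions, so existence and uniqueness are established for each of them; for
the monotone convolution this takes a concrete monotone pair in the free algebra.\<close>

section \<open>Convolution on words\<close>

text \<open>The sum over all sets of positions of \<open>f\<close> of the selected letters, times \<open>P\<close> of the first gap,
times \<open>p\<close> of each later gap; all gaps, also empty ones, are counted.  The convolution of characters
is the case \<open>P = p\<close>.  The separate functional for the first gap is what makes a structural recursion
possible: while no letter is selected, \<open>P\<close> records the letters that have been read.\<close>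

fun word_conv ::
  "('a list \<Rightarrow> complex) \<Rightarrow> ('a list \<Rightarrow> complex) \<Rightarrow> ('a list \<Rightarrow> complex) \<Rightarrow> 'a list \<Rightarrow> complex" where
  "word_conv f p P [] = f [] * P []"
| "word_conv f p P (x # w) =
     word_conv f p (\<lambda>u. P (x # u)) w + P [] * word_conv (\<lambda>s. f (x # s)) p p w"

definition empty_word :: "'a list \<Rightarrow> complex" where
  "empty_word w = (if w = [] then 1 else 0)"

lemma empty_word_simps [simp]: "empty_word [] = 1" "empty_word (x # w) = 0"
  by (simp_all add: empty_word_def)

lemma word_conv_lin_left:
  "word_conv (\<lambda>s. c * f s + d * g s) p P w = c * word_conv f p P w + d * word_conv g p P w"
  by (induction w arbitrary: f g P) (simp_all add: algebra_simps)

lemma word_conv_lin_gap: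
  "word_conv f p (\<lambda>u. c * P u + d * Q u) w = c * word_conv f p P w + d * word_conv f p Q w"
  by (induction w arbitrary: f P Q) (simp_all add: algebra_simps)

lemmas word_conv_linear =
  word_conv_lin_left [where c = 1 and d = 1, simplified]
  word_conv_lin_left [where d = 0, simplified]
  word_conv_lin_gap [where c = 1 and d = 1, simplified]
  word_conv_lin_gap [where d = 0, simplified]

lemma word_conv_zero [simp]:
  "word_conv (\<lambda>s. 0) p P w = 0" "word_conv f p (\<lambda>u. 0) w = 0"
  by (induction w arbitrary: f P) simp_all

text \<open>Coassociativity of the coproduct on words.  The induction closes because the functional of the
gap that is still open is convolved along with the others, and because \<open>word_conv\<close> is linear in it.\<close>

theorem word_conv_assoc:
  "word_conv (word_conv f p P) q Q w = word_conv f (word_conv p q q) (word_conv P q Q) w"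
proof (induction w arbitrary: f P Q)
  case (Cons x w)
  show ?case by (simp add: word_conv_linear Cons.IH algebra_simps)
qed simp

lemma word_conv_empty_gaps [simp]: "word_conv f empty_word empty_word w = f w"
  by (induction w arbitrary: f) simp_all

lemma word_conv_empty_left [simp]: "word_conv empty_word p P w = P w"
  by (induction w arbitrary: P) simp_all

text \<open>The selected letters form a word no longer than the given one.\<close>

lemma word_conv_cong:
  "(\<And>v. length v \<le> length w \<Longrightarrow> f v = g v) \<Longrightarrow> word_conv f p P w = word_conv g p P w"
proof (induction w arbitrary: f g P)
  case (Cons x w)
  have "word_conv f p (\<lambda>u. P (x # u)) w = word_conv g p (\<lambda>u. P (x # u)) w"
    by (rule Cons.IH) (use Cons.prems in simp)
  moreover have "word_conv (\<lambda>s. f (x # s)) p p w = word_conv (\<lambda>s. g (x # s)) p p w"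
    by (rule Cons.IH) (use Cons.prems in simp)
  ultimately show ?case by simp
qed simp

text \<open>Only the choice of all positions evaluates \<open>f\<close> on the whole word.  Hence an equation
\<open>word_conv f p p = h\<close> determines \<open>f\<close> by recursion on the length.\<close>

lemma word_conv_triangular:
  assumes "p [] = 1" "P [] = 1" "\<forall>v. length v < length w \<longrightarrow> f v = g v"
  shows "word_conv f p P w - f w = word_conv g p P w - g w"
  using assms(2,3)
proof (induction w arbitrary: f g P)
  case (Cons x w)
  have "word_conv f p (\<lambda>u. P (x # u)) w = word_conv g p (\<lambda>u. P (x # u)) w"
    by (rule word_conv_cong) (use Cons.prems in simp)
  moreover have "word_conv (\<lambda>s. f (x # s)) p p w - f (x # w) = word_conv (\<lambda>s. g (x # s)) p p w - g (x # w)"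
    by (rule Cons.IH) (use Cons.prems assms in simp_all)
  ultimately show ?case using Cons.prems(1) by (simp add: algebra_simps)
qed simp

text \<open>The sum of \<open>b u * q v\<close> over the splittings \<open>w = u @ v\<close> with nonempty \<open>u\<close>.  The equation
\<open>q w = prefix_conv b q w\<close> for nonempty \<open>w\<close> says that \<open>b\<close> are the Boolean cumulants of \<open>q\<close>.\<close>

fun prefix_conv :: "('a list \<Rightarrow> complex) \<Rightarrow> ('a list \<Rightarrow> complex) \<Rightarrow> 'a list \<Rightarrow> complex" where
  "prefix_conv b q [] = 0"
| "prefix_conv b q (x # w) = b [x] * q w + prefix_conv (\<lambda>u. b (x # u)) q w"

lemma prefix_conv_sum:
  "prefix_conv b q w = (\<Sum>k<length w. b (take (Suc k) w) * q (drop (Suc k) w))"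
proof (induction w arbitrary: b)
  case (Cons x w)
  have "(\<Sum>k<length (x # w). b (take (Suc k) (x # w)) * q (drop (Suc k) (x # w))) =
    (\<Sum>k<Suc (length w). b (x # take k w) * q (drop k w))"
    by simp
  also have "\<dots> = b [x] * q w + (\<Sum>k<length w. b (x # take (Suc k) w) * q (drop (Suc k) w))"
    by (subst sum.lessThan_Suc_shift) simp
  finally show ?case by (simp add: Cons.IH)
qed simp

lemma prefix_conv_cong:
  assumes "\<And>u. u \<noteq> [] \<Longrightarrow> b u = c u"
  shows "prefix_conv b q w = prefix_conv c q w"
proof -
  have "b (take (Suc k) w) = c (take (Suc k) w)" if "k < length w" for k
    using that by (intro assms) auto
  then show ?thesis unfolding prefix_conv_sum by simp
qed

text \<open>The part of \<open>word_conv\<close> in which the last position is selected; for \<open>P = empty_word\<close> the first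
position is selected as well.\<close>

fun bridge_conv ::
  "('a list \<Rightarrow> complex) \<Rightarrow> ('a list \<Rightarrow> complex) \<Rightarrow> ('a list \<Rightarrow> complex) \<Rightarrow> 'a list \<Rightarrow> complex" where
  "bridge_conv f p P [] = 0"
| "bridge_conv f p P (x # w) = bridge_conv f p (\<lambda>u. P (x # u)) w +
     P [] * ((if w = [] then f [x] else 0) + bridge_conv (\<lambda>s. f (x # s)) p p w)"

lemma bridge_conv_zero_gap [simp]: "bridge_conv f p (\<lambda>u. 0) w = 0"
  by (induction w) simp_all

lemma prefix_conv_bridge_zero_gap [simp]: "prefix_conv (bridge_conv f p (\<lambda>u. 0)) c w = 0"
  by (simp add: prefix_conv_sum)

lemma prefix_conv_bridge_Cons:
  "prefix_conv (bridge_conv f p P) c (x # w) = prefix_conv (bridge_conv f p (\<lambda>u. P (x # u))) c w +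
     P [] * (f [x] * c w + prefix_conv (bridge_conv (\<lambda>s. f (x # s)) p p) c w)"
proof -
  have "prefix_conv (\<lambda>u. bridge_conv f p P (x # u)) c w =
    prefix_conv (bridge_conv f p (\<lambda>u. P (x # u))) c w +
    P [] * prefix_conv (bridge_conv (\<lambda>s. f (x # s)) p p) c w"
    unfolding prefix_conv_sum sum_distrib_left sum.distrib [symmetric]
    by (rule sum.cong) (auto simp: algebra_simps)
  then show ?thesis by (simp add: algebra_simps)
qed

text \<open>Group the positions selected for \<open>prefix_conv b t\<close> by the last one that goes to \<open>b\<close>: up to it the
sum is a bridge, beyond it a word convolution of its own.\<close>

lemma word_conv_prefix_conv:
  "word_conv (prefix_conv b t) p P w = prefix_conv (bridge_conv b p P) (word_conv t p p) w"
proof (induction w arbitrary: b P)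
  case (Cons x w)
  have *: "word_conv (\<lambda>s. prefix_conv b t (x # s)) p p w =
    b [x] * word_conv t p p w + word_conv (prefix_conv (\<lambda>u. b (x # u)) t) p p w"
    by (simp add: word_conv_linear)
  show ?case
    unfolding prefix_conv_bridge_Cons by (simp only: word_conv.simps(2) * Cons.IH)
qed simp

text \<open>Grouping by the length \<open>g\<close> of the first gap.  Noncrossing partitions satisfy the same recursion,
with the second element of the first block in the role of the end of the gap.\<close>

lemma prefix_conv_bridge_first_gap:
  "prefix_conv (bridge_conv f p P) c w =
     (\<Sum>g<length w. P (take g w) * prefix_conv (bridge_conv f p empty_word) c (drop g w))"
proof (induction w arbitrary: P)
  case (Cons x w)
  show ?case
    unfolding length_Cons sum.lessThan_Suc_shift
    by (simp add: prefix_conv_bridge_Cons Cons.IH [of "\<lambda>u. P (x # u)"] del: prefix_conv.simps(2))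
qed simp

lemma bridge_conv_cong:
  "(\<And>s. s \<noteq> [] \<Longrightarrow> f s = g s) \<Longrightarrow> bridge_conv f p P w = bridge_conv g p P w"
proof (induction w arbitrary: f g P)
  case (Cons x w)
  have "bridge_conv f p (\<lambda>u. P (x # u)) w = bridge_conv g p (\<lambda>u. P (x # u)) w"
    by (rule Cons.IH) (rule Cons.prems)
  moreover have "bridge_conv (\<lambda>s. f (x # s)) p p w = bridge_conv (\<lambda>s. g (x # s)) p p w"
    by (rule Cons.IH) (rule Cons.prems, simp)
  ultimately show ?case using Cons.prems [of "[x]"] by simp
qed simp

lemma bridge_conv_add:
  "bridge_conv (\<lambda>s. f s + g s) p P w = bridge_conv f p P w + bridge_conv g p P w"
  by (induction w arbitrary: f g P) (simp_all add: algebra_simps)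

text \<open>If all gaps are empty, every position is selected.\<close>

lemma bridge_conv_empty_gaps: "w \<noteq> [] \<Longrightarrow> bridge_conv f empty_word empty_word w = f w"
  by (induction w arbitrary: f) auto

text \<open>Cumulants and inverses are given by equations in which the value on a word depends on shorter
words only; such equations have a solution.\<close>

lemma length_recursion:
  fixes T :: "('a list \<Rightarrow> complex) \<Rightarrow> 'a list \<Rightarrow> complex" and c :: complex
  assumes "\<And>f g w. w \<noteq> [] \<Longrightarrow> \<forall>v. length v < length w \<longrightarrow> f v = g v \<Longrightarrow> T f w = T g w"
  obtains f where "f [] = c" "\<And>w. w \<noteq> [] \<Longrightarrow> f w = T f w"
proof -
  let ?T = "\<lambda>f w. if w = [] then c else T f w"
  define f where "f = wfrec (measure length) ?T"
  have "f [] = c"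
    unfolding f_def by (subst wfrec) auto
  moreover have "f w = T f w" if "w \<noteq> []" for w
    unfolding f_def using that by (subst wfrec) (auto intro!: assms simp: cut_apply)
  ultimately show thesis by (rule that)
qed

text \<open>On powers of one letter only lengths matter, so the letter may be exchanged.  This passes from
powers of \<open>a1 + a2\<close> to words over the type \<open>unit\<close>, where every word is a power.\<close>

lemma replicate_restrict_conv:
  "word_conv f p P (replicate n x) =
   word_conv (\<lambda>s. f (replicate (length s) x)) (\<lambda>s. p (replicate (length s) x)) (\<lambda>s. P (replicate (length s) x)) (replicate n y)"
proof (induction n arbitrary: f P)
  case (Suc n)
  show ?case by (simp add: Suc.IH)
qed simp

lemma replicate_restrict_prefix:
  "prefix_conv b q (replicate n x) =
   prefix_conv (\<lambda>s. b (replicate (length s) x)) (\<lambda>s. q (replicate (length s) x)) (replicate n y)"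
  by (simp add: prefix_conv_sum min_def)

lemma replicate_restrict_bridge:
  "bridge_conv f p P (replicate n x) =
   bridge_conv (\<lambda>s. f (replicate (length s) x)) (\<lambda>s. p (replicate (length s) x)) (\<lambda>s. P (replicate (length s) x)) (replicate n y)"
proof (induction n arbitrary: f P)
  case (Suc n)
  show ?case by (simp add: Suc.IH)
qed simp

section \<open>Coproducts read letter by letter\<close>

text \<open>All gaps of \<open>S\<close> in \<open>w\<close>, one more than there are selected letters.  Keeping the empty ones gives a
recursion on \<open>w\<close>; \<open>gap_words\<close> arises by dropping them.\<close>

fun gaps :: "'a list \<Rightarrow> nat set \<Rightarrow> 'a list list" where
  "gaps [] S = [[]]"
| "gaps (x # w) S = (let g = gaps w {j. Suc j \<in> S} in if 0 \<in> S then [] # g else (x # hd g) # tl g)"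

lemma gaps_nonempty [simp]: "gaps w S \<noteq> []"
  by (cases w) (simp_all add: Let_def)

text \<open>A position starts a gap if it is not in \<open>S\<close> and is \<open>0\<close> or follows an element of \<open>S\<close>.  Reading
a new first letter either extends the gap at \<open>0\<close> or closes it, so the gap at \<open>0\<close> and
the later ones are traced separately.\<close>

lemma gap_words_eq_filter_gaps: "gap_words w S = filter (\<lambda>u. u \<noteq> []) (gaps w S)"
proof -
  \<comment> \<open>the gaps that do not start at position \<open>0\<close>\<close>
  define later where "later w S =
     [nths w (component (length w) S m).
        m \<leftarrow> [0..<length w], m \<notin> S \<and> m \<noteq> 0 \<and> m - 1 \<in> S]" for w :: "'a list" and S
  have upt0: "[0..<Suc n] = 0 # map Suc [0..<n]" for n
    by (simp add: map_Suc_upt upt_conv_Cons del: upt_Suc)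
  have comp0: "{j. Suc j \<in> component (Suc n) S 0} = component n {j. Suc j \<in> S} 0"
    if "0 \<notin> S" for n S
  proof -
    have "{0..Suc j} \<inter> S = {} \<longleftrightarrow> {0..j} \<inter> {j. Suc j \<in> S} = {}" for j
      using that by (auto simp: disjoint_iff) (metis Suc_le_mono not0_implies_Suc)
    then show ?thesis by (auto simp: component_def)
  qed
  have compS: "{j. Suc j \<in> component (Suc n) S (Suc i)} = component n {j. Suc j \<in> S} i"
    and comp0S: "0 \<notin> component (Suc n) S (Suc i)" for n S i
  proof -
    have "{Suc i..Suc j} \<inter> S = {} \<longleftrightarrow> {i..j} \<inter> {j. Suc j \<in> S} = {}" for j
      by (auto simp: disjoint_iff) (metis Suc_le_D Suc_le_mono)
    then show "{j. Suc j \<in> component (Suc n) S (Suc i)} = component n {j. Suc j \<in> S} i"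
      by (auto simp: component_def)
    show "0 \<notin> component (Suc n) S (Suc i)" by (simp add: component_def)
  qed
  have comp_empty: "nths w (component (length w) S 0) = [] \<longleftrightarrow> w = [] \<or> 0 \<in> S"
    for w :: "'a list" and S
  proof (cases "0 \<in> S")
    case True
    then have "component (length w) S 0 = {}" by (auto simp: component_def)
    with True show ?thesis by simp
  next
    case False
    then show ?thesis by (cases w) (simp_all add: nths_Cons component_def)
  qed
  have gw: "gap_words w S = (if w = [] \<or> 0 \<in> S then [] else [nths w (component (length w) S 0)]) @ later w S"
    for w S
  proof (cases w)
    case (Cons x v)
    have "m - Suc 0 \<in> S \<longleftrightarrow> m = 0 \<or> m - Suc 0 \<in> S" if "m \<noteq> 0" for m using that by simp
    then show ?thesis
      unfolding gap_words_def later_def Cons by (simp add: upt0 o_def del: upt_Suc)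
  qed (simp add: gap_words_def later_def)
  have later: "later (x # w) S = (if 0 \<in> S then gap_words w {j. Suc j \<in> S} else later w {j. Suc j \<in> S})"
    for x w S
  proof -
    let ?X = "\<lambda>i. [nths w (component (length w) {j. Suc j \<in> S} i)]"
    have "later (x # w) S = concat (map (\<lambda>i. if Suc i \<notin> S \<and> i \<in> S then ?X i else []) [0..<length w])"
      by (simp add: later_def upt0 o_def nths_Cons compS comp0S del: upt_Suc cong: if_cong)
    also have "(\<lambda>i. if Suc i \<notin> S \<and> i \<in> S then ?X i else []) =
      (\<lambda>i. if i \<notin> {j. Suc j \<in> S} \<and> (if 0 \<in> S then i = 0 \<or> i - 1 \<in> {j. Suc j \<in> S}
        else i \<noteq> 0 \<and> i - 1 \<in> {j. Suc j \<in> S}) then ?X i else [])"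
    proof
      show "(if Suc i \<notin> S \<and> i \<in> S then ?X i else []) =
        (if i \<notin> {j. Suc j \<in> S} \<and> (if 0 \<in> S then i = 0 \<or> i - 1 \<in> {j. Suc j \<in> S}
          else i \<noteq> 0 \<and> i - 1 \<in> {j. Suc j \<in> S}) then ?X i else [])" for i
        by (cases i) auto
    qed
    finally show ?thesis
      unfolding later_def gap_words_def by presburger
  qed
  have "hd (gaps w S) = nths w (component (length w) S 0) \<and>
    filter (\<lambda>u. u \<noteq> []) (tl (gaps w S)) = later w S"
  proof (induction w arbitrary: S)
    case Nil
    then show ?case by (simp add: later_def)
  next
    case (Cons x w)
    have e: "filter (\<lambda>u. u \<noteq> []) (gaps w S') = gap_words w S'" for S'
    proof -
      have "gaps w S' = hd (gaps w S') # tl (gaps w S')" by simp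
      then have "filter (\<lambda>u. u \<noteq> []) (gaps w S') =
        filter (\<lambda>u. u \<noteq> []) [hd (gaps w S')] @ filter (\<lambda>u. u \<noteq> []) (tl (gaps w S'))"
        by (metis append_Cons append_Nil filter_append)
      then show ?thesis by (simp add: Cons.IH gw comp_empty)
    qed
    show ?case
    proof (cases "0 \<in> S")
      case True
      have "component n S 0 = {}" for n using True by (auto simp: component_def)
      with True show ?thesis by (simp add: Let_def later e)
    next
      case False
      then have "0 \<in> component (Suc (length w)) S 0" by (simp add: component_def)
      with False show ?thesis by (simp add: Let_def later Cons.IH nths_Cons comp0)
    qed
  qed
  moreover have "filter (\<lambda>u. u \<noteq> []) (gaps w S) =
        filter (\<lambda>u. u \<noteq> []) [hd (gaps w S)] @ filter (\<lambda>u. u \<noteq> []) (tl (gaps w S))"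
    by (metis append_Cons append_Nil filter_append gaps_nonempty list.exhaust_sel)
  ultimately show ?thesis by (simp add: gw comp_empty)
qed

lemma hd_gaps_empty_iff: "w \<noteq> [] \<Longrightarrow> hd (gaps w S) = [] \<longleftrightarrow> 0 \<in> S"
  by (cases w) (auto simp: Let_def)

lemma sum_Pow_lessThan_Suc:
  "(\<Sum>S\<in>Pow {..<Suc n}. h S) = (\<Sum>S\<in>Pow {..<n}. h (insert 0 (Suc ` S)) + h (Suc ` S))"
    (is "?l = ?r")
proof -
  have Pow: "Pow {..<Suc n} = (`) Suc ` Pow {..<n} \<union> (\<lambda>S. insert 0 (Suc ` S)) ` Pow {..<n}"
    unfolding lessThan_Suc_eq_insert_0 Pow_insert image_Pow_surj [OF refl, symmetric] image_image ..
  have inj: "inj_on ((`) Suc) (Pow {..<n})" "inj_on (\<lambda>S. insert 0 (Suc ` S)) (Pow {..<n})"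
    by (auto simp: inj_on_def)
  have "?l = (\<Sum>S\<in>Pow {..<n}. h (Suc ` S)) + (\<Sum>S\<in>Pow {..<n}. h (insert 0 (Suc ` S)))"
    unfolding Pow by (subst sum.union_disjoint) (auto simp: sum.reindex [OF inj(1)] sum.reindex [OF inj(2)])
  then show ?thesis by (simp add: sum.distrib add.commute)
qed

lemma word_conv_eq_sum:
  "(\<Sum>S\<in>Pow {..<length w}. f (nths w S) * P (hd (gaps w S)) * prod_list (map p (tl (gaps w S)))) =
   word_conv f p P w"
proof (induction w arbitrary: f P)
  case (Cons x w)
  have g: "prod_list (map p (gaps w S)) = p (hd (gaps w S)) * prod_list (map p (tl (gaps w S)))" for S
    by (metis gaps_nonempty list.exhaust_sel list.simps(9) prod_list.Cons)
  have im: "0 \<in> Suc ` S \<longleftrightarrow> False" "Suc j \<in> Suc ` S \<longleftrightarrow> j \<in> S" for S j by auto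
  show ?case
    unfolding length_Cons sum_Pow_lessThan_Suc
    by (simp add: nths_Cons im Let_def g sum.distrib Cons.IH [symmetric] sum_distrib_left algebra_simps)
qed simp

text \<open>If all gaps except the first are empty, the selected letters form a suffix.\<close>

lemma word_conv_first_gap_only:
  "word_conv f empty_word b w = (\<Sum>k\<le>length w. b (take k w) * f (drop k w))"
proof (induction w arbitrary: b)
  case (Cons x w)
  show ?case
    unfolding length_Cons sum.atMost_Suc_shift by (simp add: Cons.IH algebra_simps)
qed simp

lemma tensor_eval_split_word:
  assumes "finite \<S>"
  shows "tensor_eval f g (tensor_mult (split_word w \<S>) B) =
    (\<Sum>S\<in>\<S>. tensor_eval (\<lambda>u. f (subword w S @ u)) (\<lambda>v. g (gap_words w S @ v)) B)"
  using assms
proof (induction rule: finite_induct)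
  case (insert S \<S>)
  have "image_mset (\<lambda>(u, v). f u * g v) (image_mset (\<lambda>(u', v'). (a @ u', b @ v')) B) =
    image_mset (\<lambda>(u, v). f (a @ u) * g (b @ v)) B" for a b
    unfolding image_mset.compositionality by (rule image_mset_cong) auto
  with insert show ?case
    by (simp add: split_word_def tensor_mult_def tensor_eval_def)
qed (simp add: split_word_def tensor_mult_def tensor_eval_def)

text \<open>Lists in which an empty word occurs are not tensors; forms vanish on them, also if \<open>p [] = 1\<close>.\<close>

definition character_of :: "('a list \<Rightarrow> complex) \<Rightarrow> 'a form" where
  "character_of p ws = (if [] \<in> set ws then 0 else prod_list (map p ws))"

definition as_tensor :: "'a list \<Rightarrow> 'a list list" where
  "as_tensor u = (if u = [] then [] else [u])"

lemma subword_as_tensor: "subword w S = as_tensor (nths w S)"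
  by (simp add: subword_def as_tensor_def)

lemma character_of_append: "character_of p (us @ vs) = character_of p us * character_of p vs"
  by (simp add: character_of_def)

lemma character_of_Cons: "character_of p (w # ws) = (if w = [] then 0 else p w) * character_of p ws"
  by (simp add: character_of_def)

lemma character_of_as_tensor: "p [] = 1 \<Longrightarrow> character_of p (as_tensor u) = p u"
  by (simp add: character_of_def as_tensor_def)

lemma character_of_gap_words:
  assumes "p [] = 1"
  shows "character_of p (gap_words w S) = p (hd (gaps w S)) * prod_list (map p (tl (gaps w S)))"
proof -
  have "prod_list (map p (filter (\<lambda>u. u \<noteq> []) us)) = prod_list (map p us)" for us
    by (induction us) (simp_all add: assms)
  then have "character_of p (gap_words w S) = prod_list (map p (gaps w S))"
    by (simp add: character_of_def gap_words_eq_filter_gaps)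
  then show ?thesis
    by (metis gaps_nonempty list.exhaust_sel list.simps(9) prod_list.Cons)
qed

lemma tensor_eval_scale:
  "tensor_eval (\<lambda>u. c * f u) (\<lambda>v. d * g v) A = c * d * tensor_eval f g A"
  unfolding tensor_eval_def by (induction A) (auto simp: algebra_simps)

lemma tensor_eval_zero: "tensor_eval f (\<lambda>v. 0) A = 0"
  unfolding tensor_eval_def by (induction A) auto

text \<open>Values on empty gaps are \<open>1\<close>, so that summing over all gaps agrees with summing over \<open>gap_words\<close>.\<close>

lemma conv_character_of:
  assumes "p [] = 1" "q [] = 1"
  shows "character_of p \<star> character_of q = character_of (word_conv p q q)"
proof
  fix ws
  show "(character_of p \<star> character_of q) ws = character_of (word_conv p q q) ws"
  proof (induction ws)
    case Nil
    then show ?case by (simp add: conv_def tensor_eval_def character_of_def)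
  next
    case (Cons w ws)
    have "(character_of p \<star> character_of q) (w # ws) =
      (\<Sum>S\<in>word_subsets w. character_of p (subword w S) * character_of q (gap_words w S)) *
      (character_of p \<star> character_of q) ws"
      by (simp add: conv_def tensor_eval_split_word word_subsets_def character_of_append
          tensor_eval_scale sum_distrib_right)
    also have "(\<Sum>S\<in>word_subsets w. character_of p (subword w S) * character_of q (gap_words w S)) =
      (if w = [] then 0 else word_conv p q q w)"
      by (simp add: word_subsets_def subword_as_tensor character_of_as_tensor character_of_gap_words assms
          word_conv_eq_sum [symmetric] mult.assoc)
    finally show ?case by (simp add: Cons.IH character_of_Cons)
  qed
qed

text \<open>The counit is a right unit: a term survives only if no gap is left in any word.\<close>

lemma tensor_eval_coprod_counit:
  "tensor_eval F (\<lambda>v. if v = [] then c else 0) (coprod ws) = (if [] \<in> set ws then 0 else F ws * c)"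
proof (induction ws arbitrary: F)
  case Nil
  then show ?case by (simp add: tensor_eval_def)
next
  case (Cons w ws)
  show ?case
  proof (cases "w = []")
    case True
    then show ?thesis by (simp add: tensor_eval_split_word word_subsets_def)
  next
    case False
    let ?G = "\<lambda>s. if [] \<in> set ws then 0 else F (as_tensor s @ ws) * c"
    have ind: "(if gap_words w S = [] then 1 else 0) =
      empty_word (hd (gaps w S)) * prod_list (map empty_word (tl (gaps w S)))" for S
    proof -
      have "character_of empty_word us = (if us = [] then 1 else 0)" for us :: "'a list list"
        by (cases us) (auto simp: character_of_Cons empty_word_def, simp add: character_of_def)
      then show ?thesis using character_of_gap_words [of empty_word w S] by simp
    qed
    have te: "tensor_eval (\<lambda>u. F (subword w S @ u)) (\<lambda>v. if gap_words w S @ v = [] then c else 0) (coprod ws)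
       = (if gap_words w S = [] then 1 else 0) * ?G (nths w S)" for S
      by (cases "gap_words w S = []") (simp_all add: Cons.IH subword_as_tensor tensor_eval_zero)
    have "tensor_eval F (\<lambda>v. if v = [] then c else 0) (coprod (w # ws)) =
      (\<Sum>S\<in>Pow {..<length w}. (if gap_words w S = [] then 1 else 0) * ?G (nths w S))"
      unfolding coprod.simps using False
      by (subst tensor_eval_split_word) (simp_all add: word_subsets_def te del: append_is_Nil_conv)
    also have "\<dots> = word_conv ?G empty_word empty_word w"
      unfolding ind word_conv_eq_sum [symmetric] by (simp add: mult_ac)
    also have "\<dots> = ?G w" by (rule word_conv_empty_gaps)
    finally show ?thesis using False by (simp add: as_tensor_def)
  qed
qed

text \<open>The first letter is not selected, so the first word has a gap at its start.  As \<open>b\<close> sees exactly one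
word, this gap is the only one: in the first word a suffix is selected, in every other word
everything.\<close>

lemma half_right_infinitesimal:
  assumes "\<And>ws. length ws \<noteq> 1 \<Longrightarrow> b ws = 0"
  shows "(f \<rhd> b) (w # ws) = (if [] \<in> set (w # ws) then 0 else
    (\<Sum>k<length w. f (as_tensor (drop (Suc k) w) @ ws) * b [take (Suc k) w]))"
proof (cases "w = []")
  case True
  then show ?thesis by (simp add: half_right_def tensor_eval_split_word word_subsets_def)
next
  case False
  let ?F = "\<lambda>s. if [] \<in> set ws then 0 else f (as_tensor s @ ws)"
  let ?B = "\<lambda>u. if u = [] then 0 else b [u]"
  have te: "tensor_eval (\<lambda>u. f (subword w S @ u)) (\<lambda>v. b (gap_words w S @ v)) (coprod ws) =
    ?F (nths w S) * ?B (hd (gaps w S)) * prod_list (map empty_word (tl (gaps w S)))"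
    if "0 \<notin> S" for S
  proof -
    have hd: "hd (gaps w S) \<noteq> []" using False that by (simp add: hd_gaps_empty_iff)
    have gw: "gap_words w S = hd (gaps w S) # filter (\<lambda>u. u \<noteq> []) (tl (gaps w S))"
    proof -
      have "filter (\<lambda>u. u \<noteq> []) (gaps w S) =
          filter (\<lambda>u. u \<noteq> []) (hd (gaps w S) # tl (gaps w S))"
        by (rule arg_cong) simp
      then show ?thesis using hd by (simp only: gap_words_eq_filter_gaps filter.simps if_True) simp
    qed
    have "b (gap_words w S @ v) = (if v = [] then b (gap_words w S) else 0)" for v
      using gw by (auto intro!: assms)
    then have "tensor_eval (\<lambda>u. f (subword w S @ u)) (\<lambda>v. b (gap_words w S @ v)) (coprod ws) =
       ?F (nths w S) * b (gap_words w S)"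
      by (simp add: tensor_eval_coprod_counit subword_as_tensor)
    also have "b (gap_words w S) = b [hd (gaps w S)] * prod_list (map empty_word (tl (gaps w S)))"
    proof -
      have "b (u # filter (\<lambda>u. u \<noteq> []) us) = b [u] * prod_list (map empty_word us)" for u us
        by (induction us) (auto simp: empty_word_def assms)
      then show ?thesis by (simp add: gw)
    qed
    finally show ?thesis using hd by simp
  qed
  have "(f \<rhd> b) (w # ws) =
    (\<Sum>S\<in>{S\<in>Pow {..<length w}. 0 \<notin> S}. ?F (nths w S) * ?B (hd (gaps w S)) * prod_list (map empty_word (tl (gaps w S))))"
    using False by (simp add: half_right_def tensor_eval_split_word word_subsets_def te)
  also have "\<dots> = (\<Sum>S\<in>Pow {..<length w}. ?F (nths w S) * ?B (hd (gaps w S)) * prod_list (map empty_word (tl (gaps w S))))"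
    by (rule sum.mono_neutral_left) (use False hd_gaps_empty_iff [of w] in auto)
  also have "\<dots> = (\<Sum>k\<le>length w. ?B (take k w) * ?F (drop k w))"
    using word_conv_eq_sum [where f = "?F" and P = "?B" and p = empty_word and w = w]
    by (simp only: word_conv_first_gap_only)
  also have "\<dots> = (\<Sum>k<length w. ?B (take (Suc k) w) * ?F (drop (Suc k) w))"
    unfolding lessThan_Suc_atMost [symmetric] sum.lessThan_Suc_shift by simp
  finally show ?thesis using False by (auto intro!: sum.cong)
qed

text \<open>The first letter is selected, hence the gap at the start is empty and the word selected from \<open>w\<close> is
not; it is the first argument of \<open>h\<close>, and the other words contribute a convolution of their own.\<close>

lemma half_left_character_of:
  assumes h: "\<And>s us. s \<noteq> [] \<Longrightarrow> h (s # us) = k s * g us" and p: "p [] = 1"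
  shows "(h \<lhd> character_of p) (w # ws) =
    (if w = [] then 0 else word_conv k p empty_word w * (g \<star> character_of p) ws)"
proof (cases "w = []")
  case True
  then show ?thesis by (simp add: half_left_def tensor_eval_split_word word_subsets_def)
next
  case False
  have te: "tensor_eval (\<lambda>u. h (subword w S @ u)) (\<lambda>v. character_of p (gap_words w S @ v)) (coprod ws) =
    k (nths w S) * empty_word (hd (gaps w S)) * prod_list (map p (tl (gaps w S))) * (g \<star> character_of p) ws"
    if "0 \<in> S" for S
  proof -
    have "nths w S \<noteq> []" using that False by (cases w) (simp_all add: nths_Cons)
    moreover have "hd (gaps w S) = []" using False that by (simp add: hd_gaps_empty_iff)
    ultimately show ?thesis
      by (simp add: subword_as_tensor as_tensor_def h character_of_append character_of_gap_words p
          tensor_eval_scale conv_def)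
  qed
  have "(h \<lhd> character_of p) (w # ws) =
    (\<Sum>S\<in>{S\<in>Pow {..<length w}. 0 \<in> S}.
      k (nths w S) * empty_word (hd (gaps w S)) * prod_list (map p (tl (gaps w S)))) * (g \<star> character_of p) ws"
    using False by (simp add: half_left_def tensor_eval_split_word word_subsets_def te sum_distrib_right)
  also have "(\<Sum>S\<in>{S\<in>Pow {..<length w}. 0 \<in> S}.
      k (nths w S) * empty_word (hd (gaps w S)) * prod_list (map p (tl (gaps w S)))) =
    (\<Sum>S\<in>Pow {..<length w}.
      k (nths w S) * empty_word (hd (gaps w S)) * prod_list (map p (tl (gaps w S))))"
    by (rule sum.mono_neutral_left) (use False hd_gaps_empty_iff [of w] in \<open>auto simp: empty_word_def\<close>)
  finally show ?thesis using False by (simp add: word_conv_eq_sum)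
qed

section \<open>Characters, inverses and the half-shuffle exponential\<close>

definition multilinear :: "(complex \<Rightarrow> 'a::ring_1 \<Rightarrow> 'a) \<Rightarrow> ('a list \<Rightarrow> complex) \<Rightarrow> bool" where
  "multilinear scale p \<longleftrightarrow> (\<forall>u v. Vector_Spaces.linear scale (*) (\<lambda>a. p (u @ a # v)))"

lemma vector_space_complex: "vector_space ((*) :: complex \<Rightarrow> complex \<Rightarrow> complex)"
  by unfold_locales (simp_all add: algebra_simps)

lemma prefix_conv_lin_left:
  "prefix_conv (\<lambda>u. c * f u + d * g u) q w = c * prefix_conv f q w + d * prefix_conv g q w"
  by (induction w arbitrary: f g) (simp_all add: algebra_simps)

lemma prefix_conv_empty_word: "w \<noteq> [] \<Longrightarrow> prefix_conv b empty_word w = b w"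
proof (induction w arbitrary: b)
  case (Cons x w)
  then show ?case by (cases w) (simp_all del: prefix_conv.simps(2) add: prefix_conv.simps(2) [of _ _ x])
qed simp

text \<open>Each factor of the half-shuffle power uses up at least one letter.\<close>

lemma half_right_power_vanishes:
  assumes b: "\<And>ws. length ws \<noteq> 1 \<Longrightarrow> b ws = 0"
  shows "length (concat ws) < n \<Longrightarrow> half_right_power b n ws = 0"
proof (induction n arbitrary: ws)
  case (Suc n)
  show ?case
  proof (cases ws)
    case Nil
    then show ?thesis by (simp add: half_right_def tensor_eval_def)
  next
    case (Cons w vs)
    have "half_right_power b n (as_tensor (drop (Suc k) w) @ vs) = 0" if "k < length w" for k
      by (rule Suc.IH) (use Suc.prems Cons that in \<open>auto simp: as_tensor_def\<close>)
    then show ?thesis by (simp add: Cons half_right_infinitesimal [OF b])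
  qed
qed simp

lemma E_right_eq_sum:
  assumes b: "\<And>ws. length ws \<noteq> 1 \<Longrightarrow> b ws = 0" and "length (concat ws) < N"
  shows "E_right b ws = (\<Sum>n<N. half_right_power b n ws)"
  unfolding E_right_def
  by (rule suminf_finite) (use assms in \<open>auto intro!: half_right_power_vanishes\<close>)

text \<open>The fixed point equation \<open>E_right b = counit + E_right b \<rhd> b\<close>, with the half-shuffle product
written out.\<close>

lemma E_right_recursion:
  assumes b: "\<And>ws. length ws \<noteq> 1 \<Longrightarrow> b ws = 0"
  shows "E_right b [] = 1"
    and "E_right b (w # ws) = (if [] \<in> set (w # ws) then 0 else
      (\<Sum>k<length w. E_right b (as_tensor (drop (Suc k) w) @ ws) * b [take (Suc k) w]))"
proof -
  show "E_right b [] = 1"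
    using E_right_eq_sum [OF b, where ws = "[]" and N = 1] by (simp add: counit_def)
  \<comment> \<open>one bound for the number of nonzero terms that serves \<open>w # ws\<close> and all tensors obtained from it\<close>
  define N where "N = Suc (length (concat (w # ws)))"
  have "E_right b (w # ws) = (\<Sum>n<Suc N. half_right_power b n (w # ws))"
    by (rule E_right_eq_sum [OF b]) (simp_all add: N_def)
  also have "\<dots> = (\<Sum>n<N. half_right_power b (Suc n) (w # ws))"
    unfolding sum.lessThan_Suc_shift by (simp add: counit_def)
  also have "\<dots> = (if [] \<in> set (w # ws) then 0 else
      (\<Sum>k<length w. (\<Sum>n<N. half_right_power b n (as_tensor (drop (Suc k) w) @ ws)) * b [take (Suc k) w]))"
    by (simp add: half_right_infinitesimal [OF b] sum_distrib_right sum.swap [of _ "{..<N}"])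
  also have "(\<Sum>k<length w. (\<Sum>n<N. half_right_power b n (as_tensor (drop (Suc k) w) @ ws)) * b [take (Suc k) w]) =
     (\<Sum>k<length w. E_right b (as_tensor (drop (Suc k) w) @ ws) * b [take (Suc k) w])"
    by (rule sum.cong [OF refl], subst E_right_eq_sum [OF b, where N = N]) (auto simp: as_tensor_def N_def)
  finally show "E_right b (w # ws) = (if [] \<in> set (w # ws) then 0 else
      (\<Sum>k<length w. E_right b (as_tensor (drop (Suc k) w) @ ws) * b [take (Suc k) w]))" .
qed

text \<open>The half-shuffle exponential is multiplicative: its recursion takes letters from the first word only,
and so does the product of the values of \<open>q\<close>.  On single words it passes from Boolean cumulants
to moments.\<close>

lemma E_right_eq_character_of:
  assumes b: "\<And>ws. length ws \<noteq> 1 \<Longrightarrow> b ws = 0"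
    and q: "q [] = 1" "\<And>w. w \<noteq> [] \<Longrightarrow> q w = prefix_conv (\<lambda>u. b [u]) q w"
  shows "E_right b = character_of q"
proof
  show "E_right b ws = character_of q ws" for ws
  proof (induction "length (concat ws)" arbitrary: ws rule: less_induct)
    case less
    show ?case
    proof (cases ws)
      case Nil
      then show ?thesis by (simp add: E_right_recursion [OF b] character_of_def)
    next
      case (Cons w vs)
      show ?thesis
      proof (cases "[] \<in> set ws")
        case True
        then show ?thesis by (simp add: Cons E_right_recursion [OF b] character_of_def)
      next
        case False
        have "E_right b ws = (\<Sum>k<length w. character_of q (as_tensor (drop (Suc k) w) @ vs) * b [take (Suc k) w])"
          unfolding Cons using False Cons
          by (simp add: E_right_recursion [OF b])
             (intro sum.cong refl arg_cong2 [where f = "(*)"] less, auto simp: as_tensor_def)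
        also have "\<dots> = prefix_conv (\<lambda>u. b [u]) q w * character_of q vs"
          by (simp add: character_of_append character_of_as_tensor q(1) prefix_conv_sum
              sum_distrib_left sum_distrib_right mult_ac)
        also have "\<dots> = character_of q ws"
          using False Cons q(2) [of w] by (simp add: character_of_Cons)
        finally show ?thesis .
      qed
    qed
  qed
qed

lemma prefix_conv_right_local:
  assumes "\<forall>v. length v < length w \<longrightarrow> f v = g v"
  shows "prefix_conv b f w = prefix_conv b g w"
  unfolding prefix_conv_sum using assms by (intro sum.cong refl arg_cong2 [where f = "(*)"]) auto

text \<open>The whole word is the only prefix that is not shorter, so moments determine Boolean cumulants.\<close>

lemma prefix_conv_left_local:
  assumes "q [] = 1" "w \<noteq> []" "\<forall>v. length v < length w \<longrightarrow> f v = g v"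
  shows "f w - prefix_conv f q w = g w - prefix_conv g q w"
proof -
  obtain n where n: "length w = Suc n" using assms(2) by (cases w) auto
  have "prefix_conv h q w = (\<Sum>k<n. h (take (Suc k) w) * q (drop (Suc k) w)) + h w" for h
    unfolding prefix_conv_sum n by (simp add: n assms(1))
  moreover have "(\<Sum>k<n. f (take (Suc k) w) * q (drop (Suc k) w)) = (\<Sum>k<n. g (take (Suc k) w) * q (drop (Suc k) w))"
    using assms(3) n by (intro sum.cong refl arg_cong2 [where f = "(*)"]) auto
  ultimately show ?thesis by simp
qed

lemma prefix_conv_cancel:
  assumes "q [] = 1" "\<And>w. w \<noteq> [] \<Longrightarrow> prefix_conv b q w = prefix_conv c q w" "w \<noteq> []"
  shows "b w = c w"
proof -
  \<comment> \<open>the values at the empty word never enter \<open>prefix_conv\<close> and may differ\<close>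
  define b' where "b' w = (if w = [] then 0 else b w)" for w
  define c' where "c' w = (if w = [] then 0 else c w)" for w
  have *: "prefix_conv b' q w = prefix_conv b q w" "prefix_conv c' q w = prefix_conv c q w" for w
    unfolding prefix_conv_sum b'_def c'_def by (intro sum.cong; auto)+
  have "b' w = c' w" for w
  proof (induction w rule: measure_induct_rule [of length])
    case (less w)
    show ?case
    proof (cases "w = []")
      case False
      then show ?thesis
        using prefix_conv_left_local [where q = q and w = w and f = b' and g = c', OF assms(1) False] less assms(2) [OF False]
        by (simp add: *)
    qed (simp add: b'_def c'_def)
  qed
  from this [of w] show ?thesis using assms(3) by (simp add: b'_def c'_def)
qed

context complex_algebra
begin

lemma functional_iff:
  "Vector_Spaces.linear scale (*) f \<longleftrightarrow>
     (\<forall>x y. f (x + y) = f x + f y) \<and> (\<forall>c x. f (scale c x) = c * f x)"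
  using vector_space_axioms by (auto simp: Vector_Spaces.linear_iff vector_space_complex)

lemma multilinearD:
  assumes "multilinear scale p"
  shows "p (u @ (a + b) # v) = p (u @ a # v) + p (u @ b # v)"
    and "p (u @ scale c a # v) = c * p (u @ a # v)"
    and "p ((a + b) # v) = p (a # v) + p (b # v)"
    and "p (scale c a # v) = c * p (a # v)"
proof -
  have *: "(\<forall>a b. p (u @ (a + b) # v) = p (u @ a # v) + p (u @ b # v)) \<and>
    (\<forall>c a. p (u @ scale c a # v) = c * p (u @ a # v))" for u v
    using assms by (simp add: multilinear_def functional_iff)
  show "p (u @ (a + b) # v) = p (u @ a # v) + p (u @ b # v)" "p (u @ scale c a # v) = c * p (u @ a # v)"
    using * by blast+
  show "p ((a + b) # v) = p (a # v) + p (b # v)" "p (scale c a # v) = c * p (a # v)"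
    using * [of "[]" v] by simp_all
qed

lemma multilinearI:
  assumes "\<And>u v a b. p (u @ (a + b) # v) = p (u @ a # v) + p (u @ b # v)"
    and "\<And>u v c a. p (u @ scale c a # v) = c * p (u @ a # v)"
  shows "multilinear scale p"
  using assms by (simp add: multilinear_def functional_iff)

lemma multilinear_Cons: "multilinear scale p \<Longrightarrow> multilinear scale (\<lambda>u. p (x # u))"
  using multilinearD(1,2) [of p "x # _"] by (intro multilinearI) simp_all

lemma multilinear_empty_word: "multilinear scale empty_word"
  by (rule multilinearI) (simp_all add: empty_word_def)

lemma multilinear_add: "multilinear scale p \<Longrightarrow> multilinear scale q \<Longrightarrow> multilinear scale (\<lambda>w. p w + q w)"
  by (rule multilinearI) (simp_all add: multilinearD algebra_simps)

lemma multilinear_diff: "multilinear scale p \<Longrightarrow> multilinear scale q \<Longrightarrow> multilinear scale (\<lambda>w. p w - q w)"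
  by (rule multilinearI) (simp_all add: multilinearD algebra_simps)

lemma multilinear_word_conv:
  assumes "multilinear scale p" "multilinear scale f" "multilinear scale P"
  shows "multilinear scale (word_conv f p P)"
proof (rule multilinearI)
  fix u v a b c
  show "word_conv f p P (u @ (a + b) # v) = word_conv f p P (u @ a # v) + word_conv f p P (u @ b # v)"
    using assms(2,3)
  proof (induction u arbitrary: f P)
    case Nil
    then show ?case by (simp add: multilinearD word_conv_linear algebra_simps)
  next
    case (Cons x u)
    then show ?case using assms(1) by (simp add: multilinear_Cons algebra_simps)
  qed
  show "word_conv f p P (u @ scale c a # v) = c * word_conv f p P (u @ a # v)"
    using assms(2,3)
  proof (induction u arbitrary: f P)
    case Nil
    then show ?case by (simp add: multilinearD word_conv_linear algebra_simps)
  next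
    case (Cons x u)
    then show ?case using assms(1) by (simp add: multilinear_Cons algebra_simps)
  qed
qed

lemma multilinear_prefix_conv:
  assumes "multilinear scale q" "multilinear scale b"
  shows "multilinear scale (prefix_conv b q)"
proof (rule multilinearI)
  note lin = prefix_conv_lin_left [where c = 1 and d = 1, simplified]
    prefix_conv_lin_left [where d = 0, simplified]
  fix u v a1 a2 c
  show "prefix_conv b q (u @ (a1 + a2) # v) = prefix_conv b q (u @ a1 # v) + prefix_conv b q (u @ a2 # v)"
    using assms(2)
  proof (induction u arbitrary: b)
    case Nil
    then show ?case by (simp add: multilinearD lin algebra_simps)
  next
    case (Cons x u)
    then show ?case using assms(1) by (simp add: multilinear_Cons multilinearD algebra_simps)
  qed
  show "prefix_conv b q (u @ scale c a1 # v) = c * prefix_conv b q (u @ a1 # v)"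
    using assms(2)
  proof (induction u arbitrary: b)
    case Nil
    then show ?case by (simp add: multilinearD lin algebra_simps)
  next
    case (Cons x u)
    then show ?case using assms(1) by (simp add: multilinear_Cons multilinearD algebra_simps)
  qed
qed

text \<open>Solutions of recursions on the length inherit multilinearity from the operator.  At length \<open>n\<close> the
operator sees only shorter words, so \<open>f\<close> can be replaced by its truncation below \<open>n\<close>, which is
multilinear by induction.\<close>

lemma multilinear_fixpoint:
  assumes pres: "\<And>f. multilinear scale f \<Longrightarrow> multilinear scale (T f)"
    and loc: "\<And>f g w. w \<noteq> [] \<Longrightarrow> \<forall>v. length v < length w \<longrightarrow> f v = g v \<Longrightarrow> T f w = T g w"
    and fp: "\<And>w. w \<noteq> [] \<Longrightarrow> f w = T f w"
  shows "multilinear scale f"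
proof -
  have "f (u @ (a + b) # v) = f (u @ a # v) + f (u @ b # v) \<and> f (u @ scale c a # v) = c * f (u @ a # v)"
    for u v a b c
  proof (induction "length u + length v" arbitrary: u v a b c rule: less_induct)
    case less
    define g where "g w = (if length w < Suc (length u + length v) then f w else 0)" for w
    have "multilinear scale g"
      using less by (intro multilinearI) (simp_all add: g_def)
    then have "multilinear scale (T g)" by (rule pres)
    moreover have "f (u @ x # v) = T g (u @ x # v)" for x
      by (subst fp, simp, rule loc) (simp_all add: g_def)
    ultimately show ?case by (simp add: multilinearD)
  qed
  then show ?thesis by (intro multilinearI) blast+
qed

lemma character_of_in_characters:
  assumes "multilinear scale p"
  shows "character_of p \<in> characters scale"
proof -
  have "Vector_Spaces.linear scale (*) (\<lambda>a. character_of p (us @ (u @ a # v) # vs))" for us u v vs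
    using assms by (simp add: functional_iff character_of_append character_of_Cons multilinearD algebra_simps)
  then show ?thesis
    by (auto simp: characters_def linear_form_def character_of_append) (simp_all add: character_of_def)
qed

lemma charactersE:
  assumes "\<Phi> \<in> characters scale"
  obtains p where "p [] = 1" "multilinear scale p" "\<Phi> = character_of p"
proof -
  define p where "p w = (if w = [] then 1 else \<Phi> [w])" for w
  have lin: "Vector_Spaces.linear scale (*) (\<lambda>a. \<Phi> ([] @ (u @ a # v) # []))" for u v
    using assms unfolding characters_def linear_form_def by blast
  have mult: "\<Phi> (us @ vs) = \<Phi> us * \<Phi> vs" "\<Phi> [] = 1" for us vs
    using assms unfolding characters_def by blast+
  have zero: "[] \<in> set ws \<Longrightarrow> \<Phi> ws = 0" for ws
    using assms unfolding characters_def linear_form_def by blast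
  have "\<Phi> ws = character_of p ws" for ws
  proof (induction ws)
    case (Cons w ws)
    then show ?case using mult(1) [of "[w]" ws] zero [of "[w]"] by (simp add: character_of_Cons p_def)
  qed (simp add: mult character_of_def)
  then have "\<Phi> = character_of p" by blast
  moreover have "p [] = 1" "multilinear scale p"
    using lin by (simp_all add: multilinear_def p_def)
  ultimately show thesis by (intro that)
qed

lemma character_of_inject:
  assumes "character_of p = character_of q" "w \<noteq> []"
  shows "p w = q w"
  using fun_cong [OF assms(1), of "[w]"] assms(2) by (simp add: character_of_def)

lemma character_of_empty_word: "character_of empty_word = counit"
proof
  show "character_of empty_word ws = counit ws" for ws :: "'z list list"
    by (cases ws) (auto simp: character_of_Cons counit_def empty_word_def, simp add: character_of_def)
qed

lemma E_right_infinitesimal: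
  assumes b: "b \<in> infinitesimal_characters scale"
  obtains q where "q [] = 1" "multilinear scale q" "E_right b = character_of q"
    "\<And>w. w \<noteq> [] \<Longrightarrow> q w = prefix_conv (\<lambda>u. b [u]) q w"
proof -
  have zero: "b ws = 0" if "length ws \<noteq> 1" for ws
  proof (cases ws)
    case Nil
    then show ?thesis using b by (simp add: infinitesimal_characters_def)
  next
    case (Cons w vs)
    then have "2 \<le> length ws" using that by (cases vs) auto
    then show ?thesis using b by (simp add: infinitesimal_characters_def)
  qed
  have lin: "Vector_Spaces.linear scale (*) (\<lambda>a. b ([] @ (u @ a # v) # []))" for u v
    using b unfolding infinitesimal_characters_def linear_form_def by blast
  then have ml: "multilinear scale (\<lambda>u. b [u])" by (simp add: multilinear_def)
  obtain q where q: "q [] = 1" "\<And>w. w \<noteq> [] \<Longrightarrow> q w = prefix_conv (\<lambda>u. b [u]) q w"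
    by (rule length_recursion [of "prefix_conv (\<lambda>u. b [u])" 1], erule prefix_conv_right_local, blast)
  show thesis
  proof
    show "multilinear scale q"
      by (rule multilinear_fixpoint [where T = "prefix_conv (\<lambda>u. b [u])"])
         (auto intro: multilinear_prefix_conv ml q dest: prefix_conv_right_local)
    show "E_right b = character_of q"
      by (rule E_right_eq_character_of [where b = b and q = q, OF zero q])
  qed (fact q)+
qed

text \<open>\<open>E_right\<close> maps the infinitesimal characters onto the characters: solve for the Boolean cumulants by
recursion on the length.\<close>

lemma L_right_character:
  assumes "\<Phi> \<in> characters scale"
  shows "L_right scale \<Phi> \<in> infinitesimal_characters scale" "E_right (L_right scale \<Phi>) = \<Phi>"
proof -
  obtain p where p: "p [] = 1" "multilinear scale p" "\<Phi> = character_of p"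
    using assms by (rule charactersE)
  \<comment> \<open>the difference does not involve the value of \<open>f\<close> at \<open>w\<close>, so this is a recursion for \<open>f\<close>\<close>
  let ?T = "\<lambda>f w. p w + (f w - prefix_conv f p w)"
  have loc: "?T f w = ?T g w" if "w \<noteq> []" "\<forall>v. length v < length w \<longrightarrow> f v = g v" for f g w
    using prefix_conv_left_local [where q = p and w = w and f = f and g = g, OF p(1) that] by simp
  obtain b where b: "\<And>w. w \<noteq> [] \<Longrightarrow> b w = ?T b w"
    by (rule length_recursion [of ?T 0], erule (1) loc, blast)
  have ml: "multilinear scale b"
  proof (rule multilinear_fixpoint [where T = ?T, OF _ loc b])
    show "multilinear scale (?T f)" if "multilinear scale f" for f
      using that p by (intro multilinear_add multilinear_diff multilinear_prefix_conv)
  qed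
  have pb: "p w = prefix_conv b p w" if "w \<noteq> []" for w
    using b [OF that] by (simp add: algebra_simps)
  define \<beta> where "\<beta> ws = (case ws of [w] \<Rightarrow> if w = [] then 0 else b w | _ \<Rightarrow> 0)" for ws
  have zero: "\<beta> ws = 0" if "length ws \<noteq> 1" for ws
    using that by (auto simp: \<beta>_def split: list.split)
  have inf: "\<beta> \<in> infinitesimal_characters scale"
  proof -
    have "Vector_Spaces.linear scale (*) (\<lambda>a. \<beta> (us @ (u @ a # v) # vs))" for us u v vs
    proof (cases "us = [] \<and> vs = []")
      case True
      then show ?thesis using ml by (simp add: \<beta>_def multilinear_def)
    next
      case False
      then have "\<beta> (us @ (u @ a # v) # vs) = 0" for a
        by (intro zero) (cases us; cases vs; simp)
      then show ?thesis by (simp add: functional_iff)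
    qed
    then show ?thesis
      by (auto simp: infinitesimal_characters_def linear_form_def zero) (auto simp: \<beta>_def split: list.split)
  qed
  have "E_right \<beta> = character_of p"
  proof (rule E_right_eq_character_of [where b = \<beta> and q = p, OF zero p(1)])
    show "p w = prefix_conv (\<lambda>u. \<beta> [u]) p w" if "w \<noteq> []" for w
      unfolding pb [OF that] prefix_conv_sum by (intro sum.cong) (auto simp: \<beta>_def)
  qed auto
  with inf p(3) have "\<Phi> \<in> E_right ` infinitesimal_characters scale"
    by (intro image_eqI [of _ _ \<beta>]) simp_all
  then show "L_right scale \<Phi> \<in> infinitesimal_characters scale" "E_right (L_right scale \<Phi>) = \<Phi>"
    unfolding L_right_def by (rule inv_into_into, rule f_inv_into_f)
qed

lemma word_left_inverse:
  assumes "p [] = 1" "multilinear scale p"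
  obtains t where "t [] = 1" "multilinear scale t" "word_conv t p p = empty_word"
proof -
  \<comment> \<open>for nonempty \<open>w\<close> the inverse has to satisfy \<open>word_conv f p p w = 0\<close>\<close>
  let ?T = "\<lambda>f w. f w - word_conv f p p w"
  have loc: "?T f w = ?T g w" if "w \<noteq> []" "\<forall>v. length v < length w \<longrightarrow> f v = g v" for f g w
    using word_conv_triangular [where p = p and P = p and w = w and f = f and g = g, OF assms(1,1) that(2)] by (simp add: algebra_simps)
  obtain t where t: "t [] = 1" "\<And>w. w \<noteq> [] \<Longrightarrow> t w = ?T t w"
    by (rule length_recursion [of ?T 1], erule (1) loc, blast)
  show thesis
  proof
    show "t [] = 1" by (fact t)
    show "multilinear scale t"
    proof (rule multilinear_fixpoint [where T = ?T, OF _ loc t(2)])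
      show "multilinear scale (?T f)" if "multilinear scale f" for f
        using that assms(2) by (intro multilinear_diff multilinear_word_conv)
    qed
    have "word_conv t p p w = empty_word w" for w
      using t assms(1) by (cases "w = []") (simp_all add: empty_word_def)
    then show "word_conv t p p = empty_word" by blast
  qed
qed

text \<open>Every word function with value \<open>1\<close> on the empty word has a left inverse \<open>t\<close>, which again has a left
inverse \<open>s\<close>; by associativity \<open>s = p\<close>, so \<open>t\<close> is a two-sided inverse.\<close>

lemma char_inverse_character_of:
  assumes p: "p [] = 1" "multilinear scale p"
  obtains t where "t [] = 1" "word_conv t p p = empty_word"
    "char_inverse scale (character_of p) = character_of t" "multilinear scale t"
proof -
  obtain t where t: "t [] = 1" "multilinear scale t" "word_conv t p p = empty_word"
    using p by (rule word_left_inverse)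
  obtain s where s: "s [] = 1" "word_conv s t t = empty_word"
    using t(1,2) by (rule word_left_inverse)
  \<comment> \<open>\<open>s = s * (t * p) = (s * t) * p = p\<close>\<close>
  have "s w = word_conv (word_conv s t t) p p w" for w
    unfolding word_conv_assoc t(3) by simp
  then have "s = p" unfolding s(2) by auto
  have inv: "character_of t \<star> character_of p = counit" "character_of p \<star> character_of t = counit"
    using t s(2) p(1) \<open>s = p\<close> by (simp_all add: conv_character_of character_of_empty_word)
  show thesis
  proof
    show "char_inverse scale (character_of p) = character_of t"
      unfolding char_inverse_def
    proof (rule the_equality)
      fix \<Theta>
      assume \<Theta>: "\<Theta> \<in> characters scale \<and> \<Theta> \<star> character_of p = counit \<and> character_of p \<star> \<Theta> = counit"
      then obtain r where r: "r [] = 1" "\<Theta> = character_of r" by (blast elim: charactersE)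
      have "character_of (word_conv r p p) = character_of empty_word"
        using \<Theta> r p(1) by (simp add: conv_character_of character_of_empty_word)
      from character_of_inject [OF this] have "word_conv r p p w = empty_word w" for w
        using r(1) p(1) by (cases "w = []") auto
      then have "word_conv r p p = empty_word" by blast
      then have "t w = r w" for w
        using word_conv_assoc [of r p p t t w] s(2) \<open>s = p\<close> by simp
      then show "\<Theta> = character_of t" using r(2) by (metis ext)
    qed (use inv character_of_in_characters [OF t(2)] in blast)
  qed (use t in auto)
qed

text \<open>The conditionally monotone convolution of characters in terms of words: in the first component, the
Boolean cumulants \<open>b2\<close> are increased by the bridges that carry \<open>b1\<close> on the selected letters and
\<open>r2\<close> on the gaps.\<close>

theorem cmonotone_char_conv_words:
  assumes "\<Phi>1 = character_of p1" "multilinear scale p1" "p1 [] = 1"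
    and "\<Phi>2 = character_of p2" "multilinear scale p2" "p2 [] = 1"
    and "\<Psi>1 = character_of r1" "multilinear scale r1" "r1 [] = 1"
    and "\<Psi>2 = character_of r2" "multilinear scale r2" "r2 [] = 1"
    and conv: "(\<Phi>, \<Psi>) = cmonotone_char_conv scale (\<Phi>1, \<Psi>1) (\<Phi>2, \<Psi>2)"
  obtains q b1 b2 where
    "\<Psi> = character_of (word_conv r1 r2 r2)" "\<Psi> \<in> characters scale"
    "\<Phi> = character_of q" "\<Phi> \<in> characters scale" "q [] = 1"
    "\<And>w. w \<noteq> [] \<Longrightarrow> p1 w = prefix_conv b1 p1 w"
    "\<And>w. w \<noteq> [] \<Longrightarrow> p2 w = prefix_conv b2 p2 w"
    "\<And>w. w \<noteq> [] \<Longrightarrow> q w = prefix_conv (\<lambda>u. b2 u + bridge_conv b1 r2 empty_word u) q w"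
proof -
  have rec: "p w = prefix_conv (\<lambda>u. L_right scale (character_of p) [u]) p w"
    if "multilinear scale p" "p [] = 1" "w \<noteq> []" for p w
  proof -
    note L = L_right_character [OF character_of_in_characters [OF that(1)]]
    obtain q where q: "q [] = 1" "E_right (L_right scale (character_of p)) = character_of q"
      "\<And>w. w \<noteq> [] \<Longrightarrow> q w = prefix_conv (\<lambda>u. L_right scale (character_of p) [u]) q w"
      using L(1) by (rule E_right_infinitesimal) blast
    have "p v = q v" for v
      using q(1,2) that(2) L(2) character_of_inject [of p q v] by (cases "v = []") auto
    then show ?thesis using q(3) [OF that(3)] by presburger
  qed
  define \<beta>1 where "\<beta>1 = L_right scale \<Phi>1"
  define \<beta>2 where "\<beta>2 = L_right scale \<Phi>2"
  have \<beta>: "\<beta>1 \<in> infinitesimal_characters scale" "\<beta>2 \<in> infinitesimal_characters scale"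
    unfolding \<beta>1_def \<beta>2_def using assms by (auto intro: L_right_character character_of_in_characters)
  obtain t where t: "t [] = 1" "word_conv t r2 r2 = empty_word"
    "char_inverse scale (character_of r2) = character_of t" "multilinear scale t"
    using assms(12,11) by (rule char_inverse_character_of)
  define b1 where "b1 u = \<beta>1 [u]" for u
  define b2 where "b2 u = \<beta>2 [u]" for u
  define \<gamma> where "\<gamma> = (character_of t \<rhd> \<beta>1) \<lhd> \<Psi>2"
  have \<beta>1_zero: "\<beta>1 ws = 0" if "length ws \<noteq> 1" for ws
    using \<beta>(1) that by (cases ws; cases "tl ws") (auto simp: infinitesimal_characters_def)
  \<comment> \<open>not an infinitesimal character: the factor on \<open>us\<close> disappears only after the product with \<open>\<Psi>2\<close>\<close>
  have h: "(character_of t \<rhd> \<beta>1) (s # us) = prefix_conv b1 t s * character_of t us" if "s \<noteq> []" for s us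
  proof -
    have "(character_of t \<rhd> \<beta>1) (s # us) = (if [] \<in> set (s # us) then 0 else
      (\<Sum>k<length s. character_of t (as_tensor (drop (Suc k) s) @ us) * \<beta>1 [take (Suc k) s]))"
      by (rule half_right_infinitesimal) (rule \<beta>1_zero)
    also have "\<dots> = (if [] \<in> set us then 0 else prefix_conv b1 t s * character_of t us)"
      using that by (simp add: character_of_append character_of_as_tensor t(1) prefix_conv_sum b1_def
        sum_distrib_left sum_distrib_right mult_ac)
    finally show ?thesis by (simp add: character_of_def)
  qed
  have inv: "character_of t \<star> character_of r2 = counit"
    by (simp add: conv_character_of t(1,2) assms(12) character_of_empty_word)
  have \<gamma>_Cons: "\<gamma> (w # ws) = (if w = [] then 0 else bridge_conv b1 r2 empty_word w * counit ws)" for w ws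
  proof -
    have "\<gamma> (w # ws) = (if w = [] then 0 else word_conv (prefix_conv b1 t) r2 empty_word w *
        (character_of t \<star> character_of r2) ws)"
      unfolding \<gamma>_def assms(10) by (rule half_left_character_of) (use h assms(12) in simp_all)
    then show ?thesis
      by (simp add: inv word_conv_prefix_conv t(2) prefix_conv_empty_word)
  qed
  have \<gamma>_Nil: "\<gamma> [] = 0" by (simp add: \<gamma>_def half_left_def tensor_eval_def)
  have b1_multilinear: "multilinear scale b1"
  proof -
    have "Vector_Spaces.linear scale (*) (\<lambda>a. \<beta>1 ([] @ (u @ a # v) # []))" for u v
      using \<beta>(1) unfolding infinitesimal_characters_def linear_form_def by blast
    then show ?thesis by (simp add: multilinear_def b1_def)
  qed
  have "multilinear scale (word_conv (prefix_conv b1 t) r2 empty_word)"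
    using assms t(4) b1_multilinear
    by (intro multilinear_word_conv multilinear_prefix_conv multilinear_empty_word)
  moreover have "word_conv (prefix_conv b1 t) r2 empty_word w = bridge_conv b1 r2 empty_word w"
    if "w \<noteq> []" for w
    using that by (simp add: word_conv_prefix_conv t(2) prefix_conv_empty_word)
  ultimately have bridge: "multilinear scale (bridge_conv b1 r2 empty_word)"
    by (simp add: multilinear_def)
  have \<gamma>: "\<gamma> \<in> infinitesimal_characters scale"
  proof -
    have zero: "\<gamma> ws = 0" if "length ws \<noteq> 1" for ws
      using that by (cases ws) (auto simp: \<gamma>_Cons \<gamma>_Nil counit_def)
    have "Vector_Spaces.linear scale (*) (\<lambda>a. \<gamma> (us @ (u @ a # v) # vs))" for us u v vs
    proof (cases "us = [] \<and> vs = []")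
      case True
      then show ?thesis using bridge by (simp add: \<gamma>_Cons counit_def multilinear_def)
    next
      case False
      then have "\<gamma> (us @ (u @ a # v) # vs) = 0" for a
        by (intro zero) (cases us; cases vs; simp)
      then show ?thesis by (simp add: functional_iff)
    qed
    moreover have "\<gamma> ws = 0" if "[] \<in> set ws" for ws
      using that by (cases ws; cases "tl ws") (auto simp: \<gamma>_Cons counit_def)
    ultimately show ?thesis
      by (simp add: infinitesimal_characters_def linear_form_def zero)
  qed
  have sum: "(\<lambda>ws. \<beta>2 ws + \<gamma> ws) \<in> infinitesimal_characters scale"
    using \<beta>(2) \<gamma> by (auto simp: infinitesimal_characters_def linear_form_def functional_iff algebra_simps)
  obtain q where q: "q [] = 1" "multilinear scale q" "E_right (\<lambda>ws. \<beta>2 ws + \<gamma> ws) = character_of q"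
    "\<And>w. w \<noteq> [] \<Longrightarrow> q w = prefix_conv (\<lambda>u. \<beta>2 [u] + \<gamma> [u]) q w"
    using sum by (rule E_right_infinitesimal) blast
  have \<Phi>\<Psi>: "\<Phi> = character_of q" "\<Psi> = character_of (word_conv r1 r2 r2)"
    using conv assms q(3) t(3) by (simp_all add: Let_def \<beta>1_def \<beta>2_def \<gamma>_def conv_character_of)
  show thesis
  proof
    show "\<Psi> \<in> characters scale"
      unfolding \<Phi>\<Psi> using assms by (intro character_of_in_characters multilinear_word_conv)
    show "\<Phi> \<in> characters scale"
      unfolding \<Phi>\<Psi> using q by (intro character_of_in_characters)
    show "p1 w = prefix_conv b1 p1 w" if "w \<noteq> []" for w
    proof -
      have "b1 = (\<lambda>u. L_right scale (character_of p1) [u])"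
        by (simp add: fun_eq_iff b1_def \<beta>1_def assms)
      then show ?thesis using rec [OF assms(2,3) that] by metis
    qed
    show "p2 w = prefix_conv b2 p2 w" if "w \<noteq> []" for w
    proof -
      have "b2 = (\<lambda>u. L_right scale (character_of p2) [u])"
        by (simp add: fun_eq_iff b2_def \<beta>2_def assms)
      then show ?thesis using rec [OF assms(5,6) that] by metis
    qed
    show "q w = prefix_conv (\<lambda>u. b2 u + bridge_conv b1 r2 empty_word u) q w" if "w \<noteq> []" for w
      unfolding q(4) [OF that] prefix_conv_sum
      by (intro sum.cong) (auto simp: b2_def \<gamma>_Cons counit_def)
  qed (fact \<Phi>\<Psi> q(1))+
qed

end

section \<open>Distributions and their moments\<close>

lemma is_distribution_iff:
  "is_distribution \<nu> \<longleftrightarrow> (\<forall>p q. \<nu> (p + q) = \<nu> p + \<nu> q) \<and> (\<forall>c p. \<nu> (smult c p) = c * \<nu> p) \<and> \<nu> 1 = 1"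
proof -
  have "vector_space (smult :: complex \<Rightarrow> complex poly \<Rightarrow> complex poly)"
    by unfold_locales (simp_all add: smult_add_left smult_add_right)
  then show ?thesis
    by (auto simp: unital_functional_def Vector_Spaces.linear_iff vector_space_complex)
qed

lemma moment_0: "is_distribution \<nu> \<Longrightarrow> moment \<nu> 0 = 1"
  by (simp add: is_distribution_iff monom_0 one_pCons)

lemma distribution_eqI:
  assumes \<nu>: "is_distribution \<nu>" and \<nu>': "is_distribution \<nu>'"
    and eq: "\<And>n. n \<ge> 1 \<Longrightarrow> moment \<nu> n = moment \<nu>' n"
  shows "\<nu> = \<nu>'"
proof
  fix p
  have expand: "\<xi> p = (\<Sum>i\<le>degree p. coeff p i * moment \<xi> i)" if "is_distribution \<xi>" for \<xi> :: distribution
  proof -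
    have add: "\<xi> (p + q) = \<xi> p + \<xi> q" and smult: "\<xi> (smult c p) = c * \<xi> p" for p q c
      using that by (simp_all add: is_distribution_iff)
    have "\<xi> 0 = 0" using smult [of 0 0] by simp
    have sum: "\<xi> (\<Sum>i\<in>A. g i) = (\<Sum>i\<in>A. \<xi> (g i))" if "finite A" for g and A :: "nat set"
      using that by (induction rule: finite_induct) (simp_all add: add \<open>\<xi> 0 = 0\<close>)
    have "p = (\<Sum>i\<le>degree p. smult (coeff p i) (monom 1 i))"
      using poly_as_sum_of_monoms [of p] by (simp add: smult_monom)
    then have "\<xi> p = \<xi> (\<Sum>i\<le>degree p. smult (coeff p i) (monom 1 i))" by (rule arg_cong)
    then show ?thesis by (simp only: sum finite_atMost smult)
  qed
  have "moment \<nu> n = moment \<nu>' n" for n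
    using eq [of n] moment_0 [OF \<nu>] moment_0 [OF \<nu>'] by (cases n) simp_all
  then show "\<nu> p = \<nu>' p" using expand [OF \<nu>] expand [OF \<nu>'] by simp
qed

lemma distribution_with_moments:
  assumes "s 0 = 1"
  obtains \<nu> where "is_distribution \<nu>" "\<And>n. moment \<nu> n = s n"
proof
  define \<nu> where "\<nu> p = (\<Sum>i\<le>degree p. coeff p i * s i)" for p :: "complex poly"
  have bound: "\<nu> p = (\<Sum>i\<le>N. coeff p i * s i)" if "degree p \<le> N" for p N
    unfolding \<nu>_def by (rule sum.mono_neutral_left) (use that in \<open>auto simp: coeff_eq_0\<close>)
  have "\<nu> (p + q) = \<nu> p + \<nu> q" for p q
    using bound [of p "max (degree p) (degree q)"] bound [of q "max (degree p) (degree q)"]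
      bound [of "p + q" "max (degree p) (degree q)"] degree_add_le_max [of p q]
    by (simp add: sum.distrib algebra_simps)
  moreover have "\<nu> (smult c p) = c * \<nu> p" for c p
    using bound [of "smult c p" "degree p"] degree_smult_le [of c p]
    by (simp add: \<nu>_def sum_distrib_left mult_ac)
  moreover have "\<nu> 1 = 1" by (simp add: \<nu>_def assms)
  ultimately show "is_distribution \<nu>" by (simp add: is_distribution_iff)
  show "moment \<nu> n = s n" for n
    using bound [of "monom 1 n" n] degree_monom_le [of "1::complex" n]
    by (simp add: coeff_monom if_distrib [where f = "\<lambda>x. x * _"] cong: if_cong)
qed

section \<open>Noncrossing partitions cut along their first block\<close>

text \<open>Intervals \<open>{a..<b}\<close> with both ends variable: cutting a partition along a block leaves partitions of
subintervals, which then need not be renumbered.\<close>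

definition interval_NC :: "nat \<Rightarrow> nat \<Rightarrow> nat set set set" where
  "interval_NC a b = {\<pi>. partition_on {a..<b} \<pi> \<and> noncrossing \<pi>}"

definition block_weight ::
  "(nat \<Rightarrow> complex) \<Rightarrow> (nat \<Rightarrow> complex) \<Rightarrow> nat set set \<Rightarrow> nat set \<Rightarrow> complex" where
  "block_weight \<kappa> k \<pi> V = (if inner_block \<pi> V then k (card V) else \<kappa> (card V))"

definition NC_sum :: "(nat \<Rightarrow> complex) \<Rightarrow> (nat \<Rightarrow> complex) \<Rightarrow> nat \<Rightarrow> nat \<Rightarrow> complex" where
  "NC_sum \<kappa> k a b = (\<Sum>\<pi>\<in>interval_NC a b. \<Prod>V\<in>\<pi>. block_weight \<kappa> k \<pi> V)"

text \<open>The block of the minimum gets its own weight \<open>l\<close>, because cutting off its minimum lowers the size of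
this block alone and so replaces \<open>l\<close> by \<open>\<lambda>n. l (Suc n)\<close>.\<close>

definition first_block_sum ::
  "(nat \<Rightarrow> complex) \<Rightarrow> (nat \<Rightarrow> complex) \<Rightarrow> (nat \<Rightarrow> complex) \<Rightarrow> nat \<Rightarrow> nat \<Rightarrow> complex" where
  "first_block_sum l \<kappa> k a b =
     (\<Sum>\<pi>\<in>interval_NC a b. \<Prod>V\<in>\<pi>. if a \<in> V then l (card V) else block_weight \<kappa> k \<pi> V)"

lemma interval_NC_iff:
  "\<pi> \<in> interval_NC a b \<longleftrightarrow> \<Union>\<pi> = {a..<b} \<and> (\<forall>V\<in>\<pi>. \<forall>W\<in>\<pi>. \<forall>x. x \<in> V \<longrightarrow> x \<in> W \<longrightarrow> V = W) \<and>
     {} \<notin> \<pi> \<and> noncrossing \<pi>"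
proof -
  have "disjoint \<pi> \<longleftrightarrow> (\<forall>V\<in>\<pi>. \<forall>W\<in>\<pi>. \<forall>x. x \<in> V \<longrightarrow> x \<in> W \<longrightarrow> V = W)"
    unfolding disjoint_def disjoint_iff by meson
  then show ?thesis by (simp add: interval_NC_def partition_on_def)
qed

lemma interval_NC_bounds:
  assumes "\<pi> \<in> interval_NC a b" "V \<in> \<pi>" "x \<in> V"
  shows "a \<le> x" "x < b"
proof -
  have "x \<in> {a..<b}" using assms unfolding interval_NC_iff by blast
  then show "a \<le> x" "x < b" by simp_all
qed

lemma interval_NC_finite:
  shows "finite (interval_NC a b)" and "\<pi> \<in> interval_NC a b \<Longrightarrow> finite \<pi>"
    and "\<pi> \<in> interval_NC a b \<Longrightarrow> V \<in> \<pi> \<Longrightarrow> finite V"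
proof -
  show "finite (interval_NC a b)"
    using finitely_many_partition_on [of "{a..<b}"] by (simp add: interval_NC_def)
  show "finite \<pi>" if "\<pi> \<in> interval_NC a b"
    using that by (intro finite_UnionD) (simp add: interval_NC_iff)
  show "finite V" if "\<pi> \<in> interval_NC a b" "V \<in> \<pi>"
    using that by (intro finite_subset [of V "{a..<b}"]) (auto simp: interval_NC_iff)
qed

lemma noncrossing_iff:
  "noncrossing \<pi> \<longleftrightarrow> (\<forall>V\<in>\<pi>. \<forall>W\<in>\<pi>. \<forall>x\<in>V. \<forall>y\<in>W. \<forall>x'\<in>V. \<forall>y'\<in>W.
    x < y \<longrightarrow> y < x' \<longrightarrow> x' < y' \<longrightarrow> V = W)"
  unfolding noncrossing_def by meson

lemma noncrossingD:
  assumes "noncrossing \<pi>" "V \<in> \<pi>" "W \<in> \<pi>" "x \<in> V" "y \<in> W" "x' \<in> V" "y' \<in> W"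
    "x < y" "y < x'" "x' < y'"
  shows "V = W"
  using assms(1) [unfolded noncrossing_iff, rule_format, OF assms(2-10)] .

lemma noncrossingI:
  assumes "\<And>V W x y x' y'. V \<in> \<pi> \<Longrightarrow> W \<in> \<pi> \<Longrightarrow> x \<in> V \<Longrightarrow> y \<in> W \<Longrightarrow> x' \<in> V \<Longrightarrow> y' \<in> W \<Longrightarrow>
    x < y \<Longrightarrow> y < x' \<Longrightarrow> x' < y' \<Longrightarrow> V = W"
  shows "noncrossing \<pi>"
  unfolding noncrossing_iff by (intro ballI impI) (rule assms)

lemma noncrossing_subset: "noncrossing \<pi> \<Longrightarrow> \<rho> \<subseteq> \<pi> \<Longrightarrow> noncrossing \<rho>"
  unfolding noncrossing_iff by (meson subsetD)

lemma NC_sum_empty: "NC_sum \<kappa> k a a = 1"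
proof -
  have "interval_NC a a = {{}}"
    by (auto simp: interval_NC_def partition_on_empty noncrossing_def)
  then show ?thesis by (simp add: NC_sum_def)
qed

text \<open>The block of the minimum is outer.\<close>

lemma NC_sum_eq_first_block_sum: "NC_sum \<kappa> k a b = first_block_sum \<kappa> \<kappa> k a b"
proof -
  have "\<not> inner_block \<pi> V" if \<pi>: "\<pi> \<in> interval_NC a b" and a: "a \<in> V" for \<pi> V
  proof
    assume "inner_block \<pi> V"
    then obtain W x where "W \<in> \<pi>" "x \<in> W" "x < a" using a unfolding inner_block_def by blast
    then show False using interval_NC_bounds(1) [OF \<pi>] by force
  qed
  then show ?thesis
    unfolding NC_sum_def first_block_sum_def by (intro sum.cong prod.cong) (auto simp: block_weight_def)
qed

lemma inner_weight: "block_weight k k \<pi> V = k (card V)"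
  by (simp add: block_weight_def)

lemma inner_block_insert_singleton:
  assumes "V \<noteq> {}"
  shows "inner_block (insert {a} \<pi>) V \<longleftrightarrow> inner_block \<pi> V"
proof
  obtain c where c: "c \<in> V" using assms by blast
  assume "inner_block (insert {a} \<pi>) V"
  then obtain W x y where W: "W \<in> insert {a} \<pi>" "W \<noteq> V" "x \<in> W" "y \<in> W" "\<forall>c\<in>V. x < c \<and> c < y"
    unfolding inner_block_def by blast
  then have "W \<noteq> {a}" using c by force
  with W show "inner_block \<pi> V" unfolding inner_block_def by blast
qed (auto simp: inner_block_def)

lemma sum_singleton_first_block:
  assumes "a < b"
  shows "(\<Sum>\<pi>\<in>{\<pi>\<in>interval_NC a b. {a} \<in> \<pi>}. \<Prod>V\<in>\<pi>. if a \<in> V then l (card V) else block_weight \<kappa> k \<pi> V) =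
    l 1 * NC_sum \<kappa> k (Suc a) b"
  unfolding NC_sum_def sum_distrib_left
proof (rule sum.reindex_bij_witness [where i = "insert {a}" and j = "\<lambda>\<pi>. \<pi> - {{a}}"])
  fix \<pi> assume "\<pi> \<in> {\<pi> \<in> interval_NC a b. {a} \<in> \<pi>}"
  then have \<pi>: "\<pi> \<in> interval_NC a b" "{a} \<in> \<pi>" by auto
  show "insert {a} (\<pi> - {{a}}) = \<pi>" using \<pi> by auto
  have a: "a \<notin> V" if "V \<in> \<pi> - {{a}}" for V
    using that \<pi> unfolding interval_NC_iff by blast
  have "\<Union> (\<pi> - {{a}}) = \<Union>\<pi> - {a}" using a \<pi>(2) by blast
  also have "\<dots> = {Suc a..<b}" using \<pi>(1) by (auto simp: interval_NC_iff)
  finally show mem: "\<pi> - {{a}} \<in> interval_NC (Suc a) b"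
    using \<pi>(1) noncrossing_subset [of \<pi> "\<pi> - {{a}}"] unfolding interval_NC_iff by auto
  have inner: "inner_block \<pi> V \<longleftrightarrow> inner_block (\<pi> - {{a}}) V" if "V \<in> \<pi> - {{a}}" for V
  proof -
    have "V \<noteq> {}" using that \<pi>(1) by (auto simp: interval_NC_iff)
    moreover have "insert {a} (\<pi> - {{a}}) = \<pi>" using \<pi>(2) by blast
    ultimately show ?thesis using inner_block_insert_singleton [of V a "\<pi> - {{a}}"] by simp
  qed
  have "(\<Prod>V\<in>\<pi>. if a \<in> V then l (card V) else block_weight \<kappa> k \<pi> V) =
    l 1 * (\<Prod>V\<in>\<pi> - {{a}}. if a \<in> V then l (card V) else block_weight \<kappa> k \<pi> V)"
    by (subst prod.remove [OF interval_NC_finite(2) [OF \<pi>(1)] \<pi>(2)]) simp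
  also have "(\<Prod>V\<in>\<pi> - {{a}}. if a \<in> V then l (card V) else block_weight \<kappa> k \<pi> V) =
    (\<Prod>V\<in>\<pi> - {{a}}. block_weight \<kappa> k (\<pi> - {{a}}) V)"
    using a inner by (intro prod.cong) (auto simp: block_weight_def)
  finally show "l 1 * (\<Prod>V\<in>\<pi> - {{a}}. block_weight \<kappa> k (\<pi> - {{a}}) V) =
    (\<Prod>V\<in>\<pi>. if a \<in> V then l (card V) else block_weight \<kappa> k \<pi> V)" ..
next
  fix \<pi> assume \<pi>: "\<pi> \<in> interval_NC (Suc a) b"
  have a: "a \<notin> V" if "V \<in> \<pi>" for V
  proof
    assume "a \<in> V"
    then have "a \<in> {Suc a..<b}" using that \<pi> unfolding interval_NC_iff by blast
    then show False by simp
  qed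
  then show "insert {a} \<pi> - {{a}} = \<pi>" by auto
  have "\<Union> (insert {a} \<pi>) = {a..<b}" using \<pi> assms by (auto simp: interval_NC_iff)
  moreover have "noncrossing (insert {a} \<pi>)"
  proof (rule noncrossingI)
    fix V W x y x' y'
    assume "V \<in> insert {a} \<pi>" "W \<in> insert {a} \<pi>"
      and el: "x \<in> V" "y \<in> W" "x' \<in> V" "y' \<in> W" "x < y" "y < x'" "x' < y'"
    moreover have "V \<noteq> {a}" "W \<noteq> {a}" using el by auto
    ultimately have "V \<in> \<pi>" "W \<in> \<pi>" by auto
    moreover have "noncrossing \<pi>" using \<pi> by (simp add: interval_NC_iff)
    ultimately show "V = W" using el by (intro noncrossingD [of \<pi> V W x y x' y'])
  qed
  ultimately show "insert {a} \<pi> \<in> {\<pi> \<in> interval_NC a b. {a} \<in> \<pi>}"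
    using \<pi> a unfolding interval_NC_iff by auto
qed

text \<open>The inverse of removing \<open>a\<close> from the block that contains \<open>a\<close> and \<open>v\<close>.\<close>

definition attach :: "nat \<Rightarrow> nat \<Rightarrow> nat set \<Rightarrow> nat set" where
  "attach a v V = (if v \<in> V then insert a V else V)"

text \<open>If \<open>v\<close> is the second element of the block of \<open>a\<close>, a block that meets the gap
between them stays inside it, or it would cross the block of \<open>a\<close>.  So the partition is a partition of the gap between \<open>a\<close> and \<open>v\<close>, whose
blocks are all inner, together with a partition of \<open>{v..<b}\<close> in which \<open>a\<close> has been removed from
the block of \<open>v\<close>; removing \<open>a\<close> does not change which blocks are inner.\<close>

lemma sum_second_element:
  assumes v: "a < v" "v < b"
  shows "(\<Sum>\<pi>\<in>{\<pi>\<in>interval_NC a b. \<exists>V\<in>\<pi>. a \<in> V \<and> v \<in> V \<and> V \<inter> {a<..<v} = {}}.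
      \<Prod>V\<in>\<pi>. if a \<in> V then l (card V) else block_weight \<kappa> k \<pi> V) =
    NC_sum k k (Suc a) v * first_block_sum (\<lambda>n. l (Suc n)) \<kappa> k v b"
proof -
  let ?glue = "\<lambda>(\<rho>, \<sigma>). \<rho> \<union> attach a v ` \<sigma>"
  let ?cut = "\<lambda>\<pi>. ({V\<in>\<pi>. V \<subseteq> {a<..<v}}, (\<lambda>V. V - {a}) ` {V\<in>\<pi>. \<not> V \<subseteq> {a<..<v}})"
  let ?w = "\<lambda>\<pi>. \<Prod>V\<in>\<pi>. if a \<in> V then l (card V) else block_weight \<kappa> k \<pi> V"
  let ?w' = "\<lambda>(\<rho>, \<sigma>). (\<Prod>V\<in>\<rho>. block_weight k k \<rho> V) *
    (\<Prod>V\<in>\<sigma>. if v \<in> V then l (Suc (card V)) else block_weight \<kappa> k \<sigma> V)"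
  have eq: "(\<Sum>p\<in>interval_NC (Suc a) v \<times> interval_NC v b. ?w' p) =
    (\<Sum>\<pi>\<in>{\<pi>\<in>interval_NC a b. \<exists>V\<in>\<pi>. a \<in> V \<and> v \<in> V \<and> V \<inter> {a<..<v} = {}}. ?w \<pi>)"
  proof (rule sum.reindex_bij_witness [where i = ?cut and j = ?glue])
    fix \<pi> assume "\<pi> \<in> {\<pi>\<in>interval_NC a b. \<exists>V\<in>\<pi>. a \<in> V \<and> v \<in> V \<and> V \<inter> {a<..<v} = {}}"
    then obtain U where \<pi>: "\<pi> \<in> interval_NC a b" and U: "U \<in> \<pi>" "a \<in> U" "v \<in> U" "U \<inter> {a<..<v} = {}"
      by blast
    have un: "\<Union>\<pi> = {a..<b}" and nc: "noncrossing \<pi>" and ne: "{} \<notin> \<pi>"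
      and dj: "\<And>V W x. V \<in> \<pi> \<Longrightarrow> W \<in> \<pi> \<Longrightarrow> x \<in> V \<Longrightarrow> x \<in> W \<Longrightarrow> V = W"
      using \<pi> unfolding interval_NC_iff by blast+
    have sub: "V \<subseteq> {a<..<v}" if V: "V \<in> \<pi>" "x \<in> V" "a < x" "x < v" for V x
    proof
      fix y assume y: "y \<in> V"
      have "V \<noteq> U" using V U by auto
      then have "a \<notin> V" "v \<notin> V" using dj V(1) U by blast+
      have "y \<in> {a..<b}" using un y V(1) by blast
      moreover have "\<not> v < y"
        using noncrossingD [OF nc U(1) V(1) U(2) V(2) U(3) y] V \<open>V \<noteq> U\<close> by blast
      ultimately show "y \<in> {a<..<v}"
        using y \<open>a \<notin> V\<close> \<open>v \<notin> V\<close> by (cases "y = a"; cases "y = v") auto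
    qed
    \<comment> \<open>every block lies inside the gap between \<open>a\<close> and \<open>v\<close> or avoids it\<close>
    have big: "V \<inter> {a<..<v} = {}" if "V \<in> \<pi>" "\<not> V \<subseteq> {a<..<v}" for V
      using sub that by fastforce
    have a_iff: "a \<in> V \<longleftrightarrow> V = U" and v_iff: "v \<in> V \<longleftrightarrow> V = U" if "V \<in> \<pi>" for V
      using dj that U by blast+
    have att: "attach a v (V - {a}) = V" if "V \<in> \<pi>" for V
      using a_iff [OF that] v_iff [OF that] v U by (auto simp: attach_def)
    show "?glue (?cut \<pi>) = \<pi>"
      using att by (auto simp: image_image)
    have "{V\<in>\<pi>. V \<subseteq> {a<..<v}} \<in> interval_NC (Suc a) v"
      unfolding interval_NC_iff
    proof (intro conjI)
      show "\<Union> {V\<in>\<pi>. V \<subseteq> {a<..<v}} = {Suc a..<v}"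
      proof (intro equalityI subsetI)
        fix x assume x: "x \<in> {Suc a..<v}"
        then obtain V where "V \<in> \<pi>" "x \<in> V" using un v by (metis UnionE atLeastLessThan_iff less_trans Suc_leD)
        then show "x \<in> \<Union> {V\<in>\<pi>. V \<subseteq> {a<..<v}}" using sub [of V x] x by auto
      qed auto
      show "noncrossing {V\<in>\<pi>. V \<subseteq> {a<..<v}}"
        using nc by (rule noncrossing_subset) blast
    qed (use dj ne in blast)+
    moreover have "(\<lambda>V. V - {a}) ` {V\<in>\<pi>. \<not> V \<subseteq> {a<..<v}} \<in> interval_NC v b"
      unfolding interval_NC_iff
    proof (intro conjI)
      show "\<Union> ((\<lambda>V. V - {a}) ` {V\<in>\<pi>. \<not> V \<subseteq> {a<..<v}}) = {v..<b}"
      proof (intro equalityI subsetI)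
        fix x assume "x \<in> \<Union> ((\<lambda>V. V - {a}) ` {V\<in>\<pi>. \<not> V \<subseteq> {a<..<v}})"
        then obtain V where V: "V \<in> \<pi>" "\<not> V \<subseteq> {a<..<v}" "x \<in> V" "x \<noteq> a" by blast
        then have "x \<in> {a..<b}" "x \<notin> {a<..<v}" using un big [OF V(1,2)] by blast+
        then show "x \<in> {v..<b}" using V(4) by auto
      next
        fix x assume x: "x \<in> {v..<b}"
        then obtain V where "V \<in> \<pi>" "x \<in> V" using un v by (metis UnionE atLeastLessThan_iff le_trans less_imp_le)
        then show "x \<in> \<Union> ((\<lambda>V. V - {a}) ` {V\<in>\<pi>. \<not> V \<subseteq> {a<..<v}})" using x v by fastforce
      qed
      show "{} \<notin> (\<lambda>V. V - {a}) ` {V \<in> \<pi>. \<not> V \<subseteq> {a<..<v}}"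
      proof
        assume "{} \<in> (\<lambda>V. V - {a}) ` {V \<in> \<pi>. \<not> V \<subseteq> {a<..<v}}"
        then obtain V where V: "V \<in> \<pi>" "V - {a} = {}" by blast
        have "V \<noteq> {}" using ne V(1) by auto
        then have "a \<in> V" using V(2) by auto
        then have "v \<in> V" using a_iff [OF V(1)] v_iff [OF V(1)] by simp
        then show False using V(2) v by auto
      qed
      show "noncrossing ((\<lambda>V. V - {a}) ` {V \<in> \<pi>. \<not> V \<subseteq> {a<..<v}})"
      proof (rule noncrossingI)
        fix V' W' x y x' y'
        assume "V' \<in> (\<lambda>V. V - {a}) ` {V \<in> \<pi>. \<not> V \<subseteq> {a<..<v}}" "W' \<in> (\<lambda>V. V - {a}) ` {V \<in> \<pi>. \<not> V \<subseteq> {a<..<v}}"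
          and el: "x \<in> V'" "y \<in> W'" "x' \<in> V'" "y' \<in> W'" "x < y" "y < x'" "x' < y'"
        then obtain V W where "V \<in> \<pi>" "W \<in> \<pi>" "V' = V - {a}" "W' = W - {a}" by blast
        moreover from this have "V = W" using el by (intro noncrossingD [OF nc, of V W x y x' y']) simp_all
        ultimately show "V' = W'" by simp
      qed
    qed (use dj in blast)
    ultimately show "?cut \<pi> \<in> interval_NC (Suc a) v \<times> interval_NC v b" by simp
  next
    fix p assume "p \<in> interval_NC (Suc a) v \<times> interval_NC v b"
    then obtain \<rho> \<sigma> where p: "p = (\<rho>, \<sigma>)" and \<rho>: "\<rho> \<in> interval_NC (Suc a) v" and \<sigma>: "\<sigma> \<in> interval_NC v b"
      by blast
    have un\<rho>: "\<Union>\<rho> = {Suc a..<v}" and nc\<rho>: "noncrossing \<rho>" and ne\<rho>: "{} \<notin> \<rho>"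
      and dj\<rho>: "\<And>V W x. V \<in> \<rho> \<Longrightarrow> W \<in> \<rho> \<Longrightarrow> x \<in> V \<Longrightarrow> x \<in> W \<Longrightarrow> V = W"
      using \<rho> unfolding interval_NC_iff by blast+
    have un\<sigma>: "\<Union>\<sigma> = {v..<b}" and nc\<sigma>: "noncrossing \<sigma>" and ne\<sigma>: "{} \<notin> \<sigma>"
      and dj\<sigma>: "\<And>V W x. V \<in> \<sigma> \<Longrightarrow> W \<in> \<sigma> \<Longrightarrow> x \<in> V \<Longrightarrow> x \<in> W \<Longrightarrow> V = W"
      using \<sigma> unfolding interval_NC_iff by blast+
    have in\<rho>: "a < x \<and> x < v" if "V \<in> \<rho>" "x \<in> V" for V x
    proof -
      have "x \<in> {Suc a..<v}" using un\<rho> that by blast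
      then show ?thesis by simp
    qed
    have in\<sigma>: "v \<le> x \<and> x < b" if "V \<in> \<sigma>" "x \<in> V" for V x
    proof -
      have "x \<in> {v..<b}" using un\<sigma> that by blast
      then show ?thesis by simp
    qed
    have in_att: "x = a \<and> v \<in> V \<or> x \<in> V" if "x \<in> attach a v V" for x V
      using that by (auto simp: attach_def split: if_splits)
    have sub_att: "V \<subseteq> attach a v V" for V by (auto simp: attach_def)
    have a\<sigma>: "a \<notin> V" if "V \<in> \<sigma>" for V using in\<sigma> [OF that, of a] v by auto
    have cut_att: "attach a v V - {a} = V" if "V \<in> \<sigma>" for V
      using a\<sigma> [OF that] by (auto simp: attach_def)
    have small: "V \<subseteq> {a<..<v}" if "V \<in> \<rho>" for V using in\<rho> [OF that] by auto
    have large: "\<not> attach a v V \<subseteq> {a<..<v}" if V: "V \<in> \<sigma>" for V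
    proof -
      obtain x where "x \<in> V" using ne\<sigma> V by (metis all_not_in_conv)
      then show ?thesis using in\<sigma> [OF V] sub_att [of V] by fastforce
    qed
    have "{V \<in> \<rho> \<union> attach a v ` \<sigma>. V \<subseteq> {a<..<v}} = \<rho>"
      "{V \<in> \<rho> \<union> attach a v ` \<sigma>. \<not> V \<subseteq> {a<..<v}} = attach a v ` \<sigma>"
      using small large by blast+
    then show "?cut (?glue p) = p"
      unfolding p by (simp only: prod.case image_image) (simp add: cut_att)
    have "v \<in> \<Union>\<sigma>" unfolding un\<sigma> using v by simp
    then obtain U where U: "U \<in> \<sigma>" "v \<in> U" by blast
    have "\<Union> (\<rho> \<union> attach a v ` \<sigma>) = {a..<b}"
    proof -
      have "\<Union> (attach a v ` \<sigma>) = insert a (\<Union>\<sigma>)" using U by (auto simp: attach_def split: if_splits)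
      then show ?thesis using un\<rho> un\<sigma> v by auto
    qed
    moreover have "V = W" if V: "V \<in> \<rho> \<union> attach a v ` \<sigma>" and W: "W \<in> \<rho> \<union> attach a v ` \<sigma>"
      and x: "x \<in> V" "x \<in> W" for V W x
    proof -
      have mixed: False if "V \<in> \<rho>" "W \<in> \<sigma>" "x \<in> V" "x \<in> attach a v W" for V W
        using in\<rho> [OF that(1,3)] in_att [OF that(4)] in\<sigma> [OF that(2), of x] by auto
      have both: "V = W" if "V \<in> \<sigma>" "W \<in> \<sigma>" "x \<in> attach a v V" "x \<in> attach a v W" for V W
        using in_att [OF that(3)] in_att [OF that(4)] dj\<sigma> [OF that(1,2)] a\<sigma> [OF that(1)] a\<sigma> [OF that(2)] by blast
      show ?thesis using V W x mixed both dj\<rho> by blast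
    qed
    moreover have "{} \<notin> \<rho> \<union> attach a v ` \<sigma>"
      using ne\<rho> large by force
    moreover have "noncrossing (\<rho> \<union> attach a v ` \<sigma>)"
    proof (rule noncrossingI)
      fix V W x y x' y'
      assume V: "V \<in> \<rho> \<union> attach a v ` \<sigma>" and W: "W \<in> \<rho> \<union> attach a v ` \<sigma>"
        and el: "x \<in> V" "y \<in> W" "x' \<in> V" "y' \<in> W" "x < y" "y < x'" "x' < y'"
      consider "V \<in> \<rho>" "W \<in> \<rho>" | V0 where "V \<in> \<rho>" "V0 \<in> \<sigma>" "W = attach a v V0"
        | V0 where "W \<in> \<rho>" "V0 \<in> \<sigma>" "V = attach a v V0"
        | V0 W0 where "V0 \<in> \<sigma>" "W0 \<in> \<sigma>" "V = attach a v V0" "W = attach a v W0"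
        using V W by blast
      then show "V = W"
      proof cases
        case 1
        then show ?thesis using noncrossingD [OF nc\<rho>] el by blast
      next
        case 2
        then show ?thesis using in\<rho> [of V x] in\<rho> [of V x'] in_att [of y V0] in\<sigma> [of V0 y] el by auto
      next
        case 3
        then show ?thesis using in\<rho> [of W y] in\<rho> [of W y'] in_att [of x' V0] in\<sigma> [of V0 x'] el by auto
      next
        case 4
        have "a \<le> x" using in_att [of x V0] in\<sigma> [of V0 x] 4 el v by auto
        then have mem: "y \<in> W0" "x' \<in> V0" "y' \<in> W0"
          using in_att [of y W0] in_att [of x' V0] in_att [of y' W0] 4 el by auto
        show ?thesis
        proof (cases "x \<in> V0")
          case True
          then show ?thesis using noncrossingD [OF nc\<sigma> 4(1,2) True mem] el 4 by blast
        next
          case False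
          then have "v \<in> V0" using in_att [of x V0] 4 el by auto
          show ?thesis
          proof (cases "y = v")
            case True
            then show ?thesis using dj\<sigma> [OF 4(1,2) \<open>v \<in> V0\<close>] mem 4 by simp
          next
            case False
            then have "v < y" using in\<sigma> [OF 4(2) mem(1)] by simp
            then show ?thesis using noncrossingD [OF nc\<sigma> 4(1,2) \<open>v \<in> V0\<close> mem] el 4 by blast
          qed
        qed
      qed
    qed
    ultimately have glue: "\<rho> \<union> attach a v ` \<sigma> \<in> interval_NC a b"
      unfolding interval_NC_iff by blast
    have U': "attach a v U \<in> \<rho> \<union> attach a v ` \<sigma>" "a \<in> attach a v U" "v \<in> attach a v U"
      "attach a v U \<inter> {a<..<v} = {}"
      using U in\<sigma> [OF U(1)] by (fastforce simp: attach_def)+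
    then show "?glue p \<in> {\<pi>\<in>interval_NC a b. \<exists>V\<in>\<pi>. a \<in> V \<and> v \<in> V \<and> V \<inter> {a<..<v} = {}}"
      unfolding p using glue by auto
    have inj: "inj_on (attach a v) \<sigma>" using cut_att by (metis inj_onI)
    have disj: "\<rho> \<inter> attach a v ` \<sigma> = {}" using small large by blast
    have inner\<rho>: "inner_block (\<rho> \<union> attach a v ` \<sigma>) V" if "V \<in> \<rho>" for V
      unfolding inner_block_def
      using U' disj that in\<rho> [OF that] U(1)
      by (intro bexI [of _ "attach a v U"] conjI bexI [of _ a] bexI [of _ v]) auto
    have inner\<sigma>: "inner_block (\<rho> \<union> attach a v ` \<sigma>) V \<longleftrightarrow> inner_block \<sigma> V"
      if V: "V \<in> \<sigma>" "v \<notin> V" for V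
    proof
      obtain c where c: "c \<in> V" using ne\<sigma> V(1) by (metis all_not_in_conv)
      assume "inner_block (\<rho> \<union> attach a v ` \<sigma>) V"
      then obtain W x y where W: "W \<in> \<rho> \<union> attach a v ` \<sigma>" "W \<noteq> V" "x \<in> W" "y \<in> W" "\<forall>c\<in>V. x < c \<and> c < y"
        unfolding inner_block_def by blast
      have "v < c" if "c \<in> V" for c using in\<sigma> [OF V(1) that] that V(2) by (cases "c = v") auto
      have "W \<notin> \<rho>" using in\<rho> [of W y] W \<open>c \<in> V\<close> in\<sigma> [OF V(1) c] by (meson leD less_trans)
      then obtain W0 where W0: "W0 \<in> \<sigma>" "W = attach a v W0" using W(1) by blast
      have "W0 \<noteq> V" using W(2) W0(2) V(2) by (auto simp: attach_def)
      have "y \<noteq> a" using W(5) c in\<sigma> [OF V(1) c] v by auto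
      then have "y \<in> W0" using in_att W(4) W0(2) by blast
      \<comment> \<open>if \<open>W\<close> surrounds \<open>V\<close> from \<open>a\<close>, then \<open>W0\<close> contains \<open>v\<close> and surrounds \<open>V\<close> from there\<close>
      obtain z where "z \<in> W0" "\<forall>c\<in>V. z < c"
        using in_att [of x W0] W(3,5) W0(2) \<open>\<And>c. c \<in> V \<Longrightarrow> v < c\<close> by blast
      then show "inner_block \<sigma> V"
        unfolding inner_block_def using W0(1) \<open>W0 \<noteq> V\<close> \<open>y \<in> W0\<close> W(5)
        by (intro bexI [of _ W0] conjI bexI [of _ z] bexI [of _ y]) simp_all
    next
      assume "inner_block \<sigma> V"
      then obtain W x y where W: "W \<in> \<sigma>" "W \<noteq> V" "x \<in> W" "y \<in> W" "\<forall>c\<in>V. x < c \<and> c < y"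
        unfolding inner_block_def by blast
      have "attach a v V = V" using V(2) by (simp add: attach_def)
      then have "attach a v W \<noteq> V" using W(1,2) V(1) inj by (metis inj_onD)
      then show "inner_block (\<rho> \<union> attach a v ` \<sigma>) V"
        unfolding inner_block_def using W subsetD [OF sub_att, of _ W]
        by (intro bexI [of _ "attach a v W"] conjI bexI [of _ x] bexI [of _ y]) auto
    qed
    have card: "card (attach a v V) = Suc (card V)" if "V \<in> \<sigma>" "v \<in> V" for V
      using that a\<sigma> [OF that(1)] interval_NC_finite(3) [OF \<sigma> that(1)] by (simp add: attach_def)
    have a\<rho>: "a \<notin> V" if "V \<in> \<rho>" for V using in\<rho> [OF that, of a] by auto
    let ?g = "\<rho> \<union> attach a v ` \<sigma>"
    let ?f = "\<lambda>V. if a \<in> V then l (card V) else block_weight \<kappa> k ?g V"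
    have "?w ?g = prod ?f \<rho> * prod ?f (attach a v ` \<sigma>)"
      using interval_NC_finite(2) \<rho> \<sigma> disj by (intro prod.union_disjoint) auto
    also have "prod ?f \<rho> = (\<Prod>V\<in>\<rho>. block_weight k k \<rho> V)"
      using a\<rho> inner\<rho> by (intro prod.cong) (auto simp: block_weight_def)
    also have "prod ?f (attach a v ` \<sigma>) = (\<Prod>V\<in>\<sigma>. ?f (attach a v V))"
      using prod.reindex [OF inj] by simp
    also have "\<dots> = (\<Prod>V\<in>\<sigma>. if v \<in> V then l (Suc (card V)) else block_weight \<kappa> k \<sigma> V)"
    proof (intro prod.cong refl)
      fix V assume V: "V \<in> \<sigma>"
      show "?f (attach a v V) = (if v \<in> V then l (Suc (card V)) else block_weight \<kappa> k \<sigma> V)"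
      proof (cases "v \<in> V")
        case True
        then show ?thesis using card [OF V] by (simp add: attach_def)
      next
        case False
        then show ?thesis using inner\<sigma> [OF V False] a\<sigma> [OF V] by (simp add: attach_def block_weight_def)
      qed
    qed
    finally have "?w ?g = ?w' (\<rho>, \<sigma>)" by simp
    then show "?w (?glue p) = ?w' p" unfolding p by (simp only: prod.case)
  qed
  show ?thesis
    unfolding eq [symmetric] NC_sum_def first_block_sum_def sum_product sum.cartesian_product
    by (simp add: case_prod_beta)
qed

lemma first_block_sum_recursion:
  assumes "a < b"
  shows "first_block_sum l \<kappa> k a b = l 1 * NC_sum \<kappa> k (Suc a) b +
    (\<Sum>v\<in>{a<..<b}. NC_sum k k (Suc a) v * first_block_sum (\<lambda>n. l (Suc n)) \<kappa> k v b)"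
proof -
  let ?N1 = "{\<pi>\<in>interval_NC a b. {a} \<in> \<pi>}"
  let ?N = "\<lambda>v. {\<pi>\<in>interval_NC a b. \<exists>V\<in>\<pi>. a \<in> V \<and> v \<in> V \<and> V \<inter> {a<..<v} = {}}"
  let ?w = "\<lambda>\<pi>. \<Prod>V\<in>\<pi>. if a \<in> V then l (card V) else block_weight \<kappa> k \<pi> V"
  have same: "V = W" if "\<pi> \<in> interval_NC a b" "V \<in> \<pi>" "W \<in> \<pi>" "a \<in> V" "a \<in> W" for \<pi> V W
    using that unfolding interval_NC_iff by blast
  have "interval_NC a b = ?N1 \<union> (\<Union>v\<in>{a<..<b}. ?N v)"
  proof (intro equalityI subsetI)
    fix \<pi> assume \<pi>: "\<pi> \<in> interval_NC a b"
    then have "a \<in> \<Union>\<pi>" using assms by (simp add: interval_NC_iff)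
    then obtain U where U: "U \<in> \<pi>" "a \<in> U" by blast
    show "\<pi> \<in> ?N1 \<union> (\<Union>v\<in>{a<..<b}. ?N v)"
    proof (cases "U = {a}")
      case False
      \<comment> \<open>the second element of the block of \<open>a\<close>\<close>
      define v where "v = Min (U - {a})"
      have fin: "finite (U - {a})" using interval_NC_finite(3) [OF \<pi> U(1)] by simp
      have "U - {a} \<noteq> {}" using False U(2) by blast
      then have v: "v \<in> U - {a}" using Min_in [OF fin] by (simp add: v_def)
      have "v \<le> x" if "x \<in> U - {a}" for x using Min_le [OF fin that] by (simp add: v_def)
      then have "U \<inter> {a<..<v} = {}" by fastforce
      moreover have "v \<in> {a<..<b}"
        using v interval_NC_bounds [OF \<pi> U(1), of v] by auto
      ultimately show ?thesis using \<pi> U v by blast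
    qed (use \<pi> U in blast)
  qed blast
  then have "first_block_sum l \<kappa> k a b = sum ?w (?N1 \<union> (\<Union>v\<in>{a<..<b}. ?N v))"
    by (simp add: first_block_sum_def)
  also have "\<dots> = sum ?w ?N1 + sum ?w (\<Union>v\<in>{a<..<b}. ?N v)"
  proof (rule sum.union_disjoint)
    show "?N1 \<inter> (\<Union>v\<in>{a<..<b}. ?N v) = {}"
    proof (rule ccontr)
      assume "?N1 \<inter> (\<Union>v\<in>{a<..<b}. ?N v) \<noteq> {}"
      then obtain \<pi> v V where "\<pi> \<in> interval_NC a b" "{a} \<in> \<pi>" "a < v" "V \<in> \<pi>" "a \<in> V" "v \<in> V" by auto
      then show False using same [of \<pi> "{a}" V] by auto
    qed
  qed (use interval_NC_finite(1) in auto)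
  also have "sum ?w (\<Union>v\<in>{a<..<b}. ?N v) = (\<Sum>v\<in>{a<..<b}. sum ?w (?N v))"
  proof (rule sum.UNION_disjoint)
    have "v = w" if \<pi>: "\<pi> \<in> ?N v" "\<pi> \<in> ?N w" and vw: "v \<in> {a<..<b}" "w \<in> {a<..<b}" for \<pi> v w
    proof -
      obtain V W where "V \<in> \<pi>" "a \<in> V" "v \<in> V" "V \<inter> {a<..<v} = {}" "W \<in> \<pi>" "a \<in> W" "w \<in> W" "W \<inter> {a<..<w} = {}"
        using \<pi> by blast
      moreover from this have "V = W" using same \<pi>(1) by blast
      ultimately have "v \<notin> {a<..<w}" "w \<notin> {a<..<v}" by blast+
      then show "v = w" using vw by auto
    qed
    then show "\<forall>v\<in>{a<..<b}. \<forall>w\<in>{a<..<b}. v \<noteq> w \<longrightarrow> ?N v \<inter> ?N w = {}" by blast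
  qed (use interval_NC_finite(1) in auto)
  also have "(\<Sum>v\<in>{a<..<b}. sum ?w (?N v)) =
    (\<Sum>v\<in>{a<..<b}. NC_sum k k (Suc a) v * first_block_sum (\<lambda>n. l (Suc n)) \<kappa> k v b)"
    by (intro sum.cong refl sum_second_element) auto
  also have "sum ?w ?N1 = l 1 * NC_sum \<kappa> k (Suc a) b"
    by (rule sum_singleton_first_block [OF assms])
  finally show ?thesis .
qed

lemma first_block_sum_recursion_length:
  "first_block_sum l \<kappa> k a (a + Suc n) = l 1 * NC_sum \<kappa> k (Suc a) (Suc a + n) +
    (\<Sum>g<n. NC_sum k k (Suc a) (Suc a + g) *
      first_block_sum (\<lambda>n. l (Suc n)) \<kappa> k (Suc a + g) ((Suc a + g) + (n - g)))"
proof -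
  let ?h = "\<lambda>v. NC_sum k k (Suc a) v * first_block_sum (\<lambda>n. l (Suc n)) \<kappa> k v (Suc a + n)"
  have "sum ?h {a<..<Suc a + n} = (\<Sum>g<n. ?h (Suc a + g))"
    by (rule sum.reindex_bij_witness [where i = "\<lambda>g. Suc a + g" and j = "\<lambda>v. v - Suc a"]) auto
  also have "\<dots> = (\<Sum>g<n. NC_sum k k (Suc a) (Suc a + g) *
      first_block_sum (\<lambda>n. l (Suc n)) \<kappa> k (Suc a + g) ((Suc a + g) + (n - g)))"
    by (intro sum.cong) auto
  finally show ?thesis
    using first_block_sum_recursion [of a "a + Suc n" l \<kappa> k] by simp
qed

text \<open>The recursion expresses both sums by intervals whose position enters only through their lengths.\<close>

lemma NC_sum_translate:
  "first_block_sum l \<kappa> k a (a + n) = first_block_sum l \<kappa> k a' (a' + n)"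
  "NC_sum \<kappa> k a (a + n) = NC_sum \<kappa> k a' (a' + n)"
proof (induction n arbitrary: l \<kappa> a a' rule: less_induct)
  case (less n)
  have eq: "first_block_sum l \<kappa> k a (a + n) = first_block_sum l \<kappa> k a' (a' + n)" for l \<kappa> a a'
  proof (cases n)
    case 0
    have "interval_NC a a = {{}}" for a
      by (auto simp: interval_NC_def partition_on_empty noncrossing_def)
    then show ?thesis using 0 by (simp add: first_block_sum_def)
  next
    case (Suc m)
    show ?thesis
      unfolding Suc first_block_sum_recursion_length
      by (intro arg_cong2 [where f = "(+)"] arg_cong2 [where f = "(*)"] sum.cong refl less.IH)
        (use Suc in auto)
  qed
  {
    case 1
    show ?case by (rule eq)
  next
    case 2
    show ?case unfolding NC_sum_eq_first_block_sum by (rule eq)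
  }
qed

text \<open>The Boolean cumulants of the sums with outer weight \<open>\<kappa>\<close> and inner weight \<open>k\<close> are bridges: \<open>\<kappa>\<close>
on the first block, and on its gaps the sums in which all blocks have weight \<open>k\<close>.  Both sides
satisfy the recursion over the first gap.\<close>

theorem NC_sum_boolean:
  fixes x :: 'x
  assumes "n \<ge> 1"
  shows "NC_sum \<kappa> k 0 n =
    prefix_conv (bridge_conv (\<lambda>s. \<kappa> (length s)) (\<lambda>s. NC_sum k k 0 (length s)) empty_word)
      (\<lambda>s. NC_sum \<kappa> k 0 (length s)) (replicate n x)"
proof -
  let ?F = "\<lambda>s :: 'x list. NC_sum k k 0 (length s)"
  let ?C = "\<lambda>s :: 'x list. NC_sum \<kappa> k 0 (length s)"
  have "first_block_sum l \<kappa> k 0 n =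
    prefix_conv (bridge_conv (\<lambda>s. l (length s)) ?F empty_word) ?C (replicate n x)" if "n \<ge> 1" for l n
    using that
  proof (induction n arbitrary: l rule: less_induct)
    case (less n)
    then obtain m where n: "n = Suc m" by (cases n) auto
    have "first_block_sum l \<kappa> k 0 n = l 1 * NC_sum \<kappa> k 0 m +
      (\<Sum>g<m. NC_sum k k 0 g * first_block_sum (\<lambda>n. l (Suc n)) \<kappa> k 0 (m - g))"
    proof -
      have first: "first_block_sum l' \<kappa> k (Suc 0 + g) (Suc 0 + g + j) = first_block_sum l' \<kappa> k 0 j" for l' g j
        using NC_sum_translate(1) [of l' \<kappa> k "Suc 0 + g" j 0] by simp
      have all: "NC_sum \<kappa>' k (Suc 0) (Suc 0 + j) = NC_sum \<kappa>' k 0 j" for \<kappa>' j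
        using NC_sum_translate(2) [of \<kappa>' k "Suc 0" j 0] by simp
      show ?thesis
        using first_block_sum_recursion_length [of l \<kappa> k 0 m] unfolding n first all add_0 .
    qed
    also have "\<dots> = l 1 * NC_sum \<kappa> k 0 m + (\<Sum>g<m. NC_sum k k 0 g *
      prefix_conv (bridge_conv (\<lambda>s. l (Suc (length s))) ?F empty_word) ?C (replicate (m - g) x))"
      by (intro arg_cong2 [where f = "(+)"] arg_cong2 [where f = "(*)"] sum.cong refl less.IH) (auto simp: n)
    also have "\<dots> = l 1 * NC_sum \<kappa> k 0 m +
      prefix_conv (bridge_conv (\<lambda>s. l (Suc (length s))) ?F ?F) ?C (replicate m x)"
      by (subst prefix_conv_bridge_first_gap) (simp add: min_def)
    also have "\<dots> = prefix_conv (bridge_conv (\<lambda>s. l (length s)) ?F empty_word) ?C (replicate n x)"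
      by (simp add: n prefix_conv_bridge_Cons del: prefix_conv.simps(2))
    finally show ?case .
  qed
  from this [OF assms] show ?thesis by (simp add: NC_sum_eq_first_block_sum)
qed

section \<open>Free and conditionally free cumulants\<close>

lemma NC_eq_interval_NC: "NC n = interval_NC 1 (1 + n)"
  by (simp add: NC_def interval_NC_def atLeastLessThanSuc_atLeastAtMost)

lemma free_moment_sum: "(\<Sum>\<pi>\<in>NC n. \<Prod>V\<in>\<pi>. k (card V)) = NC_sum k k 0 n"
proof -
  have "NC_sum k k 0 n = NC_sum k k 1 (1 + n)"
    using NC_sum_translate(2) [of k k 0 n 1] by simp
  then show ?thesis by (simp add: NC_sum_def NC_eq_interval_NC inner_weight)
qed

text \<open>The sums that define free and c-free cumulants are instances of \<open>NC_sum\<close>, the free one with equal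
weights on inner and outer blocks.\<close>

lemma cfree_moment_sum:
  "(\<Sum>\<pi>\<in>NC n. (\<Prod>V\<in>{V\<in>\<pi>. \<not> inner_block \<pi> V}. \<kappa> (card V)) *
      (\<Prod>V\<in>{V\<in>\<pi>. inner_block \<pi> V}. k (card V))) = NC_sum \<kappa> k 0 n"
proof -
  have "NC_sum \<kappa> k 0 n = NC_sum \<kappa> k 1 (1 + n)"
    using NC_sum_translate(2) [of \<kappa> k 0 n 1] by simp
  moreover have "(\<Prod>V\<in>{V\<in>\<pi>. \<not> inner_block \<pi> V}. \<kappa> (card V)) *
      (\<Prod>V\<in>{V\<in>\<pi>. inner_block \<pi> V}. k (card V)) = (\<Prod>V\<in>\<pi>. block_weight \<kappa> k \<pi> V)"
    if "\<pi> \<in> interval_NC 1 (1 + n)" for \<pi>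
    unfolding block_weight_def
    using prod.If_cases [OF interval_NC_finite(2) [OF that], of "inner_block \<pi>" "\<lambda>V. k (card V)" "\<lambda>V. \<kappa> (card V)"]
    by (simp add: Int_def conj_commute mult.commute)
  ultimately show ?thesis by (simp add: NC_sum_def NC_eq_interval_NC)
qed

text \<open>The one-block partition contributes \<open>\<kappa> n\<close>; in all others the blocks have fewer than \<open>n\<close> elements.\<close>

lemma NC_sum_triangular:
  assumes "n \<ge> 1" and eq: "\<And>m. m < n \<Longrightarrow> \<kappa> m = \<kappa>' m" "\<And>m. m < n \<Longrightarrow> k m = k' m"
  shows "NC_sum \<kappa> k 0 n - \<kappa> n = NC_sum \<kappa>' k' 0 n - \<kappa>' n"
proof -
  let ?top = "{{0..<n}}"
  have top: "?top \<in> interval_NC 0 n"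
    using assms(1) by (auto simp: interval_NC_def partition_on_def noncrossing_def)
  have small: "card V < n" if \<pi>: "\<pi> \<in> interval_NC 0 n" "\<pi> \<noteq> ?top" and V: "V \<in> \<pi>" for \<pi> V
  proof -
    have sub: "V \<subseteq> {0..<n}" using interval_NC_bounds [OF \<pi>(1) V] by auto
    have "V \<noteq> {0..<n}"
    proof
      assume eq: "V = {0..<n}"
      have "W = V" if W: "W \<in> \<pi>" for W
      proof -
        have "W \<noteq> {}" using \<pi>(1) W by (auto simp: interval_NC_iff)
        then obtain x where "x \<in> W" by blast
        moreover from this have "x \<in> V" using interval_NC_bounds [OF \<pi>(1) W] eq by auto
        ultimately show ?thesis using \<pi>(1) V W unfolding interval_NC_iff by blast
      qed
      then show False using \<pi>(2) V eq by blast
    qed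
    then show ?thesis using psubset_card_mono [of "{0..<n}" V] sub by auto
  qed
  have split: "NC_sum \<kappa> k 0 n - \<kappa> n =
    (\<Sum>\<pi>\<in>interval_NC 0 n - {?top}. \<Prod>V\<in>\<pi>. block_weight \<kappa> k \<pi> V)" for \<kappa> k
    unfolding NC_sum_def
    by (subst sum.remove [OF interval_NC_finite(1) top]) (auto simp: block_weight_def inner_block_def)
  show ?thesis
    unfolding split
    by (intro sum.cong prod.cong refl) (auto simp: block_weight_def intro!: eq small)
qed

text \<open>The weight \<open>K \<kappa>\<close> of the inner blocks is \<open>\<kappa>\<close> itself for free cumulants and a constant sequence for
c-free cumulants.\<close>

lemma cumulants_exist_unique:
  assumes K: "\<And>\<kappa> \<kappa>' n. (\<forall>m<n. \<kappa> m = \<kappa>' m) \<Longrightarrow> (\<forall>m<n. K \<kappa> m = K \<kappa>' m)"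
  shows "\<exists>!\<kappa>. \<kappa> 0 = 0 \<and> (\<forall>n\<ge>1. s n = NC_sum \<kappa> (K \<kappa>) 0 n)"
proof
  \<comment> \<open>the subtracted difference depends on the values of \<open>\<kappa>\<close> below \<open>n\<close> only\<close>
  let ?T = "\<lambda>\<kappa> n. if n = 0 then 0 else s n - (NC_sum \<kappa> (K \<kappa>) 0 n - \<kappa> n)"
  have local: "NC_sum \<kappa> (K \<kappa>) 0 n - \<kappa> n = NC_sum \<kappa>' (K \<kappa>') 0 n - \<kappa>' n"
    if "n \<ge> 1" "\<forall>m<n. \<kappa> m = \<kappa>' m" for \<kappa> \<kappa>' n
    using that K [OF that(2)] by (intro NC_sum_triangular) auto
  define \<kappa> where "\<kappa> = wfrec less_than ?T"
  have \<kappa>: "\<kappa> n = ?T \<kappa> n" for n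
  proof -
    have "\<kappa> n = ?T (cut \<kappa> less_than n) n"
      unfolding \<kappa>_def by (rule wfrec) simp
    moreover have "NC_sum (cut \<kappa> less_than n) (K (cut \<kappa> less_than n)) 0 n - cut \<kappa> less_than n n =
        NC_sum \<kappa> (K \<kappa>) 0 n - \<kappa> n" if "n \<ge> 1"
      using that by (intro local) (simp_all add: cut_apply)
    ultimately show ?thesis by simp
  qed
  show "\<kappa> 0 = 0 \<and> (\<forall>n\<ge>1. s n = NC_sum \<kappa> (K \<kappa>) 0 n)"
  proof (intro conjI allI impI)
    show "\<kappa> 0 = 0" by (subst \<kappa>) simp
    show "s n = NC_sum \<kappa> (K \<kappa>) 0 n" if "n \<ge> 1" for n
      using \<kappa> [of n] that by (simp add: algebra_simps)
  qed
  fix \<kappa>' assume \<kappa>': "\<kappa>' 0 = 0 \<and> (\<forall>n\<ge>1. s n = NC_sum \<kappa>' (K \<kappa>') 0 n)"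
  have "\<kappa>' n = \<kappa> n" for n
  proof (induction n rule: less_induct)
    case (less n)
    show ?case
    proof (cases "n = 0")
      case True
      then show ?thesis using \<kappa>' \<open>\<kappa> 0 = 0 \<and> _\<close> by simp
    next
      case False
      then show ?thesis
        using \<kappa>' \<open>\<kappa> 0 = 0 \<and> _\<close> local [of n \<kappa>' \<kappa>] less by simp
    qed
  qed
  then show "\<kappa>' = \<kappa>" by blast
qed

lemma free_cumulant_unique:
  "\<exists>!k. k 0 = 0 \<and> (\<forall>n\<ge>1. moment \<nu> n = NC_sum k k 0 n)"
  by (rule cumulants_exist_unique) simp

lemma free_cumulant_0: "free_cumulant \<nu> 0 = 0"
  and moment_eq_free: "n \<ge> 1 \<Longrightarrow> moment \<nu> n = NC_sum (free_cumulant \<nu>) (free_cumulant \<nu>) 0 n"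
  using theI' [OF free_cumulant_unique [of \<nu>]]
  unfolding free_cumulant_def free_moment_sum by blast+

lemma free_cumulant_eqI:
  "k 0 = 0 \<Longrightarrow> (\<And>n. n \<ge> 1 \<Longrightarrow> moment \<nu> n = NC_sum k k 0 n) \<Longrightarrow> free_cumulant \<nu> = k"
  unfolding free_cumulant_def free_moment_sum
  by (rule the1_equality [OF free_cumulant_unique [of \<nu>]]) blast

lemma cfree_cumulant_unique:
  "\<exists>!\<kappa>. \<kappa> 0 = 0 \<and> (\<forall>n\<ge>1. moment \<mu> n = NC_sum \<kappa> k 0 n)"
  by (rule cumulants_exist_unique) simp

lemma cfree_cumulant_0: "cfree_cumulant \<mu> \<nu> 0 = 0"
  and moment_eq_cfree: "n \<ge> 1 \<Longrightarrow> moment \<mu> n = NC_sum (cfree_cumulant \<mu> \<nu>) (free_cumulant \<nu>) 0 n"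
  using theI' [OF cfree_cumulant_unique [of \<mu> "free_cumulant \<nu>"]]
  unfolding cfree_cumulant_def cfree_moment_sum by blast+

lemma cfree_cumulant_eqI:
  "\<kappa> 0 = 0 \<Longrightarrow> (\<And>n. n \<ge> 1 \<Longrightarrow> moment \<mu> n = NC_sum \<kappa> (free_cumulant \<nu>) 0 n) \<Longrightarrow> cfree_cumulant \<mu> \<nu> = \<kappa>"
  unfolding cfree_cumulant_def cfree_moment_sum
  by (rule the1_equality [OF cfree_cumulant_unique [of \<mu> "free_cumulant \<nu>"]]) blast

lemma NC_sum_zero_cumulants:
  assumes "n \<ge> 1"
  shows "NC_sum (\<lambda>_. 0) (\<lambda>_. 0) 0 n = 0"
  unfolding NC_sum_def
proof (rule sum.neutral, rule ballI)
  fix \<pi> assume \<pi>: "\<pi> \<in> interval_NC 0 n"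
  then have "\<pi> \<noteq> {}" using assms by (auto simp: interval_NC_iff)
  then show "(\<Prod>V\<in>\<pi>. block_weight (\<lambda>_. 0) (\<lambda>_. 0) \<pi> V) = 0"
    using interval_NC_finite(2) [OF \<pi>] by (auto simp: block_weight_def)
qed

text \<open>So with \<open>delta0\<close> as second distribution, only partitions without inner blocks contribute.\<close>

lemma free_cumulant_delta0: "free_cumulant delta0 = (\<lambda>_. 0)"
  by (rule free_cumulant_eqI) (simp_all add: NC_sum_zero_cumulants delta0_def)

lemma free_conv_delta0:
  assumes "is_distribution \<nu>"
  shows "free_conv delta0 \<nu> = \<nu>"
  unfolding free_conv_def free_cumulant_delta0
proof (rule the_equality)
  fix \<nu>' assume \<nu>': "is_distribution \<nu>' \<and> (\<forall>n\<ge>1. free_cumulant \<nu>' n = 0 + free_cumulant \<nu> n)"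
  have "free_cumulant \<nu>' n = free_cumulant \<nu> n" for n
    using \<nu>' by (cases "n = 0") (simp_all add: free_cumulant_0)
  then have "free_cumulant \<nu>' = free_cumulant \<nu>" by blast
  then show "\<nu>' = \<nu>" using assms \<nu>' by (intro distribution_eqI) (simp_all add: moment_eq_free)
qed (use assms in simp)

theorem cfree_conv_delta0:
  fixes \<mu>1 \<mu>2 \<nu>2 :: distribution
  assumes "is_distribution \<nu>2"
  defines "\<kappa> \<equiv> \<lambda>n. cfree_cumulant \<mu>1 delta0 n + cfree_cumulant \<mu>2 \<nu>2 n"
  shows "is_distribution (cfree_conv \<mu>1 delta0 \<nu>2 \<mu>2)"
    and "n \<ge> 1 \<Longrightarrow> moment (cfree_conv \<mu>1 delta0 \<nu>2 \<mu>2) n = NC_sum \<kappa> (free_cumulant \<nu>2) 0 n"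
proof -
  have \<kappa>0: "\<kappa> 0 = 0" by (simp add: \<kappa>_def cfree_cumulant_0)
  obtain \<mu> where \<mu>: "is_distribution \<mu>" "\<And>n. moment \<mu> n = NC_sum \<kappa> (free_cumulant \<nu>2) 0 n"
    by (rule distribution_with_moments [of "NC_sum \<kappa> (free_cumulant \<nu>2) 0"]) (simp_all add: NC_sum_empty)
  have "cfree_conv \<mu>1 delta0 \<nu>2 \<mu>2 = \<mu>"
    unfolding cfree_conv_def free_conv_delta0 [OF assms(1)] \<kappa>_def [symmetric]
  proof (rule the_equality)
    have "cfree_cumulant \<mu> \<nu>2 = \<kappa>" by (rule cfree_cumulant_eqI) (simp_all add: \<kappa>0 \<mu>)
    then show "is_distribution \<mu> \<and> (\<forall>n\<ge>1. cfree_cumulant \<mu> \<nu>2 n =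
        cfree_cumulant \<mu>1 delta0 n + cfree_cumulant \<mu>2 \<nu>2 n)"
      using \<mu>(1) by (simp add: \<kappa>_def)
    fix \<mu>' assume \<mu>': "is_distribution \<mu>' \<and> (\<forall>n\<ge>1. cfree_cumulant \<mu>' \<nu>2 n =
        cfree_cumulant \<mu>1 delta0 n + cfree_cumulant \<mu>2 \<nu>2 n)"
    have "cfree_cumulant \<mu>' \<nu>2 n = \<kappa> n" for n
      using \<mu>' \<kappa>0 by (cases "n = 0") (simp_all add: cfree_cumulant_0 \<kappa>_def)
    then have "cfree_cumulant \<mu>' \<nu>2 = \<kappa>" by blast
    then show "\<mu>' = \<mu>"
      using \<mu>(1) \<mu>' by (intro distribution_eqI) (simp_all add: moment_eq_cfree [of _ \<mu>' \<nu>2] \<mu>(2))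
  qed
  then show "is_distribution (cfree_conv \<mu>1 delta0 \<nu>2 \<mu>2)"
    and "n \<ge> 1 \<Longrightarrow> moment (cfree_conv \<mu>1 delta0 \<nu>2 \<mu>2) n = NC_sum \<kappa> (free_cumulant \<nu>2) 0 n"
    using \<mu> by simp_all
qed

lemma words_over_unit: "w = replicate (length w) ()" for w :: "unit list"
  by (induction w) simp_all

text \<open>The first component on powers of a letter.  With \<open>R\<close> restricting to these powers, the Boolean cumulants
of \<open>\<mu>2\<close> are the bridges with its c-free cumulants \<open>\<kappa>2\<close>, those of \<open>\<mu>1\<close> are its c-free cumulants \<open>\<kappa>1\<close>
relative to \<open>delta0\<close>.  Since bridges are additive in the weight of the selected letters, the Boolean
cumulants of \<open>q\<close> are the bridges with \<open>\<kappa>1 + \<kappa>2\<close>, which are those of the c-free convolution.\<close>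

theorem cfree_conv_words:
  fixes q b1 b2 p1 p2 r2 :: "'a list \<Rightarrow> complex"
  assumes dist: "is_distribution \<mu>1" "is_distribution \<mu>2" "is_distribution \<nu>2"
    and p1: "\<And>n. p1 (replicate n a) = moment \<mu>1 n"
    and p2: "\<And>n. p2 (replicate n a) = moment \<mu>2 n"
    and r2: "\<And>n. r2 (replicate n a) = moment \<nu>2 n"
    and b1: "\<And>w. w \<noteq> [] \<Longrightarrow> p1 w = prefix_conv b1 p1 w"
    and b2: "\<And>w. w \<noteq> [] \<Longrightarrow> p2 w = prefix_conv b2 p2 w"
    and q: "q [] = 1" "\<And>w. w \<noteq> [] \<Longrightarrow> q w = prefix_conv (\<lambda>u. b2 u + bridge_conv b1 r2 empty_word u) q w"
  shows "n \<ge> 1 \<Longrightarrow> q (replicate n a) = moment (cfree_conv \<mu>1 delta0 \<nu>2 \<mu>2) n"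
proof -
  define R :: "('a list \<Rightarrow> complex) \<Rightarrow> unit list \<Rightarrow> complex" where "R f w = f (replicate (length w) a)" for f w
  define \<kappa>1 where "\<kappa>1 = cfree_cumulant \<mu>1 delta0"
  define \<kappa>2 where "\<kappa>2 = cfree_cumulant \<mu>2 \<nu>2"
  define k where "k = free_cumulant \<nu>2"
  define M where "M w = moment \<nu>2 (length w)" for w :: "unit list"
  have unit: "w = replicate (length w) ()" for w :: "unit list" by (rule words_over_unit)
  have prefix: "R f w = prefix_conv (R b) (R f) w"
    if "\<And>w. w \<noteq> [] \<Longrightarrow> f w = prefix_conv b f w" "w \<noteq> []" for f b w
  proof -
    have "R f w = prefix_conv b f (replicate (length w) a)" unfolding R_def using that by simp
    also have "\<dots> = prefix_conv (R b) (R f) (replicate (length w) ())"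
      unfolding R_def by (rule replicate_restrict_prefix)
    finally show ?thesis using unit [of w] by simp
  qed
  have NC: "NC_sum \<kappa> k' 0 (length w) = prefix_conv
      (bridge_conv (\<lambda>s. \<kappa> (length s)) (\<lambda>s. NC_sum k' k' 0 (length s)) empty_word)
      (\<lambda>s. NC_sum \<kappa> k' 0 (length s)) w" if "w \<noteq> []" for \<kappa> k' and w :: "unit list"
    using NC_sum_boolean [of "length w" \<kappa> k' "()"] unit [of w] that by (cases w) auto
  have k: "NC_sum k k 0 (length w) = M w" for w :: "unit list"
    unfolding M_def using moment_eq_free [of "length w" \<nu>2] moment_0 [OF dist(3)]
    by (cases w) (simp_all add: NC_sum_empty k_def)
  have R2: "R p2 w = NC_sum \<kappa>2 k 0 (length w)" for w
    unfolding R_def p2 using moment_eq_cfree [of "length w" \<mu>2 \<nu>2] moment_0 [OF dist(2)]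
    by (cases w) (simp_all add: NC_sum_empty k_def \<kappa>2_def)
  have R1: "R p1 w = NC_sum \<kappa>1 (\<lambda>_. 0) 0 (length w)" for w
    unfolding R_def p1 using moment_eq_cfree [of "length w" \<mu>1 delta0] moment_0 [OF dist(1)]
    by (cases w) (simp_all add: NC_sum_empty \<kappa>1_def free_cumulant_delta0)
  have Rb2: "R b2 w = bridge_conv (\<lambda>s. \<kappa>2 (length s)) M empty_word w" if "w \<noteq> []" for w
  proof (rule prefix_conv_cancel [of "R p2", OF _ _ that])
    show "R p2 [] = 1" by (simp add: R2 NC_sum_empty)
    show "prefix_conv (R b2) (R p2) w = prefix_conv (bridge_conv (\<lambda>s. \<kappa>2 (length s)) M empty_word) (R p2) w"
      if "w \<noteq> []" for w
      using prefix [OF b2 that] NC [OF that, of \<kappa>2 k] by (simp add: R2 [abs_def] k)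
  qed
  have Rb1: "R b1 w = \<kappa>1 (length w)" if "w \<noteq> []" for w
  proof (rule prefix_conv_cancel [of "R p1" _ "\<lambda>w. \<kappa>1 (length w)", OF _ _ that])
    show "R p1 [] = 1" by (simp add: R1 NC_sum_empty)
    \<comment> \<open>\<open>delta0\<close> has the moments of the empty word functional: only empty gaps are allowed\<close>
    have zero: "(\<lambda>s :: unit list. NC_sum (\<lambda>_. 0) (\<lambda>_. 0) 0 (length s)) = empty_word"
      by (auto simp: fun_eq_iff empty_word_def NC_sum_empty intro!: NC_sum_zero_cumulants simp: Suc_le_eq)
    show "prefix_conv (R b1) (R p1) w = prefix_conv (\<lambda>w. \<kappa>1 (length w)) (R p1) w" if "w \<noteq> []" for w
    proof -
      have "prefix_conv (bridge_conv (\<lambda>s. \<kappa>1 (length s)) empty_word empty_word) (R p1) w =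
        prefix_conv (\<lambda>w. \<kappa>1 (length w)) (R p1) w"
        by (intro prefix_conv_cong bridge_conv_empty_gaps)
      then show ?thesis
        using prefix [OF b1 that] NC [OF that, of \<kappa>1 "\<lambda>_. 0"] by (simp add: R1 [abs_def] zero)
    qed
  qed
  define \<kappa> where "\<kappa> n = \<kappa>1 n + \<kappa>2 n" for n
  have Rq: "R q w = NC_sum \<kappa> k 0 (length w)" for w
  proof (induction w rule: measure_induct_rule [of length])
    case (less w)
    show ?case
    proof (cases "w = []")
      case True
      then show ?thesis by (simp add: R_def q(1) NC_sum_empty)
    next
      case False
      have "R r2 = M" by (simp add: fun_eq_iff R_def M_def r2)
      moreover have "R empty_word = empty_word" by (auto simp: fun_eq_iff R_def empty_word_def)
      ultimately have "R (bridge_conv b1 r2 empty_word) u = bridge_conv (R b1) M empty_word u" for u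
        unfolding R_def [of "bridge_conv b1 r2 empty_word"]
        using replicate_restrict_bridge [of b1 r2 empty_word "length u" a "()"] unit [of u]
        by (simp add: R_def [abs_def])
      then have bridge: "R (\<lambda>u. b2 u + bridge_conv b1 r2 empty_word u) u =
          bridge_conv (\<lambda>s. \<kappa> (length s)) M empty_word u" if "u \<noteq> []" for u
        using Rb2 [OF that] bridge_conv_cong [of "R b1" "\<lambda>s. \<kappa>1 (length s)" M empty_word u, OF Rb1]
        by (simp add: R_def [of "\<lambda>u. b2 u + bridge_conv b1 r2 empty_word u"] R_def [symmetric]
            \<kappa>_def bridge_conv_add)
      have "R q w = prefix_conv (R (\<lambda>u. b2 u + bridge_conv b1 r2 empty_word u)) (R q) w"
        by (rule prefix [OF q(2) False])
      also have "\<dots> = prefix_conv (bridge_conv (\<lambda>s. \<kappa> (length s)) M empty_word) (R q) w"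
        using bridge by (rule prefix_conv_cong)
      also have "\<dots> = prefix_conv (bridge_conv (\<lambda>s. \<kappa> (length s)) M empty_word)
          (\<lambda>s. NC_sum \<kappa> k 0 (length s)) w"
        by (rule prefix_conv_right_local) (use less in blast)
      also have "\<dots> = NC_sum \<kappa> k 0 (length w)" using NC [OF False, of \<kappa> k] by (simp add: k)
      finally show ?thesis .
    qed
  qed
  show "q (replicate n a) = moment (cfree_conv \<mu>1 delta0 \<nu>2 \<mu>2) n" if "n \<ge> 1"
    using Rq [of "replicate n ()"] cfree_conv_delta0(2) [OF dist(3) that, of \<mu>1 \<mu>2]
    by (simp add: R_def \<kappa>_def [abs_def] \<kappa>1_def \<kappa>2_def k_def)
qed

section \<open>Monotone independence\<close>

text \<open>The family of subalgebras in \<open>monotone_sum\<close>, \<open>x\<close> having the smaller index.\<close>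

definition monotone_family :: "(complex \<Rightarrow> 'a::ring_1 \<Rightarrow> 'a) \<Rightarrow> 'a \<Rightarrow> 'a \<Rightarrow> nat \<Rightarrow> 'a set" where
  "monotone_family scale x y =
     (\<lambda>i. if i = 1 then subalgebra scale hull {x} else subalgebra scale hull {y})"

lemma monotone_sum_iff:
  "monotone_sum scale \<nu>1 \<nu>2 \<nu> \<longleftrightarrow>
     (\<exists>\<phi> x y. nc_prob_space scale \<phi> \<and> has_distribution \<phi> x \<nu>1 \<and> has_distribution \<phi> y \<nu>2 \<and>
        monotone_independent \<phi> (monotone_family scale x y) {1, 2} \<and> has_distribution \<phi> (x + y) \<nu>)"
  by (simp add: monotone_sum_def monotone_family_def)

lemma power_in_hull:
  assumes "n \<ge> 1"
  shows "z ^ n \<in> subalgebra scale hull {z}"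
  using assms
proof (induction n rule: dec_induct)
  case base
  then show ?case by (simp add: hull_inc)
next
  case (step n)
  then show ?case by (auto simp: hull_def subalgebra_def)
qed

lemma hull_mult:
  "a \<in> subalgebra scale hull {z} \<Longrightarrow> b \<in> subalgebra scale hull {z} \<Longrightarrow> a * b \<in> subalgebra scale hull {z}"
  by (auto simp: hull_def subalgebra_def)

text \<open>The admissible arguments in the definition of monotone independence.\<close>

definition alternating :: "(nat \<Rightarrow> 'a set) \<Rightarrow> 'a list \<Rightarrow> nat list \<Rightarrow> bool" where
  "alternating A xs is \<longleftrightarrow> length is = length xs \<and> set is \<subseteq> {1, 2} \<and>
     (\<forall>j<length xs. xs ! j \<in> A (is ! j)) \<and> (\<forall>j. Suc j < length xs \<longrightarrow> is ! j \<noteq> is ! Suc j)"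

lemma alternating_Cons:
  assumes "alternating A xs is" "a \<in> A i" "i \<in> {1, 2}" "xs \<noteq> [] \<Longrightarrow> is ! 0 \<noteq> i"
  shows "alternating A (a # xs) (i # is)"
proof -
  have "(a # xs) ! j \<in> A ((i # is) ! j)" if "j < length (a # xs)" for j
    using that assms(1,2) by (cases j) (auto simp: alternating_def)
  moreover have "(i # is) ! j \<noteq> (i # is) ! Suc j" if "Suc j < length (a # xs)" for j
    using that assms(1,4) by (cases j) (auto simp: alternating_def)
  ultimately show ?thesis using assms(1,3) by (simp add: alternating_def)
qed

text \<open>Multiply the letters of each maximal run; the generated subalgebras are closed under products.\<close>

lemma word_alternating:
  fixes x y :: "'a::ring_1" and w :: "bool list"
  assumes "w \<noteq> []"
  shows "\<exists>xs is. alternating (monotone_family scale x y) xs is \<and> xs \<noteq> [] \<and>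
    is ! 0 = (if hd w then 1 else 2) \<and> prod_list xs = prod_list (map (\<lambda>c. if c then x else y) w)"
  using assms
proof (induction w)
  case (Cons c w)
  let ?A = "monotone_family scale x y"
  let ?l = "\<lambda>c. if c then x else y"
  let ?i = "\<lambda>c. if c then 1 else (2::nat)"
  have c: "?l c \<in> ?A (?i c)" by (simp add: monotone_family_def hull_inc)
  show ?case
  proof (cases "w = []")
    case True
    have "alternating ?A [?l c] [?i c]" using c by (simp add: alternating_def)
    then show ?thesis using True by (intro exI [of _ "[?l c]"] exI [of _ "[?i c]"]) simp
  next
    case False
    then obtain xs "is" where IH: "alternating ?A xs is" "xs \<noteq> []" "is ! 0 = ?i (hd w)"
      "prod_list xs = prod_list (map ?l w)" using Cons.IH by blast
    show ?thesis
    proof (cases "hd w = c")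
      case False
      then have "alternating ?A (?l c # xs) (?i c # is)"
        using IH(1,3) c by (intro alternating_Cons) auto
      then show ?thesis
        using IH(4) by (intro exI [of _ "?l c # xs"] exI [of _ "?i c # is"]) simp
    next
      case True
      obtain z zs where xs: "xs = z # zs" using IH(2) by (cases xs) auto
      have "z \<in> ?A (?i c)" using IH(1,3) xs True by (auto simp: alternating_def)
      then have z: "?l c * z \<in> ?A (?i c)" using c by (auto simp: monotone_family_def intro: hull_mult)
      have "alternating ?A ((?l c * z) # zs) is"
      proof -
        have "((?l c * z) # zs) ! j \<in> ?A (is ! j)" if "j < length xs" for j
          using that IH(1,3) z True xs by (cases j) (auto simp: alternating_def)
        then show ?thesis using IH(1) xs by (simp add: alternating_def)
      qed
      then show ?thesis
        using IH(3,4) xs True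
        by (intro exI [of _ "(?l c * z) # zs"] exI [of _ "is"]) (simp add: mult.assoc)
    qed
  qed
qed simp

text \<open>A power of \<open>y\<close> whose neighbours, if any, lie in the subalgebra of \<open>x\<close> is a strict local maximum.\<close>

lemma monotone_extract_peak:
  assumes mono: "monotone_independent \<phi> (monotone_family scale x y) {1, 2}"
    and "\<phi> 1 = 1"
    and alt: "alternating (monotone_family scale x y) xs is" "xs \<noteq> [] \<Longrightarrow> is ! 0 = 1"
  shows "\<phi> (x ^ s * y ^ g * prod_list xs) = \<phi> (y ^ g) * \<phi> (x ^ s * prod_list xs)"
proof (cases "g = 0")
  case True
  then show ?thesis using assms(2) by simp
next
  case False
  let ?A = "monotone_family scale x y"
  have y: "y ^ g \<in> ?A 2" using False by (simp add: monotone_family_def power_in_hull)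
  have peak: "\<phi> (prod_list ys) = \<phi> (ys ! l) * \<phi> (prod_list (take l ys @ drop (Suc l) ys))"
    if "alternating ?A ys js" "l < length ys" "0 < l \<Longrightarrow> js ! (l - 1) < js ! l"
      "Suc l < length ys \<Longrightarrow> js ! Suc l < js ! l" for ys js l
    using mono that unfolding monotone_independent_def alternating_def by blast
  have first: "alternating ?A (y ^ g # xs) (2 # is)"
    using alt y by (intro alternating_Cons) auto
  show ?thesis
  proof (cases "s = 0")
    case True
    have "\<phi> (prod_list (y ^ g # xs)) = \<phi> ((y ^ g # xs) ! 0) * \<phi> (prod_list (take 0 (y ^ g # xs) @ drop (Suc 0) (y ^ g # xs)))"
      using alt(2) by (intro peak [OF first]) auto
    then show ?thesis using True by simp
  next
    case False
    let ?ys = "x ^ s # y ^ g # xs"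
    have x: "x ^ s \<in> ?A 1" using False by (simp add: monotone_family_def power_in_hull)
    have "alternating ?A ?ys (1 # 2 # is)"
      by (rule alternating_Cons [OF first x]) auto
    then have "\<phi> (prod_list ?ys) = \<phi> (?ys ! 1) * \<phi> (prod_list (take 1 ?ys @ drop (Suc 1) ?ys))"
      using alt(2) by (intro peak) auto
    then show ?thesis by (simp add: mult.assoc)
  qed
qed

text \<open>Expanding the factors from the left, the factors read so far can be kept in the form
\<open>x ^ s * y ^ g\<close>: as soon as a new factor \<open>x\<close> appears, the run \<open>y ^ g\<close> is a complete gap and is
extracted.  This is the recursion of \<open>word_conv\<close>.\<close>

lemma (in complex_algebra) monotone_moments:
  assumes \<phi>: "unital_functional scale \<phi>"
    and x: "\<And>n. \<phi> (x ^ n) = M n" and y: "\<And>n. \<phi> (y ^ n) = N n"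
    and mono: "monotone_independent \<phi> (monotone_family scale x y) {1, 2}"
  shows "\<phi> ((x + y) ^ n) =
    word_conv (\<lambda>w. M (length w)) (\<lambda>w. N (length w)) (\<lambda>w. N (length w)) (replicate n ())"
proof -
  have add: "\<phi> (a + b) = \<phi> a + \<phi> b" and one: "\<phi> 1 = 1" for a b
    using \<phi> by (simp_all add: unital_functional_def functional_iff)
  let ?l = "\<lambda>c. if c then x else y"
  have word: "\<phi> (x ^ s * y ^ g * (x * prod_list (map ?l w))) = N g * \<phi> (x ^ s * (x * prod_list (map ?l w)))"
    for s g w
  proof -
    obtain xs "is" where "alternating (monotone_family scale x y) xs is" "is ! 0 = 1"
      "prod_list xs = x * prod_list (map ?l w)"
      using word_alternating [of "True # w" scale x y] by auto
    then show ?thesis using monotone_extract_peak [OF mono one, of xs "is" s g] by (simp add: y)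
  qed
  have sum_power: "\<phi> (x ^ s * y ^ g * (x * (prod_list (map ?l w) * (x + y) ^ n))) =
      N g * \<phi> (x ^ s * (x * (prod_list (map ?l w) * (x + y) ^ n)))" for s g w n
  proof (induction n arbitrary: w)
    case 0
    then show ?case using word by simp
  next
    case (Suc n)
    have "prod_list (map ?l w) * (x + y) ^ Suc n =
      prod_list (map ?l (w @ [True])) * (x + y) ^ n + prod_list (map ?l (w @ [False])) * (x + y) ^ n"
      by (simp add: algebra_simps)
    then show ?case
      using Suc.IH [of "w @ [True]"] Suc.IH [of "w @ [False]"]
      by (simp only: distrib_left add)
  qed
  have "\<phi> (x ^ s * y ^ g * (x + y) ^ n) =
    word_conv (\<lambda>w. M (s + length w)) (\<lambda>w. N (length w)) (\<lambda>w. N (g + length w)) (replicate n ())" for s g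
  proof (induction n arbitrary: s g)
    case 0
    have "alternating (monotone_family scale x y) [] []" by (simp add: alternating_def)
    from monotone_extract_peak [OF mono one this, of s g] show ?case by (simp add: x y)
  next
    case (Suc n)
    have "\<phi> (x ^ s * y ^ g * (x + y) ^ Suc n) =
      \<phi> (x ^ s * y ^ Suc g * (x + y) ^ n) + \<phi> (x ^ s * y ^ g * (x * (x + y) ^ n))"
      unfolding power_Suc2 [of y g] power_Suc [of "x + y"] add [symmetric] by (simp add: algebra_simps)
    also have "\<phi> (x ^ s * y ^ g * (x * (x + y) ^ n)) = N g * \<phi> (x ^ Suc s * y ^ 0 * (x + y) ^ n)"
      using sum_power [of s g "[]" n] by (simp add: mult.assoc power_Suc2 del: power_Suc)
    finally show ?case
      using Suc.IH [of s "Suc g"] Suc.IH [of "Suc s" 0] by (simp del: power_Suc)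
  qed
  from this [of 0 0] show ?thesis by simp
qed

section \<open>A monotone pair in the free algebra\<close>

text \<open>The product of the gap values in a word whose selected letters are those equal to \<open>True\<close>, with \<open>P\<close>
for the first gap, as in \<open>word_conv\<close>.\<close>

fun gap_moments :: "(nat \<Rightarrow> complex) \<Rightarrow> (nat \<Rightarrow> complex) \<Rightarrow> bool list \<Rightarrow> complex" where
  "gap_moments N P [] = P 0"
| "gap_moments N P (c # w) =
     (if c then P 0 * gap_moments N N w else gap_moments N (\<lambda>n. P (Suc n)) w)"

lemma gap_moments_append: "gap_moments N P (u @ True # v) = gap_moments N P u * gap_moments N N v"
  by (induction u arbitrary: P) simp_all

lemma gap_moments_replicate: "gap_moments N P (replicate k False) = P k"
  by (induction k arbitrary: P) simp_all

text \<open>The value that monotone independence forces on a word in \<open>x\<close> (\<open>True\<close>) and \<open>y\<close> (\<open>False\<close>).\<close>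

definition monotone_word :: "(nat \<Rightarrow> complex) \<Rightarrow> (nat \<Rightarrow> complex) \<Rightarrow> bool list \<Rightarrow> complex" where
  "monotone_word M N w = M (count_list w True) * gap_moments N N w"

text \<open>The word without the run has an empty gap in its place, and an empty gap has the value \<open>1\<close>.\<close>

lemma monotone_word_peak:
  assumes "N 0 = 1" "u = [] \<or> last u" "v = [] \<or> hd v"
  shows "monotone_word M N (u @ replicate k False @ v) = N k * monotone_word M N (u @ v)"
proof -
  \<comment> \<open>the contribution of the gaps other than the one between \<open>u\<close> and \<open>v\<close>\<close>
  define c where "c = (if u = [] then 1 else gap_moments N N (butlast u)) *
    (if v = [] then 1 else gap_moments N N (tl v))"
  have gap: "gap_moments N N (u @ replicate k False @ v) = N k * c" for k
  proof -
    have right: "gap_moments N N (replicate k False @ v) = N k * (if v = [] then 1 else gap_moments N N (tl v))"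
      using assms(3) by (cases v) (auto simp: gap_moments_replicate gap_moments_append)
    show ?thesis
    proof (cases "u = []")
      case True
      then show ?thesis using right by (simp add: c_def)
    next
      case False
      then have "u = butlast u @ [True]" using assms(2) by (metis append_butlast_last_id)
      then have eq: "u @ replicate k False @ v = butlast u @ True # (replicate k False @ v)"
        by (metis append.assoc append_Cons append_Nil)
      show ?thesis unfolding eq gap_moments_append right using False by (simp add: c_def)
    qed
  qed
  have "count_list (replicate k False) True = 0" by (induction k) simp_all
  then show ?thesis
    using gap [of k] gap [of 0] assms(1) by (simp add: monotone_word_def)
qed

lemma monotone_word_replicate:
  assumes "M 0 = 1" "N 0 = 1"
  shows "monotone_word M N (replicate n True) = M n" "monotone_word M N (replicate n False) = N n"
proof -
  have "gap_moments N N (replicate n True) = 1" by (induction n) (simp_all add: assms)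
  moreover have "count_list (replicate n True) True = n" "count_list (replicate n False) True = 0"
    by (induction n) simp_all
  ultimately show "monotone_word M N (replicate n True) = M n" "monotone_word M N (replicate n False) = N n"
    by (simp_all add: monotone_word_def gap_moments_replicate assms)
qed

definition free_letter :: "bool \<Rightarrow> free_algebra_2" where
  "free_letter c = Poly_Mapping.single (Free_Monoid [c]) 1"

definition monotone_functional :: "(nat \<Rightarrow> complex) \<Rightarrow> (nat \<Rightarrow> complex) \<Rightarrow> free_algebra_2 \<Rightarrow> complex" where
  "monotone_functional M N p =
     (\<Sum>w\<in>Poly_Mapping.keys p. Poly_Mapping.lookup p w * monotone_word M N (letters w))"

lemma poly_mapping_single_induct:
  fixes p :: "'k \<Rightarrow>\<^sub>0 'b::comm_monoid_add"
  assumes "F 0 = G 0" "\<And>p q. F (p + q) = F p + F q" "\<And>p q. G (p + q) = G p + G q"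
    and "\<And>k c. k \<in> Poly_Mapping.keys p \<Longrightarrow> F (Poly_Mapping.single k c) = G (Poly_Mapping.single k c)"
  shows "F p = (G p :: complex)"
proof -
  have "F q = G q" if "Poly_Mapping.keys q \<subseteq> Poly_Mapping.keys p" for q
    using that
  proof (induction q rule: update_induct)
    case (update q k c)
    have up: "Poly_Mapping.update k c q = q + Poly_Mapping.single k c"
      using update.hyps(1)
      by (intro poly_mapping_eqI) (auto simp: lookup_update lookup_add lookup_single in_keys_iff when_def)
    have "k \<in> Poly_Mapping.keys p" "Poly_Mapping.keys q \<subseteq> Poly_Mapping.keys p"
      using update.prems update.hyps by (auto simp: keys_update split: if_splits)
    then show ?case using update.IH assms by (simp add: up)
  qed (rule assms(1))
  then show ?thesis by simp
qed

lemma free_algebra_scale_central: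
  "p * Poly_Mapping.single (0 :: bool free_monoid) (c :: complex) = Poly_Mapping.single 0 c * p"
proof (induction p rule: update_induct)
  case (update q k d)
  have up: "Poly_Mapping.update k d q = q + Poly_Mapping.single k d"
    using update.hyps(1)
    by (intro poly_mapping_eqI) (auto simp: lookup_update lookup_add lookup_single in_keys_iff when_def)
  show ?case by (simp add: up update.IH distrib_left distrib_right mult_single mult.commute)
qed simp

lemma complex_algebra_free: "complex_algebra scale_free_algebra_2"
proof
  fix a b :: complex and p q :: free_algebra_2
  show "scale_free_algebra_2 a (p + q) = scale_free_algebra_2 a p + scale_free_algebra_2 a q"
    by (simp add: scale_free_algebra_2_def distrib_left)
  show "scale_free_algebra_2 (a + b) p = scale_free_algebra_2 a p + scale_free_algebra_2 b p"
    by (simp add: scale_free_algebra_2_def single_add distrib_right)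
  show "scale_free_algebra_2 a (scale_free_algebra_2 b p) = scale_free_algebra_2 (a * b) p"
    by (simp add: scale_free_algebra_2_def mult.assoc [symmetric] mult_single)
  show "scale_free_algebra_2 1 p = p"
    by (simp add: scale_free_algebra_2_def)
  show "scale_free_algebra_2 a p * q = scale_free_algebra_2 a (p * q)"
    by (simp add: scale_free_algebra_2_def mult.assoc)
  show "p * scale_free_algebra_2 a q = scale_free_algebra_2 a (p * q)"
    by (simp add: scale_free_algebra_2_def mult.assoc [symmetric] free_algebra_scale_central)
qed

interpretation free_algebra: complex_algebra scale_free_algebra_2
  by (rule complex_algebra_free)

lemma lookup_scale_free:
  "Poly_Mapping.lookup (scale_free_algebra_2 c p) w = c * Poly_Mapping.lookup p w"
  unfolding scale_free_algebra_2_def mult_map_scale_conv_mult [symmetric]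
  by (simp add: Poly_Mapping.map.rep_eq when_def)

lemma keys_scale_free: "Poly_Mapping.keys (scale_free_algebra_2 c p) \<subseteq> Poly_Mapping.keys p"
  by (auto simp: in_keys_iff lookup_scale_free)

lemma monotone_functional_add:
  "monotone_functional M N (p + q) = monotone_functional M N p + monotone_functional M N q"
  unfolding monotone_functional_def by (rule setsum_keys_plus_distrib) (simp_all add: algebra_simps)

lemma monotone_functional_single:
  "monotone_functional M N (Poly_Mapping.single w c) = c * monotone_word M N (letters w)"
  by (simp add: monotone_functional_def)

lemma monotone_functional_scale:
  "monotone_functional M N (scale_free_algebra_2 c p) = c * monotone_functional M N p"
proof -
  have "monotone_functional M N (scale_free_algebra_2 c p) =
    (\<Sum>w\<in>Poly_Mapping.keys p. Poly_Mapping.lookup (scale_free_algebra_2 c p) w * monotone_word M N (letters w))"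
    unfolding monotone_functional_def
    by (rule sum.mono_neutral_left) (use keys_scale_free in \<open>auto simp: in_keys_iff\<close>)
  then show ?thesis
    by (simp add: lookup_scale_free monotone_functional_def sum_distrib_left mult.assoc)
qed

lemma monotone_functional_unital:
  assumes "M 0 = 1" "N 0 = 1"
  shows "unital_functional scale_free_algebra_2 (monotone_functional M N)"
proof -
  have "monotone_functional M N 1 = 1"
    using monotone_word_replicate(1) [where n = 0 and M = M and N = N, OF assms] assms(1)
    by (simp flip: single_one add: monotone_functional_single zero_free_monoid_def)
  then show ?thesis
    by (simp add: unital_functional_def free_algebra.functional_iff monotone_functional_add
        monotone_functional_scale)
qed

lemma free_letter_power: "free_letter c ^ n = Poly_Mapping.single (Free_Monoid (replicate n c)) 1"
proof (induction n)
  case 0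
  then show ?case by (simp flip: single_one add: zero_free_monoid_def)
next
  case (Suc n)
  then show ?case by (simp add: free_letter_def mult_single plus_free_monoid_def)
qed

text \<open>The nonunital subalgebra generated by a letter consists of polynomials without constant term.\<close>

lemma hull_free_letter:
  assumes "p \<in> subalgebra scale_free_algebra_2 hull {free_letter c}" "w \<in> Poly_Mapping.keys p"
  shows "\<exists>n. letters w = replicate (Suc n) c"
proof -
  let ?S = "{p :: free_algebra_2. \<forall>w\<in>Poly_Mapping.keys p. \<exists>n. letters w = replicate (Suc n) c}"
  have mult: "\<exists>n. letters w = replicate (Suc n) c"
    if pq: "p \<in> ?S" "q \<in> ?S" and w: "w \<in> Poly_Mapping.keys (p * q)" for p q w
  proof -
    obtain u v where "w = u + v" "u \<in> Poly_Mapping.keys p" "v \<in> Poly_Mapping.keys q"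
      using w keys_mult [of p q] by blast
    moreover from this pq obtain m n where "letters u = replicate (Suc m) c" "letters v = replicate (Suc n) c"
      by blast
    ultimately have "letters w = replicate (Suc (m + Suc n)) c"
      by (simp add: plus_free_monoid_def flip: replicate_add replicate_Suc)
    then show ?thesis by blast
  qed
  have "subalgebra scale_free_algebra_2 ?S"
    unfolding subalgebra_def free_algebra.subspace_def
  proof (intro conjI ballI allI)
    show "p + q \<in> ?S" if "p \<in> ?S" "q \<in> ?S" for p q using that keys_add [of p q] by blast
    show "scale_free_algebra_2 a p \<in> ?S" if "p \<in> ?S" for a p using that keys_scale_free [of a p] by blast
    show "p * q \<in> ?S" if "p \<in> ?S" "q \<in> ?S" for p q using mult [OF that] by blast
  qed simp
  moreover have "free_letter c \<in> ?S" by (auto simp: free_letter_def intro: exI [of _ 0])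
  ultimately have "subalgebra scale_free_algebra_2 hull {free_letter c} \<subseteq> ?S"
    by (intro hull_minimal) auto
  then show ?thesis using assms by blast
qed

text \<open>By linearity in each of the three factors this is the statement about words.\<close>

lemma monotone_functional_peak:
  assumes N: "M 0 = 1" "N 0 = 1"
    and u: "\<And>w. w \<in> Poly_Mapping.keys u \<Longrightarrow> letters w = [] \<or> last (letters w)"
    and a: "\<And>w. w \<in> Poly_Mapping.keys a \<Longrightarrow> \<exists>n. letters w = replicate n False"
    and v: "\<And>w. w \<in> Poly_Mapping.keys v \<Longrightarrow> letters w = [] \<or> hd (letters w)"
  shows "monotone_functional M N (u * a * v) = monotone_functional M N a * monotone_functional M N (u * v)"
proof -
  let ?\<phi> = "monotone_functional M N"
  have zero: "?\<phi> 0 = 0" by (simp add: monotone_functional_def)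
  note simps = zero monotone_functional_add distrib_left distrib_right
  show ?thesis
  proof (rule poly_mapping_single_induct [where p = u])
    fix k1 c1 assume k1: "k1 \<in> Poly_Mapping.keys u"
    show "?\<phi> (Poly_Mapping.single k1 c1 * a * v) = ?\<phi> a * ?\<phi> (Poly_Mapping.single k1 c1 * v)"
    proof (rule poly_mapping_single_induct [where p = a])
      fix k2 c2 assume k2: "k2 \<in> Poly_Mapping.keys a"
      show "?\<phi> (Poly_Mapping.single k1 c1 * Poly_Mapping.single k2 c2 * v) =
        ?\<phi> (Poly_Mapping.single k2 c2) * ?\<phi> (Poly_Mapping.single k1 c1 * v)"
      proof (rule poly_mapping_single_induct [where p = v])
        fix k3 c3 assume k3: "k3 \<in> Poly_Mapping.keys v"
        obtain n where n: "letters k2 = replicate n False" using a [OF k2] by blast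
        have word: "monotone_word M N (letters k1 @ replicate n False @ letters k3) =
          N n * monotone_word M N (letters k1 @ letters k3)"
          using u [OF k1] v [OF k3] by (intro monotone_word_peak N) auto
        show "?\<phi> (Poly_Mapping.single k1 c1 * Poly_Mapping.single k2 c2 * Poly_Mapping.single k3 c3) =
          ?\<phi> (Poly_Mapping.single k2 c2) * ?\<phi> (Poly_Mapping.single k1 c1 * Poly_Mapping.single k3 c3)"
          using word by (simp add: mult_single monotone_functional_single plus_free_monoid_def n
              monotone_word_replicate [where M = M and N = N, OF N])
      qed (simp_all add: simps)
    qed (simp_all add: simps)
  qed (simp_all add: simps)
qed

text \<open>A local maximum with the smaller index has no neighbours at all; one with the larger index has only
neighbours from the subalgebra of \<open>x\<close>, so the words on its left end with \<open>x\<close> and those on its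
right start with \<open>x\<close>.\<close>

lemma monotone_functional_independent:
  assumes N: "M 0 = 1" "N 0 = 1"
  shows "monotone_independent (monotone_functional M N)
    (monotone_family scale_free_algebra_2 (free_letter True) (free_letter False)) {1, 2}"
  unfolding monotone_independent_def
proof (intro allI impI, elim conjE)
  fix xs :: "free_algebra_2 list" and "is" :: "nat list" and l
  let ?\<phi> = "monotone_functional M N"
  let ?A = "monotone_family scale_free_algebra_2 (free_letter True) (free_letter False)"
  assume len: "length is = length xs" and set: "set is \<subseteq> {1, 2}"
    and A: "\<forall>j<length xs. xs ! j \<in> ?A (is ! j)" and l: "l < length xs"
    and left: "0 < l \<longrightarrow> is ! (l - 1) < is ! l" and right: "Suc l < length xs \<longrightarrow> is ! Suc l < is ! l"
  have idx: "is ! j = 1 \<or> is ! j = 2" if "j < length xs" for j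
  proof -
    have "is ! j \<in> set is" using that len by simp
    then show ?thesis using set by blast
  qed
  show "?\<phi> (prod_list xs) = ?\<phi> (xs ! l) * ?\<phi> (prod_list (take l xs @ drop (Suc l) xs))"
  proof (cases "is ! l = 1")
    case True
    have "l = 0" using left idx [of "l - 1"] True l by (cases l) auto
    moreover have "\<not> Suc l < length xs" using right idx [of "Suc l"] True by auto
    ultimately obtain a where "xs = [a]" using l by (cases xs) auto
    moreover have "?\<phi> 1 = 1" using monotone_functional_unital [where M = M and N = N, OF N] by (simp add: unital_functional_def)
    ultimately show ?thesis using \<open>l = 0\<close> by simp
  next
    case False
    then have two: "is ! l = 2" using idx [OF l] by simp
    have one: "xs ! j \<in> subalgebra scale_free_algebra_2 hull {free_letter True}"
      if "j < length xs" "is ! j < is ! l" for j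
      using A that idx [OF that(1)] two by (auto simp: monotone_family_def)
    have "?\<phi> (prod_list (take l xs) * xs ! l * prod_list (drop (Suc l) xs)) =
      ?\<phi> (xs ! l) * ?\<phi> (prod_list (take l xs) * prod_list (drop (Suc l) xs))"
    proof (rule monotone_functional_peak)
      fix w assume w: "w \<in> Poly_Mapping.keys (prod_list (take l xs))"
      show "letters w = [] \<or> last (letters w)"
      proof (cases l)
        case 0
        then show ?thesis using w by (simp add: zero_free_monoid_def)
      next
        case (Suc m)
        then have "prod_list (take l xs) = prod_list (take m xs) * xs ! m"
          using l by (simp add: take_Suc_conv_app_nth)
        then obtain u v where uv: "w = u + v" "v \<in> Poly_Mapping.keys (xs ! m)"
          using w keys_mult [of "prod_list (take m xs)" "xs ! m"] by auto
        have "xs ! m \<in> subalgebra scale_free_algebra_2 hull {free_letter True}"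
          using one [of m] left l Suc by simp
        then obtain n where "letters v = replicate (Suc n) True" using uv(2) hull_free_letter by blast
        then show ?thesis using uv(1) by (simp add: plus_free_monoid_def)
      qed
    next
      have "xs ! l \<in> subalgebra scale_free_algebra_2 hull {free_letter False}"
        using A l two by (auto simp: monotone_family_def)
      then show "\<exists>n. letters w = replicate n False" if "w \<in> Poly_Mapping.keys (xs ! l)" for w
        using hull_free_letter that by blast
    next
      fix w assume w: "w \<in> Poly_Mapping.keys (prod_list (drop (Suc l) xs))"
      show "letters w = [] \<or> hd (letters w)"
      proof (cases "Suc l < length xs")
        case False
        then show ?thesis using w by (simp add: zero_free_monoid_def)
      next
        case True
        then have "prod_list (drop (Suc l) xs) = xs ! Suc l * prod_list (drop (Suc (Suc l)) xs)"
          by (metis Cons_nth_drop_Suc prod_list.Cons)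
        then obtain u v where uv: "w = u + v" "u \<in> Poly_Mapping.keys (xs ! Suc l)"
          using w keys_mult [of "xs ! Suc l" "prod_list (drop (Suc (Suc l)) xs)"] by auto
        have "xs ! Suc l \<in> subalgebra scale_free_algebra_2 hull {free_letter True}"
          using one [of "Suc l"] right True by simp
        then obtain n where "letters u = replicate (Suc n) True" using uv(2) hull_free_letter by blast
        then show ?thesis using uv(1) by (simp add: plus_free_monoid_def)
      qed
    qed (fact N)+
    moreover have "prod_list xs = prod_list (take l xs) * xs ! l * prod_list (drop (Suc l) xs)"
      using id_take_nth_drop [OF l] by (metis mult.assoc prod_list.Cons prod_list.append)
    ultimately show ?thesis by simp
  qed
qed

text \<open>The free algebra with \<open>monotone_functional\<close> shows that a monotone sum exists, \<open>monotone_moments\<close> that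
its moments are determined.\<close>

theorem monotone_conv_moments:
  assumes "is_distribution \<nu>1" "is_distribution \<nu>2"
  shows "is_distribution (monotone_conv \<nu>1 \<nu>2)"
    and "moment (monotone_conv \<nu>1 \<nu>2) n = word_conv (\<lambda>w. moment \<nu>1 (length w))
      (\<lambda>w. moment \<nu>2 (length w)) (\<lambda>w. moment \<nu>2 (length w)) (replicate n ())"
proof -
  let ?\<phi> = "monotone_functional (moment \<nu>1) (moment \<nu>2)"
  let ?x = "free_letter True" and ?y = "free_letter False"
  let ?s = "\<lambda>n. word_conv (\<lambda>w. moment \<nu>1 (length w))
      (\<lambda>w. moment \<nu>2 (length w)) (\<lambda>w. moment \<nu>2 (length w)) (replicate n ())"
  have N: "moment \<nu>1 0 = 1" "moment \<nu>2 0 = 1" using assms by (simp_all only: moment_0)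
  note \<phi> = monotone_functional_unital [where M = "moment \<nu>1" and N = "moment \<nu>2", OF N]
  have x: "?\<phi> (?x ^ n) = moment \<nu>1 n" and y: "?\<phi> (?y ^ n) = moment \<nu>2 n" for n
    using monotone_word_replicate [where M = "moment \<nu>1" and N = "moment \<nu>2", OF N]
    by (simp_all add: free_letter_power monotone_functional_single)
  note mono = monotone_functional_independent [where M = "moment \<nu>1" and N = "moment \<nu>2", OF N]
  have moments: "moment \<nu> n = ?s n" if sum: "monotone_sum scale_free_algebra_2 \<nu>1 \<nu>2 \<nu>" for \<nu> n
  proof -
    obtain \<phi> x y where "nc_prob_space scale_free_algebra_2 \<phi>" "has_distribution \<phi> x \<nu>1"
      "has_distribution \<phi> y \<nu>2" "monotone_independent \<phi> (monotone_family scale_free_algebra_2 x y) {1, 2}"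
      "has_distribution \<phi> (x + y) \<nu>"
      using sum unfolding monotone_sum_iff by blast
    then show ?thesis
      using free_algebra.monotone_moments [of \<phi> x "moment \<nu>1" y "moment \<nu>2" n]
      by (simp add: nc_prob_space_def has_distribution_def)
  qed
  obtain \<nu> where \<nu>: "is_distribution \<nu>" "\<And>n. moment \<nu> n = ?s n"
    by (rule distribution_with_moments [of ?s]) (use N in simp_all)
  have "monotone_sum scale_free_algebra_2 \<nu>1 \<nu>2 \<nu>"
    unfolding monotone_sum_iff
  proof (intro exI conjI)
    show "nc_prob_space scale_free_algebra_2 ?\<phi>"
      using \<phi> complex_algebra_free by (simp add: nc_prob_space_def)
    show "has_distribution ?\<phi> ?x \<nu>1" "has_distribution ?\<phi> ?y \<nu>2"
      using assms x y by (simp_all add: has_distribution_def)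
    show "monotone_independent ?\<phi> (monotone_family scale_free_algebra_2 ?x ?y) {1, 2}" by (fact mono)
    show "has_distribution ?\<phi> (?x + ?y) \<nu>"
      using \<nu> free_algebra.monotone_moments [OF \<phi> x y mono] by (simp add: has_distribution_def)
  qed
  moreover have "is_distribution \<nu>'" if "monotone_sum scale_free_algebra_2 \<nu>1 \<nu>2 \<nu>'" for \<nu>'
    using that by (auto simp: monotone_sum_def has_distribution_def)
  ultimately have "monotone_conv \<nu>1 \<nu>2 = \<nu>"
    unfolding monotone_conv_def
    by (intro the_equality) (auto intro!: distribution_eqI simp: moments)
  then show "is_distribution (monotone_conv \<nu>1 \<nu>2)" "moment (monotone_conv \<nu>1 \<nu>2) n = ?s n"
    using \<nu> by simp_all
qed

section \<open>Extensions evaluated on the sum of the variables\<close>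

text \<open>Expand the sums from the left: as soon as a letter \<open>b\<close> is chosen, the value is \<open>0\<close>, whatever
follows.\<close>

lemma (in complex_algebra) extension_on_sum:
  assumes p: "multilinear scale p" and vanish: "\<And>w. set w \<subseteq> L \<Longrightarrow> \<exists>z\<in>set w. z \<noteq> a \<Longrightarrow> p w = 0"
    and "a \<in> L" "b \<in> L" "a \<noteq> b"
  shows "p (replicate n (a + b)) = p (replicate n a)"
proof -
  have zero: "p (u @ replicate n (a + b)) = 0" if "set u \<subseteq> L" "\<exists>z\<in>set u. z \<noteq> a" for u n
    using that
  proof (induction n arbitrary: u)
    case (Suc n)
    then show ?case
      using Suc.IH [of "u @ [a]"] Suc.IH [of "u @ [b]"] assms(3,4) by (simp add: multilinearD [OF p])
  qed (simp add: vanish)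
  have "p (replicate m a @ replicate n (a + b)) = p (replicate (m + n) a)" for m
  proof (induction n arbitrary: m)
    case (Suc n)
    have "p (replicate m a @ replicate (Suc n) (a + b)) =
      p (replicate m a @ a # replicate n (a + b)) + p (replicate m a @ b # replicate n (a + b))"
      by (simp add: multilinearD [OF p])
    moreover have "p (replicate m a @ b # replicate n (a + b)) = 0"
    proof -
      have "set (replicate m a @ [b]) \<subseteq> L" using assms(3,4) by auto
      then show ?thesis using zero [of "replicate m a @ [b]" n] assms(5) by simp
    qed
    moreover have "replicate m a @ a # v = replicate (Suc m) a @ v" for v
      by (simp add: replicate_app_Cons_same)
    ultimately show ?case using Suc.IH [of "Suc m"] by simp
  qed simp
  from this [of 0] show ?thesis by simp
qed

lemma (in complex_algebra) is_extensionE: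
  assumes "is_extension scale L a \<mu> \<Phi>" "is_distribution \<mu>" "a \<in> L" "b \<in> L" "a \<noteq> b"
  obtains p where "\<Phi> = character_of p" "multilinear scale p" "p [] = 1"
    "\<And>n. p (replicate n (a + b)) = moment \<mu> n"
proof -
  have \<Phi>: "\<Phi> \<in> characters scale" "\<And>n. n \<ge> 1 \<Longrightarrow> \<Phi> [replicate n a] = moment \<mu> n"
    "\<And>w. set w \<subseteq> L \<Longrightarrow> \<exists>x\<in>set w. x \<noteq> a \<Longrightarrow> \<Phi> [w] = 0"
    using assms(1) unfolding is_extension_def takes_moments_def by blast+
  obtain p where p: "p [] = 1" "multilinear scale p" "\<Phi> = character_of p"
    using \<Phi>(1) by (rule charactersE)
  have word: "\<Phi> [w] = p w" if "w \<noteq> []" for w using that p(3) by (simp add: character_of_def)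
  have "p w = 0" if "set w \<subseteq> L" "\<exists>x\<in>set w. x \<noteq> a" for w
    using \<Phi>(3) [OF that] word [of w] that(2) by (cases w) auto
  then have "p (replicate n (a + b)) = p (replicate n a)" for n
    using p(2) assms by (intro extension_on_sum) auto
  moreover have "p (replicate n a) = moment \<mu> n" for n
    using \<Phi>(2) [of n] word [of "replicate n a"] p(1) moment_0 [OF assms(2)] by (cases n) auto
  ultimately show thesis using p by (intro that [of p]) auto
qed

theorem theorem5p4:
  fixes scale :: "complex \<Rightarrow> 'a::ring_1 \<Rightarrow> 'a"
    and \<phi> \<psi> :: "'a \<Rightarrow> complex"
    and a1 a2 :: 'a and L :: "'a set"
    and \<mu>1 \<nu>1 \<mu>2 \<nu>2 \<mu> \<nu> :: distribution
    and \<Phi>1 \<Psi>1 \<Phi>2 \<Psi>2 \<Phi> \<Psi> :: "'a form"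
  assumes "cond_nc_prob_space scale \<phi> \<psi>"
    and "has_distribution \<phi> a1 \<mu>1" and "has_distribution \<psi> a1 \<nu>1"
    and "has_distribution \<phi> a2 \<mu>2" and "has_distribution \<psi> a2 \<nu>2"
    and "a1 \<in> L" and "a2 \<in> L" and "a1 \<noteq> a2" and "module.span scale L = UNIV"
    and "is_extension scale L a1 \<mu>1 \<Phi>1" and "is_extension scale L a1 \<nu>1 \<Psi>1"
    and "is_extension scale L a2 \<mu>2 \<Phi>2" and "is_extension scale L a2 \<nu>2 \<Psi>2"
    and "(\<Phi>, \<Psi>) = cmonotone_char_conv scale (\<Phi>1, \<Psi>1) (\<Phi>2, \<Psi>2)"
    and "(\<mu>, \<nu>) = cmonotone_conv (\<mu>1, \<nu>1) (\<mu>2, \<nu>2)"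
  shows "takes_moments scale (a1 + a2) \<mu> \<Phi> \<and> takes_moments scale (a1 + a2) \<nu> \<Psi>"
proof -
  interpret complex_algebra scale
    using assms(1) by (simp add: cond_nc_prob_space_def nc_prob_space_def)
  have dist: "is_distribution \<mu>1" "is_distribution \<nu>1" "is_distribution \<mu>2" "is_distribution \<nu>2"
    using assms(2-5) by (simp_all add: has_distribution_def)
  have \<mu>\<nu>: "\<mu> = cfree_conv \<mu>1 delta0 \<nu>2 \<mu>2" "\<nu> = monotone_conv \<nu>1 \<nu>2"
    using assms(15) by simp_all
  let ?a = "a1 + a2"
  obtain p1 where p1: "\<Phi>1 = character_of p1" "multilinear scale p1" "p1 [] = 1"
    "\<And>n. p1 (replicate n ?a) = moment \<mu>1 n"
    using assms(10) dist(1) assms(6,7,8) by (rule is_extensionE) blast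
  obtain r1 where r1: "\<Psi>1 = character_of r1" "multilinear scale r1" "r1 [] = 1"
    "\<And>n. r1 (replicate n ?a) = moment \<nu>1 n"
    using assms(11) dist(2) assms(6,7,8) by (rule is_extensionE) blast
  obtain p2 where p2: "\<Phi>2 = character_of p2" "multilinear scale p2" "p2 [] = 1"
    "\<And>n. p2 (replicate n (a2 + a1)) = moment \<mu>2 n"
    using assms(12) dist(3) assms(7,6) assms(8) [symmetric]
    by (rule is_extensionE) blast
  obtain r2 where r2: "\<Psi>2 = character_of r2" "multilinear scale r2" "r2 [] = 1"
    "\<And>n. r2 (replicate n (a2 + a1)) = moment \<nu>2 n"
    using assms(13) dist(4) assms(7,6) assms(8) [symmetric]
    by (rule is_extensionE) blast
  have p2a: "p2 (replicate n ?a) = moment \<mu>2 n" and r2a: "r2 (replicate n ?a) = moment \<nu>2 n" for n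
    using p2(4) r2(4) by (simp_all add: add.commute)
  obtain q b1 b2 where \<Psi>: "\<Psi> = character_of (word_conv r1 r2 r2)" "\<Psi> \<in> characters scale"
    and \<Phi>: "\<Phi> = character_of q" "\<Phi> \<in> characters scale"
    and q: "q [] = 1" "\<And>w. w \<noteq> [] \<Longrightarrow> q w = prefix_conv (\<lambda>u. b2 u + bridge_conv b1 r2 empty_word u) q w"
    and b1: "\<And>w. w \<noteq> [] \<Longrightarrow> p1 w = prefix_conv b1 p1 w"
    and b2: "\<And>w. w \<noteq> [] \<Longrightarrow> p2 w = prefix_conv b2 p2 w"
    using p1(1-3) p2(1-3) r1(1-3) r2(1-3) assms(14) by (rule cmonotone_char_conv_words) blast
  have "\<Phi> [replicate n ?a] = moment \<mu> n" if "n \<ge> 1" for n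
    using cfree_conv_words [where ?p1.0 = p1 and ?p2.0 = p2 and ?r2.0 = r2 and q = q, OF dist(1,3,4) p1(4) p2a r2a b1 b2 q that] that
    by (simp add: \<Phi>(1) \<mu>\<nu>(1) character_of_def)
  moreover have "\<Psi> [replicate n ?a] = moment \<nu> n" if "n \<ge> 1" for n
    using monotone_conv_moments(2) [OF dist(2,4), of n] that
      replicate_restrict_conv [of r1 r2 r2 n ?a "()"]
    by (simp add: \<Psi>(1) \<mu>\<nu>(2) character_of_def r1(4) r2a)
  ultimately show ?thesis
    using \<Phi>(2) \<Psi>(2) by (simp add: takes_moments_def)
qed

end
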